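(* Let $G$ be a graph on $n$ vertices with maximum degree $\Delta$, whose vertex set is partitioned into $k$ blocks each of size $b$. If $b\ge5\Delta$, then $G$ has a strong coloring with respect to this partition, and one can be found by a randomized algorithm in expected time $O(n^2\Delta^2)$.
   Context: A strong coloring of $G$ with respect to the partition $V=V_1\sqcup\dots\sqcup V_k$ into blocks of size $b$ is a coloring of the vertices with the colors $\{1,\dots,b\}$ such that every block receives all $b$ colors (i.e. the vertices of each block have distinct colors) and no edge has both endpoints of the same color. *)

theory Defs
  imports "HOL-Probability.Probability"
begin

section \<open>Strong colorings\<close>

definition simple_graph :: "'a set \<Rightarrow> 'a set set \<Rightarrow> bool" where
  "simple_graph V E \<longleftrightarrow> finite V \<and> (\<forall>e\<in>E. \<exists>u v. u \<in> V \<and> v \<in> V \<and> u \<noteq> v \<and> e = {u, v})"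

definition degree :: "'a set set \<Rightarrow> 'a \<Rightarrow> nat" where
  "degree E v = card {e \<in> E. v \<in> e}"

text \<open>Inserting 0 only matters for the graph without vertices, whose maximum degree is 0.\<close>

definition max_degree :: "'a set \<Rightarrow> 'a set set \<Rightarrow> nat" where
  "max_degree V E = Max (insert 0 (degree E ` V))"

definition block_partition :: "'a set \<Rightarrow> nat \<Rightarrow> nat \<Rightarrow> (nat \<Rightarrow> 'a set) \<Rightarrow> bool" where
  "block_partition V k b B \<longleftrightarrow>
     (\<Union>i\<in>{1..k}. B i) = V \<and> disjoint_family_on B {1..k} \<and> (\<forall>i\<in>{1..k}. card (B i) = b)"

definition strong_coloring ::
  "'a set \<Rightarrow> 'a set set \<Rightarrow> nat \<Rightarrow> nat \<Rightarrow> (nat \<Rightarrow> 'a set) \<Rightarrow> ('a \<Rightarrow> nat) \<Rightarrow> bool" where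
  "strong_coloring V E k b B f \<longleftrightarrow>
     f \<in> V \<rightarrow> {1..b} \<and>
     (\<forall>i\<in>{1..k}. f ` B i = {1..b}) \<and>
     (\<forall>u v. {u, v} \<in> E \<longrightarrow> f u \<noteq> f v)"

section \<open>A randomized word RAM\<close>

text \<open>
  Running times refer to a word RAM with uniform cost, programmed by structured while programs.
  The memory consists of named words and named arrays of words; the words are the numbers
  below \<open>W\<close>, and sums and products wrap around. Every evaluation of an operator, a
  constant or a memory access costs one time unit. Besides the deterministic operations, there is a
  unit-cost instruction drawing an integer uniformly at random from \<open>{..<r}\<close>.
\<close>

datatype binop = Plus | Minus | Times | Div | Mod | Less | Eq

datatype exp =
    Const nat
  | Var string
  | Arr string exp
  | Op binop exp exp

datatype com =
    Skip
  | Assign string exp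
  | Store string exp exp
  | Draw string exp
  | Seq com com
  | If exp com com
  | While exp com

record mem =
  vars :: "string \<Rightarrow> nat"
  arrs :: "string \<Rightarrow> nat \<Rightarrow> nat"

primrec apply_op :: "nat \<Rightarrow> binop \<Rightarrow> nat \<Rightarrow> nat \<Rightarrow> nat" where
  "apply_op W Plus x y = (x + y) mod W"
| "apply_op W Minus x y = x - y"
| "apply_op W Times x y = (x * y) mod W"
| "apply_op W Div x y = x div y"
| "apply_op W Mod x y = x mod y"
| "apply_op W Less x y = (if x < y then 1 else 0)"
| "apply_op W Eq x y = (if x = y then 1 else 0)"

primrec eval_exp :: "nat \<Rightarrow> mem \<Rightarrow> exp \<Rightarrow> nat" where
  "eval_exp W s (Const c) = c mod W"
| "eval_exp W s (Var x) = vars s x"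
| "eval_exp W s (Arr a e) = arrs s a (eval_exp W s e)"
| "eval_exp W s (Op f e1 e2) = apply_op W f (eval_exp W s e1) (eval_exp W s e2)"

primrec exp_cost :: "exp \<Rightarrow> nat" where
  "exp_cost (Const c) = 1"
| "exp_cost (Var x) = 1"
| "exp_cost (Arr a e) = 1 + exp_cost e"
| "exp_cost (Op f e1 e2) = 1 + exp_cost e1 + exp_cost e2"

definition set_var :: "string \<Rightarrow> nat \<Rightarrow> mem \<Rightarrow> mem" where
  "set_var x c s = s\<lparr>vars := (vars s)(x := c)\<rparr>"

definition set_arr :: "string \<Rightarrow> nat \<Rightarrow> nat \<Rightarrow> mem \<Rightarrow> mem" where
  "set_arr a i c s = s\<lparr>arrs := (arrs s)(a := (arrs s a)(i := c))\<rparr>"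

partial_function (spmf) while_spmf :: "('s \<Rightarrow> bool) \<Rightarrow> ('s \<Rightarrow> 's spmf) \<Rightarrow> 's \<Rightarrow> 's spmf" where
  "while_spmf P f s = (if P s then bind_spmf (f s) (while_spmf P f) else return_spmf s)"

text \<open>
  A configuration pairs the memory with the time elapsed so far. The mass that \<open>run\<close> puts
  on \<open>None\<close> is the probability of not halting properly: either by running forever or by
  drawing from the empty range, where \<open>spmf_of_set {}\<close> has no mass on proper outcomes.
  The loop is entered with its first guard evaluation already paid for, and each
  execution of the body pays for the guard evaluation that follows it.
\<close>

primrec run :: "nat \<Rightarrow> com \<Rightarrow> mem \<times> nat \<Rightarrow> (mem \<times> nat) spmf" where
  "run W Skip = (\<lambda>(s, t). return_spmf (s, t + 1))"
| "run W (Assign x e) =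
     (\<lambda>(s, t). return_spmf (set_var x (eval_exp W s e) s, t + 1 + exp_cost e))"
| "run W (Store a e1 e2) =
     (\<lambda>(s, t). return_spmf
        (set_arr a (eval_exp W s e1) (eval_exp W s e2) s, t + 1 + exp_cost e1 + exp_cost e2))"
| "run W (Draw x e) =
     (\<lambda>(s, t). map_spmf (\<lambda>r. (set_var x r s, t + 1 + exp_cost e))
                          (spmf_of_set {..<eval_exp W s e}))"
| "run W (Seq c1 c2) = (\<lambda>\<sigma>. bind_spmf (run W c1 \<sigma>) (run W c2))"
| "run W (If e c1 c2) =
     (\<lambda>(s, t). if eval_exp W s e \<noteq> 0
                 then run W c1 (s, t + 1 + exp_cost e)
                 else run W c2 (s, t + 1 + exp_cost e))"
| "run W (While e c) =
     (\<lambda>(s, t). while_spmf (\<lambda>(s, t). eval_exp W s e \<noteq> 0)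
                 (\<lambda>\<sigma>. map_spmf (\<lambda>(s, t). (s, t + 1 + exp_cost e)) (run W c \<sigma>))
                 (s, t + 1 + exp_cost e))"

text \<open>A run that does not halt properly counts as taking infinite time.\<close>

definition expected_time :: "(mem \<times> nat) spmf \<Rightarrow> ennreal" where
  "expected_time r =
     (\<integral>\<^sup>+ \<omega>. (case \<omega> of None \<Rightarrow> \<infinity> | Some (s, t) \<Rightarrow> of_nat t) \<partial>measure_pmf r)"

section \<open>Representation of the input\<close>

text \<open>
  The vertices are \<open>0, \<dots>, n - 1\<close>. The edges are listed once each, in any order
  and with endpoints in either order, in the arrays \<open>src\<close> and \<open>dst\<close>, and the array \<open>block\<close> gives
  the index of the block of each vertex.
\<close>

definition edge_list :: "nat set set \<Rightarrow> (nat \<times> nat) list \<Rightarrow> bool" where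
  "edge_list E es \<longleftrightarrow>
     distinct (map (\<lambda>(u, v). {u, v}) es) \<and> set (map (\<lambda>(u, v). {u, v}) es) = E"

definition block_list :: "nat \<Rightarrow> nat \<Rightarrow> (nat \<Rightarrow> nat set) \<Rightarrow> nat list \<Rightarrow> bool" where
  "block_list n k B bs \<longleftrightarrow>
     length bs = n \<and> (\<forall>v<n. bs ! v \<in> {1..k} \<and> v \<in> B (bs ! v))"

definition array_of :: "nat list \<Rightarrow> nat \<Rightarrow> nat" where
  "array_of xs i = (if i < length xs then xs ! i else 0)"

definition input_mem :: "nat \<Rightarrow> nat \<Rightarrow> nat \<Rightarrow> (nat \<times> nat) list \<Rightarrow> nat list \<Rightarrow> mem" where
  "input_mem n k b es bs =
     \<lparr>vars = (\<lambda>_. 0)(''n'' := n, ''k'' := k, ''b'' := b, ''m'' := length es),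
      arrs = (\<lambda>_ _. 0)(''src'' := array_of (map fst es),
                        ''dst'' := array_of (map snd es),
                        ''block'' := array_of bs)\<rparr>"

text \<open>
  Words have \<open>O(log (n + k + b))\<close> bits: for a constant \<open>d\<close> depending on the program only,
  \<open>W\<close> is the \<open>d\<close>-th power of the following number. If there are any vertices,
  then \<open>k, b \<le> n\<close>.
\<close>

definition word_base :: "nat \<Rightarrow> nat \<Rightarrow> nat \<Rightarrow> nat" where
  "word_base n k b = n + k + b + 2"

end

theory Submission
  imports Defs
begin

text \<open>
  Keep a colouring that is a bijection on every block and process the vertices one by one, so that
  no edge between processed vertices is monochromatic. To process \<open>v\<close>, of colour \<open>c\<close>, let \<open>w\<^sub>i\<close> be the
  vertex of colour \<open>c\<close> in block \<open>i\<close>, and exchange the colours of \<open>w\<^sub>i\<close> and \<open>x\<^sub>i\<close> in every block, where the \<open>x\<^sub>i\<close>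
  form an independent transversal through \<open>v\<close> such that the colour of \<open>x\<^sub>i\<close> does not occur among the neighbours
  of \<open>w\<^sub>i\<close>. The latter leaves at least \<open>b - \<Delta> \<ge> 4 \<Delta>\<close> candidates in every block.

  The transversal is found by filling the blocks from a stack, with the block of \<open>v\<close> at the
  bottom: draw a random candidate for the top block; if it has a chosen neighbour, remove the choice
  of that neighbour and push its block, and otherwise keep the candidate and pop. A failed step is
  described by an edge and forgets two uniform choices, so a given sequence of failures is
  unlikely; summing over all sequences bounds the exponential moment of the number of failures, and
  hence the expected number of steps by \<open>O (k \<Delta>\<^sup>2)\<close>.
\<close>

section \<open>A random walk towards independent transversals\<close>

text \<open>With a = 4 D, a block has at most 4 D^2 edges that can describe a failure, each of
  probability 1 / a^2. The weight g of all failure sequences that start from a block then satisfies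
  g = 1 + g^2 / 4. This is the critical case: g = 2 is a double root, and nothing is left over for
  counting failures with a factor above 1. The slack comes from the edge between a block blanked by
  a failure and the block below it, which is still blank, so that this edge cannot describe the next
  failure. One edge out of 4 D^2 is a relative gain of order 1 / D^2, hence the factor \<Delta>^2 in
  the number of steps. The block of \<open>v\<close> lies at the bottom of the stack because
  \<open>v\<close> is its only choice: removing that choice would forget no randomness. At the
  bottom it stays blank until the very last step. A step costs O(\<Delta>), so the search of a phase
  takes O(k \<Delta>^3). This is within O(n \<Delta>^2) because n = k b and b \<ge> 5 \<Delta>; the
  candidate lists cost O(n \<Delta>) per phase, and there are n phases.\<close>

locale transversal_walk =
  fixes J :: "nat set" and blk :: "nat \<Rightarrow> nat" and nb :: "nat \<Rightarrow> nat list"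
    and sel :: "nat \<Rightarrow> nat \<Rightarrow> nat" and a D i0 :: nat
  assumes finite_J: "finite J" and zero_J: "0 \<notin> J" and i0_J: "i0 \<in> J"
    and a_pos: "0 < a" and a_ge: "4 * D \<le> a"
    and blk_sel: "\<And>i r. i \<in> J \<Longrightarrow> r < a \<Longrightarrow> blk (sel i r) = i"
    and inj_sel: "\<And>i. i \<in> J \<Longrightarrow> i \<noteq> i0 \<Longrightarrow> inj_on (sel i) {..<a}"
    and blk_nb: "\<And>i r y. i \<in> J \<Longrightarrow> r < a \<Longrightarrow> y \<in> set (nb (sel i r)) \<Longrightarrow> blk y \<in> J"
    and length_nb: "\<And>i r. i \<in> J \<Longrightarrow> r < a \<Longrightarrow> length (nb (sel i r)) \<le> D"
    and sym_nb: "\<And>x y. y \<in> set (nb x) \<Longrightarrow> x \<in> set (nb y)"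
    and irrefl_nb: "\<And>x. x \<notin> set (nb x)"
begin

text \<open>By \<open>zero_J\<close>, 0 is not the number of a block and can stand for the absence
  of a conflict. Among several conflicts the last in the list counts, as in the loop of the
  program.\<close>

definition conflict :: "(nat \<Rightarrow> nat) \<Rightarrow> nat \<Rightarrow> nat" where
  "conflict \<tau> x = fold (\<lambda>y j. if \<tau> (blk y) = Suc y then blk y else j) (nb x) 0"

fun step :: "(nat \<Rightarrow> nat) \<times> nat list \<Rightarrow> nat \<Rightarrow> (nat \<Rightarrow> nat) \<times> nat list" where
  "step (\<tau>, []) r = (\<tau>, [])"
| "step (\<tau>, i # st) r =
     (let j = conflict \<tau> (sel i r) in
      if j = 0 then (\<tau>(i := Suc (sel i r)), st) else (\<tau>(j := 0), j # i # st))"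

lemma conflict_cases:
  "conflict \<tau> x = 0 \<or> (\<exists>y\<in>set (nb x). \<tau> (blk y) = Suc y \<and> conflict \<tau> x = blk y)"
proof -
  have "fold (\<lambda>y j. if \<tau> (blk y) = Suc y then blk y else j) ys j0 = j0 \<or>
    (\<exists>y\<in>set ys. \<tau> (blk y) = Suc y \<and> fold (\<lambda>y j. if \<tau> (blk y) = Suc y then blk y else j) ys j0 = blk y)"
    for ys j0
  proof (induction ys arbitrary: j0)
    case (Cons y ys)
    show ?case
    proof (cases "\<tau> (blk y) = Suc y")
      case True
      then show ?thesis using Cons[of "blk y"] by auto
    next
      case False
      then show ?thesis using Cons[of j0] by auto
    qed
  qed simp
  then show ?thesis unfolding conflict_def by blast
qed

text \<open>Block numbers are nonzero, so the accumulator cannot return to 0 once a conflict has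
  been seen.\<close>

lemma no_conflict:
  assumes "conflict \<tau> x = 0" "\<And>y. y \<in> set (nb x) \<Longrightarrow> blk y \<noteq> 0" "y \<in> set (nb x)"
  shows "\<tau> (blk y) \<noteq> Suc y"
proof -
  let ?f = "\<lambda>y j. if \<tau> (blk y) = Suc y then blk y else j"
  have nz: "j0 \<noteq> 0 \<Longrightarrow> \<forall>y\<in>set ys. blk y \<noteq> 0 \<Longrightarrow> fold ?f ys j0 \<noteq> 0" for ys j0
    by (induction ys arbitrary: j0) auto
  have "\<forall>y\<in>set ys. blk y \<noteq> 0 \<Longrightarrow> fold ?f ys 0 = 0 \<Longrightarrow> y \<in> set ys \<Longrightarrow> \<tau> (blk y) \<noteq> Suc y" for ys
  proof (induction ys)
    case (Cons y' ys)
    show ?case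
    proof (cases "\<tau> (blk y') = Suc y'")
      case True
      then show ?thesis using Cons nz[of "blk y'" ys] by auto
    next
      case False
      then show ?thesis using Cons by auto
    qed
  qed simp
  then show ?thesis using assms unfolding conflict_def by blast
qed

section \<open>Expectations over independent uniform choices\<close>

definition fill :: "nat set \<Rightarrow> (nat \<Rightarrow> nat) \<Rightarrow> nat \<Rightarrow> nat" where
  "fill F \<rho> i = (if i \<in> F then Suc (sel i (\<rho> i)) else 0)"

definition choices :: "nat set \<Rightarrow> (nat \<Rightarrow> nat) set" where
  "choices F = PiE_dflt F 0 (\<lambda>_. {..<a})"

text \<open>Expectation for independent uniform choices in the blocks of \<open>F\<close>. The
  average is over indices below \<open>a\<close> rather than over vertices, so that it also covers
  \<open>i0\<close>, where several indices may select the same vertex.\<close>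

definition avg :: "nat set \<Rightarrow> ((nat \<Rightarrow> nat) \<Rightarrow> real) \<Rightarrow> real" where
  "avg F h = (\<Sum>\<rho>\<in>choices F. h (fill F \<rho>)) / real a ^ card F"

text \<open>Blank blocks have value 0.\<close>

fun valid :: "(nat \<Rightarrow> nat) \<times> nat list \<Rightarrow> bool" where
  "valid (\<tau>, st) \<longleftrightarrow> distinct st \<and> set st \<subseteq> J \<and> (st \<noteq> [] \<longrightarrow> last st = i0) \<and>
     (\<forall>i. i \<notin> J \<or> i \<in> set st \<longrightarrow> \<tau> i = 0) \<and>
     (\<forall>i\<in>J - set st. \<exists>r<a. \<tau> i = Suc (sel i r)) \<and>
     (\<forall>i j x y. \<tau> i = Suc x \<longrightarrow> \<tau> j = Suc y \<longrightarrow> y \<notin> set (nb x))"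

lemma valid_start:
  assumes "distinct rs" "set rs = J" "last rs = i0"
  shows "valid (\<lambda>_. 0, rs)"
  using assms by auto

lemma valid_step:
  assumes v: "valid (\<tau>, st)" and r: "r < a"
  shows "valid (step (\<tau>, st) r)"
proof (cases st)
  case Nil
  then show ?thesis using v by simp
next
  case (Cons i st')
  have i: "i \<in> J" "i \<notin> set st'" using v Cons by auto
  let ?x = "sel i r"
  \<comment> \<open>A filled block holds one of its own vertices, so a chosen vertex is found
    through \<open>blk\<close>, as \<open>conflict\<close> does.\<close>
  have filled: "\<tau> j = Suc y \<Longrightarrow> j \<in> J - set st \<and> blk y = j" for j y
  proof -
    assume y: "\<tau> j = Suc y"
    then have j: "j \<in> J - set st" using v by force
    then obtain q where "q < a" "\<tau> j = Suc (sel j q)" using v unfolding valid.simps by blast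
    then show ?thesis using y j blk_sel by auto
  qed
  show ?thesis
  proof (cases "conflict \<tau> ?x = 0")
    case True
    have "blk y \<noteq> 0" if "y \<in> set (nb ?x)" for y
      using blk_nb[OF i(1) r that] zero_J by metis
    then have nc: "y \<in> set (nb ?x) \<Longrightarrow> \<tau> (blk y) \<noteq> Suc y" for y
      using no_conflict[OF True] by blast
    have free: "\<tau> j = Suc y \<Longrightarrow> y \<notin> set (nb ?x) \<and> ?x \<notin> set (nb y)" for j y
      using filled[of j y] nc[of y] sym_nb by metis
    have "valid (\<tau>(i := Suc ?x), st')"
      unfolding valid.simps
    proof (intro conjI)
      show "\<forall>j l x y. (\<tau>(i := Suc ?x)) j = Suc x \<longrightarrow> (\<tau>(i := Suc ?x)) l = Suc y \<longrightarrow> y \<notin> set (nb x)"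
        using free irrefl_nb v by (auto split: if_splits)
    qed (use v Cons i r in \<open>auto split: if_splits\<close>)
    then show ?thesis using True Cons by (simp del: valid.simps)
  next
    case False
    then obtain y where y: "\<tau> (blk y) = Suc y" "conflict \<tau> ?x = blk y"
      using conflict_cases[of \<tau> ?x] by auto
    have "valid (\<tau>(blk y := 0), blk y # st)"
      using v filled[OF y(1)] Cons by auto
    then show ?thesis using False y(2) Cons by (simp add: Let_def del: valid.simps)
  qed
qed

lemma avg_empty [simp]: "avg {} h = h (\<lambda>_. 0)"
proof -
  have "choices {} = {\<lambda>_. 0}" by (auto simp: choices_def PiE_dflt_def)
  moreover have "fill {} \<rho> = (\<lambda>_. 0)" for \<rho> by (auto simp: fill_def)
  ultimately show ?thesis by (simp add: avg_def)
qed

lemma avg_insert: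
  assumes "finite F" "i \<notin> F"
  shows "avg (insert i F) h = (\<Sum>r<a. avg F (\<lambda>\<tau>. h (\<tau>(i := Suc (sel i r))))) / real a"
proof -
  have e: "fill (insert i F) (\<rho>(i := r)) = (fill F \<rho>)(i := Suc (sel i r))" for \<rho> r
    using assms by (auto simp: fill_def fun_eq_iff)
  have "(\<Sum>\<rho>\<in>choices (insert i F). h (fill (insert i F) \<rho>)) =
        (\<Sum>(r, \<rho>)\<in>{..<a} \<times> choices F. h ((fill F \<rho>)(i := Suc (sel i r))))"
  proof (rule sum.reindex_bij_witness[where i = "\<lambda>(r, \<rho>). \<rho>(i := r)" and j = "\<lambda>\<rho>. (\<rho> i, \<rho>(i := 0))"], goal_cases)
    case (5 \<rho>)
    then show ?case using e[of "\<rho>(i := 0)" "\<rho> i"] by simp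
  next
    case 4
    then show ?case using assms by (fastforce simp: choices_def PiE_dflt_def)
  qed (use assms in \<open>auto simp: choices_def PiE_dflt_def fun_eq_iff\<close>)
  also have "\<dots> = (\<Sum>r<a. \<Sum>\<rho>\<in>choices F. h ((fill F \<rho>)(i := Suc (sel i r))))"
    by (simp add: sum.cartesian_product)
  finally show ?thesis using assms by (simp add: avg_def sum_divide_distrib mult.commute)
qed

lemma avg_cong:
  "(\<And>\<rho>. \<rho> \<in> choices F \<Longrightarrow> h (fill F \<rho>) = h' (fill F \<rho>)) \<Longrightarrow> avg F h = avg F h'"
  by (simp add: avg_def)

lemma avg_mono:
  "(\<And>\<rho>. \<rho> \<in> choices F \<Longrightarrow> h (fill F \<rho>) \<le> h' (fill F \<rho>)) \<Longrightarrow> avg F h \<le> avg F h'"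
  unfolding avg_def by (intro divide_right_mono sum_mono) auto

lemma avg_sum: "avg F (\<lambda>\<tau>. \<Sum>x\<in>A. h x \<tau>) = (\<Sum>x\<in>A. avg F (h x))"
  unfolding avg_def by (subst sum.swap) (simp add: sum_divide_distrib)

lemma avg_add: "avg F (\<lambda>\<tau>. h \<tau> + h' \<tau>) = avg F h + avg F h'"
  unfolding avg_def by (simp add: sum.distrib add_divide_distrib)

lemma avg_scale: "avg F (\<lambda>\<tau>. c * h \<tau>) = c * avg F h"
  unfolding avg_def by (simp add: sum_distrib_left)

lemma avg_divide: "avg F (\<lambda>\<tau>. h \<tau> / c) = avg F h / c"
  using avg_scale[of F "1 / c" h] by simp

lemma avg_zero [simp]: "avg F (\<lambda>_. 0) = 0"
  unfolding avg_def by simp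

lemma avg_const:
  assumes "finite F"
  shows "avg F (\<lambda>_. c) = c"
  using assms
proof (induction F rule: finite_induct)
  case (insert i F)
  then show ?case using a_pos by (simp add: avg_insert)
qed simp

text \<open>As \<open>sel j\<close> is injective, at most one index selects \<open>y\<close>. The
  event therefore has probability 1 / a or 0, and the other blocks are independent of it: forgetting
  the choice of \<open>j\<close> leaves a uniform configuration behind.\<close>

lemma avg_pinned:
  assumes F: "finite F" "j \<in> F" "F \<subseteq> J" "j \<noteq> i0" and h: "\<And>\<tau>. 0 \<le> h \<tau>"
  shows "avg F (\<lambda>\<tau>. if \<tau> j = Suc y then h (\<tau>(j := 0)) else 0)
         \<le> (if \<exists>q<a. sel j q = y then avg (F - {j}) h / real a else 0)"
proof -
  let ?F = "F - {j}"
  have F': "F = insert j ?F" using F by auto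
  have upd: "avg ?F (\<lambda>\<tau>. h (\<tau>(j := 0))) = avg ?F h"
  proof (rule avg_cong)
    fix \<rho>
    have "(fill ?F \<rho>)(j := 0) = fill ?F \<rho>" by (auto simp: fill_def)
    then show "h ((fill ?F \<rho>)(j := 0)) = h (fill ?F \<rho>)" by simp
  qed
  have eq: "avg F (\<lambda>\<tau>. if \<tau> j = Suc y then h (\<tau>(j := 0)) else 0) =
      (\<Sum>q<a. avg ?F (\<lambda>\<tau>. if sel j q = y then h (\<tau>(j := 0)) else 0)) / real a"
    by (subst F', subst avg_insert) (use F in \<open>auto cong: if_cong\<close>)
  also have "\<dots> = (\<Sum>q<a. if sel j q = y then avg ?F h else 0) / real a"
    using upd by (intro arg_cong2[where f = "(/)"] sum.cong) auto
  also have "(\<Sum>q<a. if sel j q = y then avg ?F h else 0) = (\<Sum>q\<in>{q. q < a \<and> sel j q = y}. avg ?F h)"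
    by (intro sum.mono_neutral_cong_right) auto
  also have "\<dots> = real (card {q. q < a \<and> sel j q = y}) * avg ?F h" by simp
  also have "\<dots> / real a \<le> (if \<exists>q<a. sel j q = y then avg ?F h / real a else 0)"
  proof (cases "\<exists>q<a. sel j q = y")
    case True
    then obtain q where q: "q < a" "sel j q = y" by auto
    have "inj_on (sel j) {..<a}" using inj_sel F by auto
    then have "{q. q < a \<and> sel j q = y} = {q}" using q by (auto dest!: inj_onD)
    then show ?thesis using True by simp
  next
    case False
    then have e: "{q. q < a \<and> sel j q = y} = {}" by auto
    from False have "\<not> (\<exists>q<a. sel j q = y)" by auto
    then show ?thesis unfolding e by (simp only: if_False) simp
  qed
  finally show ?thesis .
qed

section \<open>Weight of a failure and moments of the walk\<close>

definition D1 :: real where "D1 = max 1 (real D)"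
text \<open>For positive \<open>D\<close>, this is slightly below 4 D^2 / (4 D^2 - 1), the largest
  value with which \<open>nested_weight\<close> holds at a = 4 D. \<open>D1\<close> in place of
  \<open>D\<close> keeps \<open>z\<close> above 1 when \<open>D = 0\<close>.\<close>

definition z :: real where "z = 1 + 1 / (4 * D1\<^sup>2)"

lemma D1_ge: "1 \<le> D1" "real D \<le> D1" by (auto simp: D1_def)

lemma z_bounds: "1 < z" "z \<le> 5 / 4"
proof -
  have "1 \<le> D1\<^sup>2" using D1_ge(1) by simp
  then show "1 < z" "z \<le> 5 / 4" by (auto simp: z_def divide_le_eq)
qed

lemma nested_weight:
  assumes "D > 0"
  shows "4 * z * (real a * real D - 1) \<le> (real a)\<^sup>2"
proof -
  have D: "D1 = real D" "real D \<ge> 1" using assms by (auto simp: D1_def)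
  have a: "real a \<ge> 4 * real D" using a_ge by (metis of_nat_le_iff of_nat_mult of_nat_numeral)
  \<comment> \<open>After multiplication by D^2, the right-hand side minus the left-hand side is
    exactly this expression.\<close>
  have "0 \<le> (real a - 4 * real D) * (real D * (real a * real D - 1)) + 1"
  proof -
    have "1 * 1 \<le> real a * real D" using a D by (intro mult_mono) auto
    then show ?thesis using a D by (intro add_nonneg_nonneg mult_nonneg_nonneg) auto
  qed
  then have "(4 * (real D)\<^sup>2 + 1) * (real a * real D - 1) \<le> (real a)\<^sup>2 * (real D)\<^sup>2"
    by (simp add: algebra_simps power2_eq_square)
  moreover have "4 * z * (real D)\<^sup>2 = 4 * (real D)\<^sup>2 + 1"
    using D by (simp add: z_def field_simps)
  ultimately have "(4 * z * (real a * real D - 1)) * (real D)\<^sup>2 \<le> (real a)\<^sup>2 * (real D)\<^sup>2"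
    by (metis (no_types, lifting) mult.assoc mult.commute)
  then show ?thesis using D by (simp add: mult_le_cancel_right)
qed

text \<open>Expected number of steps until the stack is empty, where only the first \<open>N\<close>
  steps count. The truncation leaves termination open and has the shape that
  \<open>time_le_While\<close> asks for.\<close>

fun steps :: "nat \<Rightarrow> (nat \<Rightarrow> nat) \<times> nat list \<Rightarrow> real" where
  "steps 0 s = 0"
| "steps (Suc N) s = (if snd s = [] then 0 else 1 + (\<Sum>r<a. steps N (step s r)) / real a)"

text \<open>Expectation of \<open>z\<close> to the number of failures among the first
  \<open>N\<close> steps; a failure is recognised by the longer stack.\<close>

fun moment :: "nat \<Rightarrow> (nat \<Rightarrow> nat) \<times> nat list \<Rightarrow> real" where
  "moment 0 s = 1"
| "moment (Suc N) s = (if snd s = [] then 1 else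
     (\<Sum>r<a. (if length (snd (step s r)) > length (snd s) then z else 1) * moment N (step s r)) / real a)"

lemma moment_nonneg: "0 \<le> moment N s"
proof (induction N arbitrary: s)
  case (Suc N)
  have "0 \<le> (if length (snd (step s r)) > length (snd s) then z else 1) * moment N (step s r)" for r
    using Suc[of "step s r"] z_bounds by (intro mult_nonneg_nonneg) auto
  then show ?case by (auto intro!: divide_nonneg_nonneg sum_nonneg simp del: step.simps)
qed simp

lemma steps_nonneg: "0 \<le> steps N s"
proof (induction N arbitrary: s)
  case (Suc N)
  have "0 \<le> (\<Sum>r<a. steps N (step s r)) / real a"
    using Suc by (intro divide_nonneg_nonneg sum_nonneg) simp_all
  then show ?case by simp
qed simp

text \<open>The number of steps is the drop in stack size plus twice the number of failures; the
  failures are counted through their exponential moment by \<open>ln u \<le> u - 1\<close>.\<close>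

lemma exponent_le:
  assumes P: "0 < P"
  shows "real m \<le> (ln P - 1 + z ^ m / P) / ln z"
proof -
  have zm: "z ^ m > 0" using z_bounds by simp
  have "ln (z ^ m / P) \<le> z ^ m / P - 1" using P zm by (intro ln_le_minus_one) auto
  moreover have "ln (z ^ m / P) = real m * ln z - ln P"
    using P zm z_bounds by (simp add: ln_div ln_realpow)
  ultimately have "real m * ln z \<le> ln P - 1 + z ^ m / P" by simp
  then show ?thesis using z_bounds by (simp add: pos_le_divide_eq)
qed

text \<open>\<open>m\<close> counts the failures so far, so that a failure moves a factor
  \<open>z\<close> from \<open>moment\<close> into \<open>z ^ m\<close>. The bound is affine in the
  moment and hence survives averaging over the draws. \<open>P\<close> is free; a bound on the
  moment will be inserted, which makes the quotient at most 1.\<close>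

lemma steps_le_moment:
  assumes P: "0 < P"
  shows "steps N s \<le> real (length (snd s)) + 2 * ((ln P - 1 + z ^ m * moment N s / P) / ln z - real m)"
proof (induction N arbitrary: s m)
  case 0
  show ?case using exponent_le[OF P, of m] unfolding steps.simps moment.simps mult_1_right
    by (intro add_nonneg_nonneg mult_nonneg_nonneg) (simp_all only: diff_ge_0_iff_ge of_nat_0_le_iff zero_le_numeral)
next
  case (Suc N)
  have lz: "0 < ln z" using z_bounds by simp
  show ?case
  proof (cases "snd s")
    case Nil
    have "steps (Suc N) s = 0" "moment (Suc N) s = 1" using Nil by simp_all
    then show ?thesis using exponent_le[OF P, of m] unfolding mult_1_right
      by (simp only:) (intro add_nonneg_nonneg mult_nonneg_nonneg, simp_all only: diff_ge_0_iff_ge of_nat_0_le_iff zero_le_numeral mult_1_right)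
  next
    case (Cons i st)
    obtain \<tau> where s: "s = (\<tau>, i # st)" using Cons by (cases s) auto
    define c where "c r = (if length (snd (step s r)) > length (snd s) then z else 1)" for r
    define C where "C = real (length (snd s)) - 1 + 2 * ((ln P - 1) / ln z - real m)"
    have key: "2 * ((ln P - 1 + z ^ m' * M / P) / ln z - real m') =
        2 * ((ln P - 1) / ln z - real m') + 2 * z ^ m' / (P * ln z) * M" for m' M
      using P lz by (simp add: field_simps)
    \<comment> \<open>A success shortens the stack by 1. A failure lengthens it by 1 and raises
      \<open>m\<close>, which counts twice. Both cases lead to the same constant
      \<open>C\<close>.\<close>
    have "steps N (step s r) \<le> C + 2 * z ^ m / (P * ln z) * (c r * moment N (step s r))" for r
    proof (cases "conflict \<tau> (sel i r) = 0")
      case True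
      then show ?thesis using Suc[of "step s r" m] unfolding key
        by (simp add: s Let_def C_def c_def)
    next
      case False
      then show ?thesis using Suc[of "step s r" "Suc m"] unfolding key
        by (simp add: s Let_def C_def c_def algebra_simps)
    qed
    then have "(\<Sum>r<a. steps N (step s r)) \<le> (\<Sum>r<a. C + 2 * z ^ m / (P * ln z) * (c r * moment N (step s r)))"
      by (intro sum_mono)
    also have "\<dots> = real a * C + 2 * z ^ m / (P * ln z) * (\<Sum>r<a. c r * moment N (step s r))"
      by (simp add: sum.distrib sum_distrib_left)
    also have "\<dots> = real a * (C + 2 * z ^ m / (P * ln z) * moment (Suc N) s)"
      using a_pos Cons by (simp add: c_def field_simps)
    finally have "(\<Sum>r<a. steps N (step s r)) / real a \<le> C + 2 * z ^ m / (P * ln z) * moment (Suc N) s"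
      using a_pos by (simp add: field_simps)
    then have "steps (Suc N) s \<le> 1 + (C + 2 * z ^ m / (P * ln z) * moment (Suc N) s)"
      using Cons by simp
    also have "\<dots> = real (length (snd s)) + 2 * ((ln P - 1 + z ^ m * moment (Suc N) s / P) / ln z - real m)"
      unfolding key C_def by simp
    finally show ?thesis .
  qed
qed

section \<open>Edges that describe a failure\<close>

definition pairs :: "nat \<Rightarrow> nat set \<Rightarrow> (nat \<times> nat) set" where
  "pairs i F = (SIGMA r:{..<a}. {y \<in> set (nb (sel i r)). blk y \<in> F \<and> (\<exists>q<a. sel (blk y) q = y)})"

definition link :: "nat \<Rightarrow> nat \<Rightarrow> bool" where
  "link i j \<longleftrightarrow> (\<exists>r<a. \<exists>q<a. sel j q \<in> set (nb (sel i r)))"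

lemma link_pairs: "(r, y) \<in> pairs i F \<Longrightarrow> link (blk y) i"
  unfolding link_def pairs_def using sym_nb by fastforce

lemma card_neighbours:
  assumes "i \<in> J"
  shows "card (SIGMA r:{..<a}. set (nb (sel i r))) \<le> a * D"
proof -
  have "card (SIGMA r:{..<a}. set (nb (sel i r))) = (\<Sum>r<a. card (set (nb (sel i r))))"
    by simp
  also have "\<dots> \<le> (\<Sum>r<a. D)"
    using order_trans[OF card_length length_nb[OF assms]] by (intro sum_mono) auto
  finally show ?thesis by simp
qed

lemma card_pairs: "i \<in> J \<Longrightarrow> card (pairs i F) \<le> a * D"
  by (rule order_trans[OF card_mono card_neighbours]) (auto simp: pairs_def)

text \<open>The edge that witnesses the link ends in a block outside \<open>F\<close>, so it is
  missing from \<open>pairs i F\<close>.\<close>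

lemma card_pairs_link:
  assumes "i \<in> J" "j \<in> J" "link i j" "j \<notin> F"
  shows "card (pairs i F) < a * D"
proof -
  obtain r q where rq: "r < a" "q < a" "sel j q \<in> set (nb (sel i r))"
    using assms unfolding link_def by blast
  have "pairs i F \<subset> (SIGMA r:{..<a}. set (nb (sel i r)))"
  proof
    show "pairs i F \<noteq> (SIGMA r:{..<a}. set (nb (sel i r)))"
    proof
      assume eq: "pairs i F = (SIGMA r:{..<a}. set (nb (sel i r)))"
      have "(r, sel j q) \<in> pairs i F" unfolding eq using rq by simp
      then show False using assms(4) blk_sel[OF assms(2) rq(2)] by (simp add: pairs_def)
    qed
  qed (auto simp: pairs_def)
  then have "card (pairs i F) < card (SIGMA r:{..<a}. set (nb (sel i r)))"
    by (intro psubset_card_mono) auto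
  then show ?thesis using card_neighbours[OF assms(1)] by simp
qed

text \<open>Union bound over the edges that can describe a failure: the candidate must be drawn and
  the other end must be chosen, with probability 1 / a each, and both are then forgotten. In the
  success term the condition that no conflict occurs is dropped, which leaves the new choice
  uniform.\<close>

lemma avg_step_le:
  assumes i: "i \<in> J" "i \<notin> F" and F: "F \<subseteq> J" "i0 \<notin> F"
  shows "avg F (\<lambda>\<tau>. moment (Suc N) (\<tau>, i # st)) \<le> avg (insert i F) (\<lambda>\<tau>. moment N (\<tau>, st)) +
     z / (real a)\<^sup>2 * (\<Sum>(r, y)\<in>pairs i F. avg (F - {blk y}) (\<lambda>\<tau>. moment N (\<tau>, blk y # i # st)))"
proof -
  have finF: "finite F" using F finite_J finite_subset by blast
  define Y where "Y r = {y \<in> set (nb (sel i r)). blk y \<in> F \<and> (\<exists>q<a. sel (blk y) q = y)}" for r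
  define G where "G y = (\<lambda>\<tau>. if \<tau> (blk y) = Suc y then moment N (\<tau>(blk y := 0), blk y # i # st) else 0)" for y
  have G0: "0 \<le> G y \<tau>" for y \<tau> using moment_nonneg by (auto simp: G_def)
  have pw: "(if length (snd (step (\<tau>, i # st) r)) > length (i # st) then z else 1) * moment N (step (\<tau>, i # st) r)
      \<le> moment N (\<tau>(i := Suc (sel i r)), st) + (\<Sum>y\<in>Y r. z * G y \<tau>)"
    if r: "r < a" and \<rho>: "\<rho> \<in> choices F" and \<tau>: "\<tau> = fill F \<rho>" for r \<rho> \<tau>
  proof (cases "conflict \<tau> (sel i r) = 0")
    case True
    have "0 \<le> (\<Sum>y\<in>Y r. z * G y \<tau>)" using z_bounds G0 by (intro sum_nonneg mult_nonneg_nonneg) auto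
    then show ?thesis using True by simp
  next
    case False
    then obtain y where y: "y \<in> set (nb (sel i r))" "\<tau> (blk y) = Suc y" "conflict \<tau> (sel i r) = blk y"
      using conflict_cases[of \<tau> "sel i r"] by auto
    have yF: "blk y \<in> F" "y = sel (blk y) (\<rho> (blk y))"
      using y(2) \<tau> by (auto simp: fill_def split: if_splits)
    then have "\<rho> (blk y) < a" using \<rho> by (auto simp: choices_def PiE_dflt_def)
    then have yY: "y \<in> Y r" using y yF by (auto simp: Y_def)
    have fin: "finite (Y r)" by (auto simp: Y_def)
    have "z * moment N (\<tau>(blk y := 0), blk y # i # st) = z * G y \<tau>" using y by (simp add: G_def)
    \<comment> \<open>\<open>conflict\<close> reports a single neighbour; adding the terms of all
      the others removes the dependence on which one it is.\<close>
    also have "\<dots> \<le> (\<Sum>y\<in>Y r. z * G y \<tau>)"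
      using z_bounds G0 yY fin by (intro member_le_sum) auto
    finally show ?thesis
      using False y(3) moment_nonneg[of N "(\<tau>(i := Suc (sel i r)), st)"] by (simp add: Let_def)
  qed
  have "avg F (\<lambda>\<tau>. moment (Suc N) (\<tau>, i # st)) \<le>
      avg F (\<lambda>\<tau>. (\<Sum>r<a. moment N (\<tau>(i := Suc (sel i r)), st) + (\<Sum>y\<in>Y r. z * G y \<tau>)) / real a)"
    using pw by (intro avg_mono) (auto intro!: divide_right_mono sum_mono)
  also have "\<dots> = (\<Sum>r<a. avg F (\<lambda>\<tau>. moment N (\<tau>(i := Suc (sel i r)), st))) / real a +
      (\<Sum>r<a. \<Sum>y\<in>Y r. z * avg F (G y)) / real a"
    by (simp only: avg_divide avg_sum avg_add avg_scale sum.distrib add_divide_distrib)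
  also have "(\<Sum>r<a. avg F (\<lambda>\<tau>. moment N (\<tau>(i := Suc (sel i r)), st))) / real a =
      avg (insert i F) (\<lambda>\<tau>. moment N (\<tau>, st))"
    using avg_insert[OF finF i(2), of "\<lambda>\<tau>. moment N (\<tau>, st)"] by simp
  also have "(\<Sum>r<a. \<Sum>y\<in>Y r. z * avg F (G y)) / real a \<le>
      (\<Sum>r<a. \<Sum>y\<in>Y r. z * (avg (F - {blk y}) (\<lambda>\<tau>. moment N (\<tau>, blk y # i # st)) / real a)) / real a"
  proof (intro divide_right_mono sum_mono mult_left_mono)
    fix r y assume "y \<in> Y r"
    then have y: "blk y \<in> F" "\<exists>q<a. sel (blk y) q = y" by (auto simp: Y_def)
    show "avg F (G y) \<le> avg (F - {blk y}) (\<lambda>\<tau>. moment N (\<tau>, blk y # i # st)) / real a"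
      using avg_pinned[OF finF y(1) F(1), of "\<lambda>\<tau>. moment N (\<tau>, blk y # i # st)" y] y F moment_nonneg
      by (auto simp: G_def)
  qed (use z_bounds in auto)
  also have "\<dots> = z / (real a)\<^sup>2 * (\<Sum>(r, y)\<in>pairs i F. avg (F - {blk y}) (\<lambda>\<tau>. moment N (\<tau>, blk y # i # st)))"
    unfolding pairs_def Y_def[symmetric]
    by (subst sum.Sigma[symmetric]) (auto simp: Y_def sum_distrib_left sum_divide_distrib power2_eq_square)
  finally show ?thesis by simp
qed

text \<open>The stack is split into blocks \<open>ns\<close> blanked by failures, on top of blocks
  \<open>rs\<close> that have been blank since the start. A block of \<open>ns\<close> lies directly
  above the block whose candidate removed its choice, and the conflicting edge joins the
  two.\<close>

fun linked :: "nat list \<Rightarrow> nat list \<Rightarrow> bool" where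
  "linked [] rs = True"
| "linked (i # ns) rs = (ns @ rs \<noteq> [] \<and> link i (hd (ns @ rs)) \<and> linked ns rs)"

text \<open>A block blanked by a failure loses at least one edge to the blank block that caused it. With
  this, its weight solves \<open>g = 1 + g\<^sup>2 / 4\<close>, i.e. \<open>g = 2\<close>, even though failures count \<open>z > 1\<close>.\<close>

lemma avg_moment_le:
  assumes "linked ns rs" "distinct (ns @ rs)" "set (ns @ rs) \<subseteq> J"
    "ns @ rs \<noteq> [] \<Longrightarrow> rs \<noteq> [] \<and> last rs = i0"
  shows "avg (J - set (ns @ rs)) (\<lambda>\<tau>. moment N (\<tau>, ns @ rs)) \<le> 2 ^ length ns * (8 / 3) ^ length rs"
  using assms
proof (induction N arbitrary: ns rs)
  case 0
  have "1 * 1 \<le> (2::real) ^ length ns * (8 / 3) ^ length rs"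
    by (intro mult_mono) (auto simp: one_le_power)
  then show ?case using finite_J by (simp add: avg_const)
next
  case (Suc N)
  define \<Psi> :: real where "\<Psi> = 2 ^ length ns * (8 / 3) ^ length rs"
  have \<Psi>0: "\<Psi> > 0" by (simp add: \<Psi>_def)
  show ?case
  proof (cases "ns @ rs")
    case Nil
    then show ?thesis using finite_J by (simp add: avg_const)
  next
    case (Cons i st)
    define F where "F = J - set (ns @ rs)"
    have i: "i \<in> J" "i \<notin> F" using Suc.prems Cons by (auto simp: F_def)
    have rs: "rs \<noteq> []" "last rs = i0" using Suc.prems(4) Cons by auto
    have "last rs \<in> set rs" using rs(1) by (rule last_in_set)
    then have F: "F \<subseteq> J" "i0 \<notin> F" using rs by (auto simp: F_def)
    have ins: "insert i F = J - set st" using Suc.prems(2,3) Cons by (auto simp: F_def)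
    have grow: "avg (F - {blk y}) (\<lambda>\<tau>. moment N (\<tau>, blk y # i # st)) \<le> 2 * \<Psi>"
      if "(r, y) \<in> pairs i F" for r y
    proof -
      have y: "blk y \<in> F" using that by (auto simp: pairs_def)
      have "linked (blk y # ns) rs"
        using link_pairs[OF that] Suc.prems(1) Cons by auto
      moreover have "distinct ((blk y # ns) @ rs)" "set ((blk y # ns) @ rs) \<subseteq> J"
        using y Suc.prems by (auto simp: F_def)
      ultimately have "avg (J - set ((blk y # ns) @ rs)) (\<lambda>\<tau>. moment N (\<tau>, (blk y # ns) @ rs))
          \<le> 2 ^ length (blk y # ns) * (8 / 3) ^ length rs"
        using rs by (intro Suc.IH) auto
      moreover have "J - set ((blk y # ns) @ rs) = F - {blk y}" by (auto simp: F_def)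
      ultimately show ?thesis using Cons by (simp add: \<Psi>_def)
    qed
    have "(\<Sum>(r, y)\<in>pairs i F. avg (F - {blk y}) (\<lambda>\<tau>. moment N (\<tau>, blk y # i # st)))
        \<le> (\<Sum>(r, y)\<in>pairs i F. 2 * \<Psi>)"
      using grow by (intro sum_mono) auto
    also have "\<dots> = real (card (pairs i F)) * (2 * \<Psi>)" by (simp add: case_prod_unfold)
    finally have tot: "avg F (\<lambda>\<tau>. moment (Suc N) (\<tau>, i # st)) \<le> avg (insert i F) (\<lambda>\<tau>. moment N (\<tau>, st)) +
        z / (real a)\<^sup>2 * (real (card (pairs i F)) * (2 * \<Psi>))"
      using avg_step_le[OF i F, of N st] z_bounds
      by (meson add_left_mono divide_nonneg_nonneg less_eq_real_def mult_left_mono order_trans zero_le_one zero_le_power2)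
    have a0: "real a > 0" using a_pos by simp
    show ?thesis
    proof (cases ns)
      case (Cons i' ns')
      then have ns: "ns = i # ns'" "st = ns' @ rs" using \<open>ns @ rs = i # st\<close> by auto
      have "avg (insert i F) (\<lambda>\<tau>. moment N (\<tau>, st)) \<le> 2 ^ length ns' * (8 / 3) ^ length rs"
        unfolding ins ns(2) by (rule Suc.IH) (use Suc.prems ns rs in auto)
      \<comment> \<open>The popped block had weight 2. The other half of \<open>\<Psi>\<close> is
        for the failures: at most 1/4 times the weight 2 of the pushed block.\<close>
      also have "\<dots> = \<Psi> / 2" by (simp add: \<Psi>_def ns)
      finally have 1: "avg (insert i F) (\<lambda>\<tau>. moment N (\<tau>, st)) \<le> \<Psi> / 2" .
      have l: "link i (hd st)" "st \<noteq> []" using Suc.prems(1) ns by auto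
      then have "hd st \<in> set st" by simp
      then have "hd st \<in> J" "hd st \<notin> F" using Suc.prems ns by (auto simp: F_def)
      then have c: "card (pairs i F) < a * D" using card_pairs_link i l by blast
      then have D: "D > 0" by (cases D) auto
      have "real (card (pairs i F)) \<le> real a * real D - 1"
        using c by (metis add_le_cancel_right diff_add_cancel of_nat_1 of_nat_add of_nat_le_iff of_nat_mult Suc_eq_plus1 Suc_leI)
      then have "4 * z * real (card (pairs i F)) \<le> 4 * z * (real a * real D - 1)"
        using z_bounds by (intro mult_left_mono) auto
      also have "\<dots> \<le> (real a)\<^sup>2" by (rule nested_weight[OF D])
      finally have "z / (real a)\<^sup>2 * real (card (pairs i F)) \<le> 1 / 4"
        using a0 by (simp add: field_simps)
      then have "z / (real a)\<^sup>2 * real (card (pairs i F)) * (2 * \<Psi>) \<le> 1 / 4 * (2 * \<Psi>)"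
        using \<Psi>0 by (intro mult_right_mono) auto
      then have "avg F (\<lambda>\<tau>. moment (Suc N) (\<tau>, i # st)) \<le> \<Psi>"
        using tot 1 unfolding mult.assoc by linarith
      then show ?thesis using \<open>ns @ rs = i # st\<close> by (simp only: F_def \<Psi>_def)
    next
      case Nil
      then have r: "rs = i # st" using \<open>ns @ rs = i # st\<close> by auto
      have "avg (insert i F) (\<lambda>\<tau>. moment N (\<tau>, st)) \<le> (8 / 3) ^ length st"
        unfolding ins using Suc.IH[of "[]" st] Suc.prems Nil r rs by (auto split: if_splits)
      \<comment> \<open>An initial block need not have a blank neighbour below it, so its failures
        are only bounded by z / 4 \<le> 5/16. The weight 8/3 solves g = 1 + 5/16 * 2 * g.\<close>
      also have "\<dots> = 3 / 8 * \<Psi>" by (simp add: \<Psi>_def r Nil)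
      finally have 1: "avg (insert i F) (\<lambda>\<tau>. moment N (\<tau>, st)) \<le> 3 / 8 * \<Psi>" by simp
      have "real (card (pairs i F)) \<le> real (a * D)" using card_pairs[OF i(1)] of_nat_le_iff by blast
      then have "4 * real (card (pairs i F)) \<le> real (a * (4 * D))" by simp
      also have "\<dots> \<le> real (a * a)" using a_ge mult_le_mono2 of_nat_le_iff by blast
      finally have "4 * real (card (pairs i F)) \<le> (real a)\<^sup>2" by (simp add: power2_eq_square)
      then have "z * (4 * real (card (pairs i F))) \<le> 5 / 4 * (real a)\<^sup>2"
        using z_bounds by (intro mult_mono) auto
      then have "z / (real a)\<^sup>2 * real (card (pairs i F)) \<le> 5 / 16"
        using a0 by (simp add: field_simps)
      then have "z / (real a)\<^sup>2 * real (card (pairs i F)) * (2 * \<Psi>) \<le> 5 / 16 * (2 * \<Psi>)"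
        using \<Psi>0 by (intro mult_right_mono) auto
      then have "avg F (\<lambda>\<tau>. moment (Suc N) (\<tau>, i # st)) \<le> \<Psi>"
        using tot 1 unfolding mult.assoc by linarith
      then show ?thesis using \<open>ns @ rs = i # st\<close> by (simp only: F_def \<Psi>_def)
    qed
  qed
qed

section \<open>From the moment to the number of steps\<close>

lemma ln_z_ge: "1 / (5 * D1\<^sup>2) \<le> ln z"
proof -
  have D: "1 \<le> D1\<^sup>2" using D1_ge by simp
  have "1 - inverse z \<le> ln z" using z_bounds ln_le_minus_one[of "inverse z"] by (simp add: ln_inverse)
  moreover have "1 - inverse z = 1 / (4 * D1\<^sup>2 + 1)"
  proof -
    have "D1 > 0" using D1_ge by simp
    then show ?thesis unfolding z_def by (simp add: divide_simps add_pos_pos less_imp_neq[THEN not_sym])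
  qed
  moreover have "1 / (5 * D1\<^sup>2) \<le> 1 / (4 * D1\<^sup>2 + 1)"
    using D by (intro divide_left_mono mult_pos_pos) auto
  ultimately show ?thesis by linarith
qed

text \<open>With the moment bound as \<open>P\<close>, the quotient is at most 1 and cancels the -1.
  As ln (8/3) \<le> 5/3 and 1 / ln z \<le> 5 D1^2, there remain card J + 2 * (5/3) * 5 * card J *
  D1^2 steps, and 1 + 50/3 < 18.\<close>

theorem steps_bound:
  assumes "distinct rs" "set rs = J" "last rs = i0"
  shows "steps N (\<lambda>_. 0, rs) \<le> 18 * real (card J) * D1\<^sup>2"
proof -
  define P :: real where "P = (8 / 3) ^ length rs"
  have len: "length rs = card J" using assms distinct_card by fastforce
  have P0: "P > 0" by (simp add: P_def)
  have ne: "rs \<noteq> []" using assms(2) i0_J by auto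
  have m: "moment N (\<lambda>_. 0, rs) / P \<le> 1"
    using avg_moment_le[of "[]" rs N] assms ne P0 by (simp add: P_def)
  have lz: "0 < ln z" using z_bounds by simp
  have D: "1 \<le> D1\<^sup>2" using D1_ge by simp
  have l1: "ln (8 / 3 :: real) \<le> 5 / 3" using ln_le_minus_one[of "8 / 3 :: real"] by simp
  have lnP: "ln P \<le> real (card J) * (5 / 3)"
    using mult_left_mono[OF l1, of "real (card J)"] by (simp add: P_def ln_realpow len)
  have "steps N (\<lambda>_. 0, rs) \<le> real (card J) + 2 * ((ln P - 1 + moment N (\<lambda>_. 0, rs) / P) / ln z)"
    using steps_le_moment[OF P0, of N "(\<lambda>_. 0, rs)" 0] len by simp
  also have "\<dots> \<le> real (card J) + 2 * (real (card J) * (5 / 3) / ln z)"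
  proof -
    have "ln P - 1 + moment N (\<lambda>_. 0, rs) / P \<le> real (card J) * (5 / 3)"
      using add_mono[OF lnP m] by (simp only: diff_add_eq diff_le_eq)
    then show ?thesis using lz by (intro add_left_mono mult_left_mono divide_right_mono) auto
  qed
  also have "\<dots> \<le> real (card J) * D1\<^sup>2 + 2 * (5 / 3 * (real (card J) * (5 * D1\<^sup>2)))"
  proof -
    have "1 \<le> ln z * (5 * D1\<^sup>2)" using ln_z_ge pos_divide_le_eq[of "5 * D1\<^sup>2" 1 "ln z"] D by linarith
    then have "real (card J) * 1 \<le> real (card J) * (ln z * (5 * D1\<^sup>2))" by (intro mult_left_mono) auto
    then have "real (card J) / ln z \<le> real (card J) * (5 * D1\<^sup>2)"
      using lz by (simp add: pos_divide_le_eq mult_ac)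
    moreover have "real (card J) * 1 \<le> real (card J) * D1\<^sup>2" using D by (intro mult_left_mono) auto
    ultimately show ?thesis by (intro add_mono mult_left_mono) auto
  qed
  also have "\<dots> \<le> 18 * real (card J) * D1\<^sup>2" by simp
  finally show ?thesis .
qed

end

section \<open>Expected running times\<close>

text \<open>The value on \<open>None\<close> is a parameter because the analysis of a loop also uses
  finite penalties for nontermination.\<close>

definition expect :: "ennreal \<Rightarrow> 'a spmf \<Rightarrow> ('a \<Rightarrow> ennreal) \<Rightarrow> ennreal" where
  "expect c p f = (\<integral>\<^sup>+ \<omega>. (case \<omega> of None \<Rightarrow> c | Some x \<Rightarrow> f x) \<partial>measure_pmf p)"

lemma expect_return [simp]: "expect c (return_spmf x) f = f x"
  by (simp add: expect_def)

lemma expect_bind: "expect c (bind_spmf p g) f = expect c p (\<lambda>x. expect c (g x) f)"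
  unfolding expect_def bind_spmf_def nn_integral_bind_pmf
  by (intro nn_integral_cong) (auto split: option.split)

lemma expect_map: "expect c (map_spmf g p) f = expect c p (\<lambda>x. f (g x))"
  unfolding expect_def nn_integral_map_pmf
  by (intro nn_integral_cong) (auto split: option.split)

lemma expect_mono:
  assumes "c \<le> c'" "\<And>x. f x \<le> f' x"
  shows "expect c p f \<le> expect c' p f'"
  unfolding expect_def using assms by (intro nn_integral_mono) (auto split: option.split)

text \<open>The penalty is raised together with the values, which makes this an equality whatever
  the probability of \<open>None\<close>.\<close>

lemma expect_add: "expect (c + y) p (\<lambda>x. f x + y) = expect c p f + y"
proof -
  have "expect (c + y) p (\<lambda>x. f x + y) = (\<integral>\<^sup>+ \<omega>. (case \<omega> of None \<Rightarrow> c | Some x \<Rightarrow> f x) + y \<partial>measure_pmf p)"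
    unfolding expect_def by (intro nn_integral_cong) (auto split: option.split)
  also have "\<dots> = expect c p f + y"
    unfolding expect_def by (subst nn_integral_add) auto
  finally show ?thesis .
qed

lemma expect_uniform:
  assumes "0 < a"
  shows "expect c (spmf_of_set {..<a}) f = (\<Sum>r<a. f r) / of_nat a"
proof -
  have "expect c (spmf_of_set {..<a}) f = expect c (spmf_of_pmf (pmf_of_set {..<a})) f"
    using assms by (simp add: spmf_of_set_def lessThan_empty_iff del: spmf_of_pmf_pmf_of_set)
  also have "\<dots> = (\<integral>\<^sup>+ r. f r \<partial>measure_pmf (pmf_of_set {..<a}))"
    by (simp add: expect_def spmf_of_pmf_def del: spmf_of_pmf_pmf_of_set)
  also have "\<dots> = (\<Sum>r<a. f r) / of_nat a"
    using assms by (subst nn_integral_pmf_of_set) (auto simp: lessThan_empty_iff)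
  finally show ?thesis .
qed

lemma SUP_min_of_nat: "(SUP N. min (of_nat N) (y::ennreal)) = y"
proof -
  have "y \<le> (SUP N. min (of_nat N) y)"
  proof (cases "y = \<infinity>")
    case True
    then show ?thesis by (simp add: min_def ennreal_SUP_of_nat_eq_top)
  next
    case False
    then obtain N where "y < of_nat N" using ennreal_Ex_less_of_nat[of y] by (auto simp: less_top)
    then show ?thesis by (intro SUP_upper2[of N]) auto
  qed
  then show ?thesis by (intro antisym SUP_least) auto
qed

lemma min_add_one_le: "min (c + 1) (y::ennreal) \<le> min c y + 1"
proof (cases "c \<le> y")
  case False
  then have "min c y = y" by simp
  moreover have "min (c + 1) y \<le> y + 1" by (intro min.coboundedI2) (simp add: add_increasing2)
  ultimately show ?thesis by simp
qed (simp add: min.coboundedI1)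

text \<open>Monotone convergence in the truncation level. A finite level gives an induction a
  trivial start, since everything is truncated to 0 at level 0; with the penalty \<infinity> there
  would be none.\<close>

lemma expect_truncate: "expect \<infinity> p f = (SUP N. expect (of_nat N) p (\<lambda>x. min (of_nat N) (f x)))"
proof -
  have "expect \<infinity> p f = (\<integral>\<^sup>+ \<omega>. (SUP N. case \<omega> of None \<Rightarrow> of_nat N | Some x \<Rightarrow> min (of_nat N) (f x)) \<partial>measure_pmf p)"
    unfolding expect_def
    by (intro nn_integral_cong) (auto split: option.split simp: SUP_min_of_nat ennreal_SUP_of_nat_eq_top)
  also have "\<dots> = (SUP N. expect (of_nat N) p (\<lambda>x. min (of_nat N) (f x)))"
    unfolding expect_def
  proof (rule nn_integral_monotone_convergence_SUP)
    show "incseq (\<lambda>N \<omega>. case \<omega> of None \<Rightarrow> of_nat N | Some x \<Rightarrow> min (of_nat N) (f x))"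
      by (auto simp: incseq_def le_fun_def min_le_iff_disj split: option.split)
  qed simp
  finally show ?thesis .
qed

text \<open>\<open>time_le W c s Q X\<close>: from memory \<open>s\<close>, the expected value of the running time of \<open>c\<close> plus
  \<open>Q\<close> of the final memory is at most \<open>X\<close>. Values \<open>\<infinity>\<close> of \<open>Q\<close> express postconditions.\<close>

definition time_le :: "nat \<Rightarrow> com \<Rightarrow> mem \<Rightarrow> (mem \<Rightarrow> ennreal) \<Rightarrow> ennreal \<Rightarrow> bool" where
  "time_le W c s Q X \<longleftrightarrow> (\<forall>t. expect \<infinity> (run W c (s, t)) (\<lambda>(s', t'). of_nat t' + Q s') \<le> of_nat t + X)"

lemma time_le_mono:
  assumes "time_le W c s Q X" "\<And>s'. Q' s' \<le> Q s'" "X \<le> X'"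
  shows "time_le W c s Q' X'"
  unfolding time_le_def
proof
  fix t
  have "expect \<infinity> (run W c (s, t)) (\<lambda>(s', t'). of_nat t' + Q' s') \<le> expect \<infinity> (run W c (s, t)) (\<lambda>(s', t'). of_nat t' + Q s')"
    using assms(2) by (intro expect_mono) (auto intro: add_left_mono)
  also have "\<dots> \<le> of_nat t + X" using assms(1) by (simp add: time_le_def)
  also have "\<dots> \<le> of_nat t + X'" using assms(3) by (intro add_left_mono)
  finally show "expect \<infinity> (run W c (s, t)) (\<lambda>(s', t'). of_nat t' + Q' s') \<le> of_nat t + X'" .
qed

lemma time_le_add:
  assumes "time_le W c s Q X"
  shows "time_le W c s (\<lambda>s'. Q s' + y) (X + y)"
  unfolding time_le_def
proof
  fix t
  have "expect \<infinity> (run W c (s, t)) (\<lambda>(s', t'). of_nat t' + (Q s' + y)) =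
      expect (\<infinity> + y) (run W c (s, t)) (\<lambda>x. (case x of (s', t') \<Rightarrow> of_nat t' + Q s') + y)"
    by (simp add: case_prod_unfold add.assoc)
  also have "\<dots> \<le> of_nat t + X + y"
    unfolding expect_add using assms by (intro add_right_mono) (simp add: time_le_def)
  finally show "expect \<infinity> (run W c (s, t)) (\<lambda>(s', t'). of_nat t' + (Q s' + y)) \<le> of_nat t + (X + y)"
    by (simp add: add.assoc)
qed

lemma time_le_Skip: "time_le W Skip s Q (Q s + 1)"
  by (simp add: time_le_def algebra_simps)

lemma time_le_Assign:
  "time_le W (Assign x e) s Q (Q (set_var x (eval_exp W s e) s) + of_nat (1 + exp_cost e))"
  by (simp add: time_le_def algebra_simps)

lemma time_le_Store:
  "time_le W (Store a e1 e2) s Q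
     (Q (set_arr a (eval_exp W s e1) (eval_exp W s e2) s) + of_nat (1 + exp_cost e1 + exp_cost e2))"
  by (simp add: time_le_def algebra_simps)

lemma time_le_Draw:
  assumes "0 < a" "eval_exp W s e = a"
  shows "time_le W (Draw x e) s Q ((\<Sum>r<a. Q (set_var x r s)) / of_nat a + of_nat (1 + exp_cost e))"
  unfolding time_le_def
proof
  fix t
  have "expect \<infinity> (run W (Draw x e) (s, t)) (\<lambda>(s', t'). of_nat t' + Q s') =
     (\<Sum>r<a. of_nat (t + 1 + exp_cost e) + Q (set_var x r s)) / of_nat a"
    using assms by (simp add: expect_map expect_uniform)
  also have "\<dots> = (of_nat a * of_nat (t + 1 + exp_cost e) + (\<Sum>r<a. Q (set_var x r s))) / of_nat a"
    by (simp add: sum.distrib)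
  also have "\<dots> = of_nat (t + 1 + exp_cost e) + (\<Sum>r<a. Q (set_var x r s)) / of_nat a"
  proof -
    have "of_nat a * of_nat (t + 1 + exp_cost e) / (of_nat a :: ennreal) = of_nat (t + 1 + exp_cost e)"
      unfolding mult.commute[of "of_nat a"] using assms(1) by (intro mult_divide_eq_ennreal) auto
    then show ?thesis by (simp only: add_divide_distrib_ennreal)
  qed
  finally show "expect \<infinity> (run W (Draw x e) (s, t)) (\<lambda>(s', t'). of_nat t' + Q s')
      \<le> of_nat t + ((\<Sum>r<a. Q (set_var x r s)) / of_nat a + of_nat (1 + exp_cost e))"
    by (simp add: algebra_simps)
qed

lemma time_le_Seq:
  assumes "time_le W c1 s Q' X" "\<And>s'. Q' s' < \<infinity> \<Longrightarrow> time_le W c2 s' Q (Q' s')"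
  shows "time_le W (Seq c1 c2) s Q X"
  unfolding time_le_def
proof
  fix t
  have "expect \<infinity> (run W c2 \<sigma>) (\<lambda>(s', t'). of_nat t' + Q s') \<le> (case \<sigma> of (s', t') \<Rightarrow> of_nat t' + Q' s')" for \<sigma>
  proof (cases \<sigma>)
    case (Pair s' t')
    then show ?thesis using assms(2)[of s'] by (cases "Q' s' < \<infinity>") (auto simp: time_le_def less_top[symmetric])
  qed
  then have "expect \<infinity> (run W (Seq c1 c2) (s, t)) (\<lambda>(s', t'). of_nat t' + Q s') \<le>
      expect \<infinity> (run W c1 (s, t)) (\<lambda>(s', t'). of_nat t' + Q' s')"
    by (auto simp: expect_bind intro!: expect_mono)
  also have "\<dots> \<le> of_nat t + X" using assms(1) by (simp add: time_le_def)
  finally show "expect \<infinity> (run W (Seq c1 c2) (s, t)) (\<lambda>(s', t'). of_nat t' + Q s') \<le> of_nat t + X" .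
qed

lemma time_le_If:
  assumes "eval_exp W s e \<noteq> 0 \<Longrightarrow> time_le W c1 s Q X" "eval_exp W s e = 0 \<Longrightarrow> time_le W c2 s Q X"
  shows "time_le W (If e c1 c2) s Q (X + of_nat (1 + exp_cost e))"
  unfolding time_le_def
proof
  fix t
  have "expect \<infinity> (run W (If e c1 c2) (s, t)) (\<lambda>(s', t'). of_nat t' + Q s') \<le> of_nat (t + 1 + exp_cost e) + X"
    using assms unfolding time_le_def by (cases "eval_exp W s e = 0") (simp_all del: of_nat_add of_nat_Suc)
  then show "expect \<infinity> (run W (If e c1 c2) (s, t)) (\<lambda>(s', t'). of_nat t' + Q s') \<le> of_nat t + (X + of_nat (1 + exp_cost e))"
    by (simp add: algebra_simps)
qed

text \<open>Since every iteration takes time, truncating the time and the penalty for nontermination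
  at \<open>N\<close> turns the bound into an induction on \<open>N\<close>.\<close>

lemma time_le_While:
  assumes step: "\<And>N s. eval_exp W s e \<noteq> 0 \<Longrightarrow> R (Suc N) s < \<infinity> \<Longrightarrow>
      time_le W c s (\<lambda>s'. R N s' + of_nat (2 + exp_cost e)) (R (Suc N) s)"
    and exit: "\<And>N s. eval_exp W s e = 0 \<Longrightarrow> Q s \<le> R N s"
  shows "time_le W (While e c) s Q ((SUP N. R N s) + of_nat (1 + exp_cost e))"
proof -
  define P where "P = (\<lambda>(s, t::nat). eval_exp W s e \<noteq> 0)"
  define F where "F = (\<lambda>\<sigma>. map_spmf (\<lambda>(s, t). (s, t + 1 + exp_cost e)) (run W c \<sigma>))"
  define L where "L = while_spmf P F"
  define f where "f = (\<lambda>(s', t'). of_nat t' + Q s' :: ennreal)"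
  have claim: "expect (of_nat N) (L (s, t)) (\<lambda>x. min (of_nat N) (f x)) \<le> of_nat t + R N s" for N s t
  proof (induction N arbitrary: s t)
    case 0
    then show ?case by (simp add: expect_def option.case_eq_if)
  next
    case (Suc N)
    show ?case
    proof (cases "eval_exp W s e = 0 \<or> R (Suc N) s = \<infinity>")
      case True
      show ?thesis
      proof (cases "eval_exp W s e = 0")
        case e: True
        then have "L (s, t) = return_spmf (s, t)"
          unfolding L_def by (subst while_spmf.simps) (simp add: P_def)
        then show ?thesis using exit[OF e, of "Suc N"]
          by (auto simp: f_def min_le_iff_disj intro: add_left_mono)
      next
        case False
        then show ?thesis using True by simp
      qed
    next
      case False
      \<comment> \<open>Going from level \<open>N\<close> to level \<open>N + 1\<close> costs one
        unit. The assumption \<open>step\<close> provides it on top of the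
        \<open>1 + exp_cost e\<close> units for the next guard.\<close>
      have "expect (of_nat (Suc N)) (L (s', t')) (\<lambda>x. min (of_nat (Suc N)) (f x))
          \<le> of_nat t' + R N s' + 1" for s' t'
      proof -
        have "expect (of_nat (Suc N)) (L (s', t')) (\<lambda>x. min (of_nat (Suc N)) (f x)) \<le>
              expect (of_nat N + 1) (L (s', t')) (\<lambda>x. min (of_nat N) (f x) + 1)"
          by (intro expect_mono) (auto simp: add.commute[of 1] min_add_one_le simp del: min_less_iff_conj min.bounded_iff)
        also have "\<dots> = expect (of_nat N) (L (s', t')) (\<lambda>x. min (of_nat N) (f x)) + 1" by (rule expect_add)
        also have "\<dots> \<le> of_nat t' + R N s' + 1" using Suc by (intro add_right_mono)
        finally show ?thesis .
      qed
      note * = this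
      have "L (s, t) = bind_spmf (F (s, t)) L"
        using False unfolding L_def by (subst while_spmf.simps) (simp add: P_def)
      then have "expect (of_nat (Suc N)) (L (s, t)) (\<lambda>x. min (of_nat (Suc N)) (f x)) =
          expect (of_nat (Suc N)) (F (s, t)) (\<lambda>\<sigma>. expect (of_nat (Suc N)) (L \<sigma>) (\<lambda>x. min (of_nat (Suc N)) (f x)))"
        by (simp add: expect_bind)
      also have "\<dots> \<le> expect \<infinity> (F (s, t)) (\<lambda>(s', t'). of_nat t' + R N s' + 1)"
        using * by (intro expect_mono) auto
      also have "\<dots> = expect \<infinity> (run W c (s, t)) (\<lambda>(s', t'). of_nat t' + (R N s' + of_nat (2 + exp_cost e)))"
        by (simp add: F_def expect_map case_prod_unfold algebra_simps)
      also have "\<dots> \<le> of_nat t + R (Suc N) s"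
        using step[of s N] False by (auto simp: time_le_def less_top[symmetric])
      finally show ?thesis .
    qed
  qed
  show ?thesis
    unfolding time_le_def
  proof
    fix t
    have "expect \<infinity> (run W (While e c) (s, t)) f = expect \<infinity> (L (s, t + 1 + exp_cost e)) f"
      by (simp add: L_def P_def F_def)
    also have "\<dots> \<le> (SUP N. of_nat (t + 1 + exp_cost e) + R N s)"
      unfolding expect_truncate by (intro SUP_mono) (use claim in blast)
    also have "\<dots> \<le> of_nat (t + 1 + exp_cost e) + (SUP N. R N s)"
      by (intro SUP_least add_left_mono SUP_upper) auto
    finally show "expect \<infinity> (run W (While e c) (s, t)) (\<lambda>(s', t'). of_nat t' + Q s')
        \<le> of_nat t + ((SUP N. R N s) + of_nat (1 + exp_cost e))"
      by (simp add: f_def algebra_simps)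
  qed
qed

section \<open>Hoare triples with expected running time\<close>

definition ht :: "nat \<Rightarrow> com \<Rightarrow> mem \<Rightarrow> (mem \<Rightarrow> bool) \<Rightarrow> nat \<Rightarrow> bool" where
  "ht W c s P T \<longleftrightarrow> time_le W c s (\<lambda>s'. if P s' then 0 else \<infinity>) (of_nat T)"

lemma ht_mono: "ht W c s P T' \<Longrightarrow> T' \<le> T \<Longrightarrow> ht W c s P T"
  unfolding ht_def by (erule time_le_mono) (auto simp: of_nat_mono)

lemma ht_post: "ht W c s P T \<Longrightarrow> (\<And>s'. P s' \<Longrightarrow> P' s') \<Longrightarrow> ht W c s P' T"
  unfolding ht_def by (erule time_le_mono) auto

lemma ht_bounded:
  assumes "ht W c s P T" "\<And>s'. P s' \<Longrightarrow> Q s' \<le> Y"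
  shows "time_le W c s Q (of_nat T + Y)"
  by (rule time_le_mono[OF time_le_add[OF assms(1)[unfolded ht_def], of Y]]) (use assms(2) in auto)

lemma ht_Seq:
  assumes "ht W c1 s P T1" "\<And>s'. P s' \<Longrightarrow> ht W c2 s' Q T2"
  shows "ht W (Seq c1 c2) s Q (T1 + T2)"
  unfolding ht_def
proof (rule time_le_Seq)
  show "time_le W c1 s (\<lambda>s'. if P s' then of_nat T2 else \<infinity>) (of_nat (T1 + T2))"
    using ht_bounded[OF assms(1), of "\<lambda>s'. if P s' then of_nat T2 else \<infinity>" "of_nat T2"] by simp
qed (use assms(2) in \<open>auto simp: ht_def split: if_splits\<close>)

lemma ht_Skip: "P s \<Longrightarrow> ht W Skip s P 1"
  using time_le_Skip[of W s "\<lambda>s'. if P s' then 0 else \<infinity>"] by (simp add: ht_def)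

lemma ht_Assign: "P (set_var x (eval_exp W s e) s) \<Longrightarrow> ht W (Assign x e) s P (1 + exp_cost e)"
  using time_le_Assign[of W x e s "\<lambda>s'. if P s' then 0 else \<infinity>"] by (simp add: ht_def)

lemma ht_Store:
  "P (set_arr a (eval_exp W s e1) (eval_exp W s e2) s) \<Longrightarrow>
   ht W (Store a e1 e2) s P (1 + exp_cost e1 + exp_cost e2)"
  using time_le_Store[of W a e1 e2 s "\<lambda>s'. if P s' then 0 else \<infinity>"] by (simp add: ht_def)

lemma ht_If:
  assumes "eval_exp W s e \<noteq> 0 \<Longrightarrow> ht W c1 s P T1" "eval_exp W s e = 0 \<Longrightarrow> ht W c2 s P T2"
  shows "ht W (If e c1 c2) s P (1 + exp_cost e + max T1 T2)"
proof -
  have "time_le W (If e c1 c2) s (\<lambda>s'. if P s' then 0 else \<infinity>) (of_nat (max T1 T2) + of_nat (1 + exp_cost e))"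
    by (rule time_le_If)
      (use assms in \<open>auto simp: ht_def intro: time_le_mono intro!: of_nat_mono\<close>)
  then show ?thesis unfolding ht_def by (simp only: of_nat_add[symmetric] add.commute)
qed

lemma ht_Assign_Seq:
  assumes "ht W c (set_var x (eval_exp W s e) s) P T"
  shows "ht W (Seq (Assign x e) c) s P (1 + exp_cost e + T)"
  by (rule ht_Seq[where P = "\<lambda>s'. s' = set_var x (eval_exp W s e) s"]) (use assms in \<open>simp_all del: One_nat_def add_Suc add_Suc_right plus_1_eq_Suc add: ht_Assign\<close>)

lemma ht_Store_Seq:
  assumes "ht W c (set_arr a (eval_exp W s e1) (eval_exp W s e2) s) P T"
  shows "ht W (Seq (Store a e1 e2) c) s P (1 + exp_cost e1 + exp_cost e2 + T)"
  by (rule ht_Seq[where P = "\<lambda>s'. s' = set_arr a (eval_exp W s e1) (eval_exp W s e2) s"])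
    (use assms in \<open>simp_all del: One_nat_def add_Suc add_Suc_right plus_1_eq_Suc add: ht_Store\<close>)

definition For :: "string \<Rightarrow> string \<Rightarrow> com \<Rightarrow> com" where
  "For x y c = While (Op Less (Var x) (Var y)) (Seq c (Assign x (Op Plus (Var x) (Const 1))))"

text \<open>An iteration pays \<open>T\<close> for the body, 4 for the increment, 4 for the next
  guard and 1 for the truncation in \<open>time_le_While\<close>; the final 4 is the first guard.
  The remaining distance to \<open>h\<close> bounds the iterations, so the potential
  \<open>R\<close> can be the same for every truncation level.\<close>

lemma ht_For:
  assumes inv: "\<And>j s. I j s \<Longrightarrow> vars s x = j \<and> vars s y = h"
    and body: "\<And>j s. I j s \<Longrightarrow> j < h \<Longrightarrow> ht W c s (\<lambda>s'. vars s' x = j \<and> I (Suc j) (set_var x (Suc j) s')) T"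
    and W: "1 < W" "h < W" and init: "I l s" "l \<le> h"
  shows "ht W (For x y c) s (I h) ((h - l) * (T + 9) + 4)"
proof -
  define R :: "nat \<Rightarrow> mem \<Rightarrow> ennreal" where
    "R N s = (if \<exists>j\<le>h. I j s then of_nat ((h - vars s x) * (T + 9)) else \<infinity>)" for N s
  have "time_le W (For x y c) s (\<lambda>s'. if I h s' then 0 else \<infinity>) ((SUP N. R N s) + of_nat (1 + exp_cost (Op Less (Var x) (Var y))))"
    unfolding For_def
  proof (rule time_le_While)
    fix N s
    assume g: "eval_exp W s (Op Less (Var x) (Var y)) \<noteq> 0" and R: "R (Suc N) s < \<infinity>"
    from R obtain j where j: "j \<le> h" "I j s" by (auto simp: R_def split: if_splits)
    then have jh: "j < h" "vars s x = j" using inv[OF j(2)] g by (auto split: if_splits)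
    have "ht W (Seq c (Assign x (Op Plus (Var x) (Const 1)))) s (I (Suc j)) (T + (1 + exp_cost (Op Plus (Var x) (Const 1))))"
      by (rule ht_Seq[OF body[OF j(2) jh(1)]], rule ht_Assign) (use jh W in auto)
    then have "time_le W (Seq c (Assign x (Op Plus (Var x) (Const 1)))) s
      (\<lambda>s'. R N s' + of_nat (2 + exp_cost (Op Less (Var x) (Var y))))
      (of_nat (T + (1 + exp_cost (Op Plus (Var x) (Const 1)))) + of_nat ((h - Suc j) * (T + 9) + 5))"
    proof (rule ht_bounded)
      fix s' assume I: "I (Suc j) s'"
      then have "R N s' = of_nat ((h - Suc j) * (T + 9))" using inv[OF I] jh(1) by (auto simp: R_def)
      then show "R N s' + of_nat (2 + exp_cost (Op Less (Var x) (Var y))) \<le> of_nat ((h - Suc j) * (T + 9) + 5)"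
        by simp
    qed
    moreover have "(T + (1 + exp_cost (Op Plus (Var x) (Const 1)))) + ((h - Suc j) * (T + 9) + 5) = (h - j) * (T + 9)"
      using jh(1) by (simp add: Suc_diff_Suc[symmetric] algebra_simps)
    moreover have "R (Suc N) s = of_nat ((h - j) * (T + 9))" using j jh by (auto simp: R_def)
    ultimately show "time_le W (Seq c (Assign x (Op Plus (Var x) (Const 1)))) s
      (\<lambda>s'. R N s' + of_nat (2 + exp_cost (Op Less (Var x) (Var y)))) (R (Suc N) s)"
      by (metis of_nat_add)
  next
    fix N s
    assume g: "eval_exp W s (Op Less (Var x) (Var y)) = 0"
    show "(if I h s then 0 else \<infinity>) \<le> R N s"
    proof (cases "\<exists>j\<le>h. I j s")
      case True
      then obtain j where j: "j \<le> h" "I j s" by auto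
      then have "j = h" using inv[OF j(2)] g by (auto split: if_splits)
      then show ?thesis using j by simp
    next
      case False
      then show ?thesis by (simp only: R_def if_False) simp
    qed
  qed
  moreover have "(SUP N. R N s) = of_nat ((h - l) * (T + 9))"
    using init inv[OF init(1)] by (auto simp: R_def)
  ultimately show ?thesis unfolding ht_def by (simp add: algebra_simps)
qed

text \<open>A result outside \<open>P\<close> would have positive probability and would make the
  expectation infinite.\<close>

lemma ht_run:
  assumes "ht W c s P T"
  shows "\<forall>(s', t) \<in> set_spmf (run W c (s, 0)). P s'" "expected_time (run W c (s, 0)) \<le> of_nat T"
proof -
  define g where "g = (\<lambda>(s', t'). of_nat t' + (if P s' then 0 else \<infinity>) :: ennreal)"
  have le: "expect \<infinity> (run W c (s, 0)) g \<le> of_nat T"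
    using assms unfolding ht_def time_le_def g_def by (metis add_0 of_nat_0)
  have "expected_time (run W c (s, 0)) \<le> expect \<infinity> (run W c (s, 0)) g"
    unfolding expected_time_def expect_def by (intro nn_integral_mono) (auto simp: g_def split: option.split)
  then show "expected_time (run W c (s, 0)) \<le> of_nat T" using le by simp
  show "\<forall>(s', t) \<in> set_spmf (run W c (s, 0)). P s'"
  proof (rule ccontr)
    assume "\<not> (\<forall>(s', t) \<in> set_spmf (run W c (s, 0)). P s')"
    then obtain s' t where st: "Some (s', t) \<in> set_pmf (run W c (s, 0))" "\<not> P s'"
      by (auto simp: in_set_spmf)
    have "AE \<omega> in measure_pmf (run W c (s, 0)). (case \<omega> of None \<Rightarrow> \<infinity> | Some x \<Rightarrow> g x) \<noteq> \<infinity>"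
    proof (rule nn_integral_noteq_infinite)
      have "expect \<infinity> (run W c (s, 0)) g < \<infinity>" using le by (rule le_less_trans) (simp add: ennreal_of_nat_eq_real_of_nat)
      then show "(\<integral>\<^sup>+ \<omega>. (case \<omega> of None \<Rightarrow> \<infinity> | Some x \<Rightarrow> g x) \<partial>measure_pmf (run W c (s, 0))) \<noteq> \<infinity>"
        unfolding expect_def by (metis less_irrefl)
    qed simp
    then show False using st by (auto simp: AE_measure_pmf_iff g_def)
  qed
qed

section \<open>Adjacency lists and the initial colouring\<close>

text \<open>Neighbours in the order in which the edges are read, so that a prefix of the edge list
  describes the tables in the middle of the loop.\<close>

definition nbrs :: "(nat \<times> nat) list \<Rightarrow> nat \<Rightarrow> nat list" where
  "nbrs es u = concat (map (\<lambda>(x, y). (if x = u then [y] else []) @ (if y = u then [x] else [])) es)"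

lemma nbrs_Nil [simp]: "nbrs [] u = []"
  by (simp add: nbrs_def)

lemma nbrs_append: "nbrs (es @ es') u = nbrs es u @ nbrs es' u"
  by (simp add: nbrs_def)

lemma set_nbrs: "y \<in> set (nbrs es u) \<longleftrightarrow> (u, y) \<in> set es \<or> (y, u) \<in> set es"
  unfolding nbrs_def by (induction es) (auto split: if_splits)

text \<open>A repetition could only come from a loop or from an edge listed twice, possibly with its
  ends exchanged; distinctness as sets excludes the latter.\<close>

lemma distinct_nbrs:
  assumes "distinct (map (\<lambda>(x, y). {x, y}) es)" "\<And>x y. (x, y) \<in> set es \<Longrightarrow> x \<noteq> y"
  shows "distinct (nbrs es u)"
  using assms
proof (induction es)
  case (Cons e es)
  obtain x y where e: "e = (x, y)" by force
  have xy: "x \<noteq> y" using Cons.prems(2)[of x y] e by simp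
  have ih: "distinct (nbrs es u)" using Cons by simp
  have "(x, y) \<notin> set es" "(y, x) \<notin> set es"
    using Cons.prems(1) e by (force simp: insert_commute)+
  then have "x = u \<Longrightarrow> y \<notin> set (nbrs es u)" "y = u \<Longrightarrow> x \<notin> set (nbrs es u)"
    by (auto simp: set_nbrs)
  moreover have "nbrs (e # es) u = ((if x = u then [y] else []) @ (if y = u then [x] else [])) @ nbrs es u"
    by (simp add: nbrs_def e)
  ultimately show ?case using ih xy by auto
qed simp

text \<open>Frame condition: \<open>X\<close> and \<open>Y\<close> are the variables and arrays that
  a program may write.\<close>

definition same :: "string set \<Rightarrow> string set \<Rightarrow> mem \<Rightarrow> mem \<Rightarrow> bool" where
  "same X Y s s' \<longleftrightarrow> (\<forall>x. x \<notin> X \<longrightarrow> vars s' x = vars s x) \<and> (\<forall>y. y \<notin> Y \<longrightarrow> arrs s' y = arrs s y)"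

lemma same_refl: "same X Y s s"
  by (simp add: same_def)

lemma same_vars: "same X Y s s' \<Longrightarrow> x \<notin> X \<Longrightarrow> vars s' x = vars s x"
  by (simp add: same_def)

lemma same_arrs: "same X Y s s' \<Longrightarrow> y \<notin> Y \<Longrightarrow> arrs s' y = arrs s y"
  by (simp add: same_def)

lemma mem_upd [simp]:
  "vars (set_var x c s) = (vars s)(x := c)" "arrs (set_var x c s) = arrs s"
  "vars (set_arr y i c s) = vars s" "arrs (set_arr y i c s) = (arrs s)(y := (arrs s y)(i := c))"
  by (simp_all add: set_var_def set_arr_def)

lemma same_upd:
  "same X Y s s' \<Longrightarrow> x \<in> X \<Longrightarrow> same X Y s (set_var x c s')"
  "same X Y s s' \<Longrightarrow> y \<in> Y \<Longrightarrow> same X Y s (set_arr y i c s')"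
  by (auto simp: same_def)

text \<open>For tables stored row by row: different entries have different addresses.\<close>

lemma index_inj:
  fixes u :: nat
  assumes "t < n" "t' < n" "u * n + t = u' * n + t'"
  shows "u = u' \<and> t = t'"
proof -
  have "(u * n + t) div n = u" "(u' * n + t') div n = u'"
    using assms(1,2) by (simp_all add: div_mult_self3)
  then show ?thesis using assms(3) by simp
qed

definition ix :: "string \<Rightarrow> exp \<Rightarrow> exp" where
  "ix x e = Op Plus (Op Times (Var x) (Var ''h'')) e"

definition nx :: "string \<Rightarrow> exp \<Rightarrow> exp" where
  "nx x e = Op Plus (Op Times (Var x) (Var ''n'')) e"

lemma cost_ix [simp]: "exp_cost (ix x e) = 4 + exp_cost e" "exp_cost (nx x e) = 4 + exp_cost e"
  by (simp_all add: ix_def nx_def)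

text \<open>Every row of \<open>adj\<close> has room for \<open>n\<close> entries, so the table can
  be filled without knowing the maximum degree.\<close>

definition edge_body :: com where
  "edge_body =
     Seq (Assign ''u'' (Arr ''src'' (Var ''e'')))
    (Seq (Assign ''w'' (Arr ''dst'' (Var ''e'')))
    (Seq (Store ''adj'' (nx ''u'' (Arr ''deg'' (Var ''u''))) (Var ''w''))
    (Seq (Store ''deg'' (Var ''u'') (Op Plus (Arr ''deg'' (Var ''u'')) (Const 1)))
    (Seq (Store ''adj'' (nx ''w'' (Arr ''deg'' (Var ''w''))) (Var ''u''))
         (Store ''deg'' (Var ''w'') (Op Plus (Arr ''deg'' (Var ''w'')) (Const 1)))))))"

text \<open>The initial colour of a vertex is its rank within its block; \<open>at\<close> is the
  inverse table.\<close>

definition vertex_body :: com where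
  "vertex_body =
     Seq (Assign ''i'' (Arr ''block'' (Var ''v'')))
    (Seq (Store ''cnt'' (Var ''i'') (Op Plus (Arr ''cnt'' (Var ''i'')) (Const 1)))
    (Seq (Store ''at'' (ix ''i'' (Arr ''cnt'' (Var ''i''))) (Var ''v''))
         (Store ''color'' (Var ''v'') (Arr ''cnt'' (Var ''i'')))))"

section \<open>Degrees, blocks and word size of an instance\<close>

locale strong_instance =
  fixes n k b D :: nat and E :: "nat set set" and B :: "nat \<Rightarrow> nat set"
    and es :: "(nat \<times> nat) list" and bs :: "nat list"
  assumes graph: "simple_graph {..<n} E" and max_deg: "max_degree {..<n} E = D"
    and partition: "block_partition {..<n} k b B" and large: "5 * D \<le> b"
    and edges: "edge_list E es" and blocks: "block_list n k B bs"
begin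

definition nb :: "nat \<Rightarrow> nat list" where "nb = nbrs es"
definition blk :: "nat \<Rightarrow> nat" where "blk = array_of bs"
text \<open>Addresses are bounded by the square of the word base. The cube exceeds it strictly, so
  address computations do not wrap around.\<close>

definition W :: nat where "W = word_base n k b ^ 3"
definition H :: nat where "H = Suc b"
text \<open>The program can compute this number of candidates without \<open>D\<close>. Since D
  \<le> b div 5, it is at most b - D, the number of colours that certainly remain, and still at
  least 4 D.\<close>

definition a :: nat where "a = b - b div 5"

lemma E_edge: "{x, y} \<in> E \<Longrightarrow> x < n \<and> y < n \<and> x \<noteq> y"
  using graph unfolding simple_graph_def by (fastforce simp: doubleton_eq_iff)

lemma es_edge:
  assumes "(x, y) \<in> set es"
  shows "{x, y} \<in> E" "x < n" "y < n" "x \<noteq> y"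
proof -
  show e: "{x, y} \<in> E" using edges assms unfolding edge_list_def by force
  show "x < n" "y < n" "x \<noteq> y" using E_edge[OF e] by auto
qed

lemma nb_iff: "y \<in> set (nb x) \<longleftrightarrow> {x, y} \<in> E"
proof
  assume "{x, y} \<in> E"
  then obtain u v where "(u, v) \<in> set es" "{u, v} = {x, y}"
    using edges unfolding edge_list_def by (auto simp: image_iff)
  then show "y \<in> set (nb x)" by (auto simp: nb_def set_nbrs doubleton_eq_iff)
qed (auto simp: nb_def set_nbrs insert_commute dest: es_edge(1))

lemma nb_less: "y \<in> set (nb x) \<Longrightarrow> x < n \<and> y < n \<and> x \<noteq> y"
  using E_edge by (simp add: nb_iff)

lemma nb_sym: "y \<in> set (nb x) \<Longrightarrow> x \<in> set (nb y)"
  by (simp add: nb_iff insert_commute)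

lemma distinct_nb: "distinct (nb x)"
  unfolding nb_def using edges es_edge(4) by (intro distinct_nbrs) (auto simp: edge_list_def)

lemma finite_E: "finite E"
proof (rule finite_subset)
  show "E \<subseteq> Pow {..<n}" using graph unfolding simple_graph_def by auto
qed simp

lemma degree_le: "u < n \<Longrightarrow> degree E u \<le> D"
  using max_deg unfolding max_degree_def by (auto intro!: Max_ge)

lemma length_nb: "length (nb x) \<le> D"
proof (cases "x < n")
  case True
  have "length (nb x) = card (set (nb x))" by (simp add: distinct_card distinct_nb)
  also have "\<dots> = card ((\<lambda>y. {x, y}) ` set (nb x))"
    by (rule card_image[symmetric]) (auto simp: inj_on_def doubleton_eq_iff)
  also have "\<dots> \<le> degree E x"
    unfolding degree_def using finite_E by (intro card_mono) (auto simp: nb_iff)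
  finally show ?thesis using degree_le[OF True] by simp
next
  case False
  then have "set (nb x) = {}" using nb_less[of _ x] by (meson equals0I)
  then show ?thesis by simp
qed

lemma length_nb_n: "length (nb x) \<le> n"
proof -
  have "length (nb x) = card (set (nb x))" by (simp add: distinct_card distinct_nb)
  also have "\<dots> \<le> card {..<n}" using nb_less by (intro card_mono) auto
  finally show ?thesis by simp
qed

lemma length_es: "length es \<le> n * D"
proof -
  have "length es = card E"
    using edges unfolding edge_list_def by (metis distinct_card length_map)
  also have "\<dots> \<le> card (\<Union>u<n. {e \<in> E. u \<in> e})"
  proof (rule card_mono)
    show "E \<subseteq> (\<Union>u<n. {e \<in> E. u \<in> e})"
      using graph unfolding simple_graph_def by fastforce
  qed (use finite_E in auto)
  also have "\<dots> \<le> (\<Sum>u<n. card {e \<in> E. u \<in> e})" by (rule card_UN_le) simp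
  also have "\<dots> \<le> (\<Sum>u<n. D)" using degree_le by (intro sum_mono) (auto simp: degree_def)
  finally show ?thesis by simp
qed

lemma blk_in: "v < n \<Longrightarrow> 1 \<le> blk v \<and> blk v \<le> k \<and> v \<in> B (blk v)"
  using blocks unfolding block_list_def blk_def array_of_def by auto

lemma B_iff: "i \<in> {1..k} \<Longrightarrow> v \<in> B i \<longleftrightarrow> v < n \<and> blk v = i"
proof -
  assume i: "i \<in> {1..k}"
  have "v \<in> B i \<Longrightarrow> v < n" using partition i unfolding block_partition_def by blast
  moreover have "v < n \<Longrightarrow> v \<in> B i \<Longrightarrow> blk v = i"
    using partition i blk_in[of v] unfolding block_partition_def disjoint_family_on_def
    by (metis atLeastAtMost_iff disjoint_iff)
  ultimately show ?thesis using blk_in[of v] by blast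
qed

lemma finite_B: "i \<in> {1..k} \<Longrightarrow> finite (B i)"
  by (rule finite_subset[of _ "{..<n}"]) (auto simp: B_iff)

lemma card_B: "i \<in> {1..k} \<Longrightarrow> card (B i) = b"
  using partition by (simp add: block_partition_def)

lemma n_eq: "n = k * b"
proof -
  have "card (\<Union>i\<in>{1..k}. B i) = (\<Sum>i\<in>{1..k}. card (B i))"
    using partition finite_B by (intro card_UN_disjoint) (auto simp: block_partition_def disjoint_family_on_def)
  then show ?thesis using partition by (simp add: block_partition_def)
qed

lemma W_big: "(n + k + b + 2) * (n + k + b + 2) < W"
proof -
  let ?N = "n + k + b + 2"
  have "?N * ?N * 1 < ?N * ?N * ?N" by (rule mult_strict_left_mono) auto
  then show ?thesis by (simp only: W_def word_base_def power3_eq_cube mult_1_right)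
qed

lemma W_gr: "x \<le> 2 * (n + k + b + 2) \<Longrightarrow> x < W"
proof -
  assume "x \<le> 2 * (n + k + b + 2)"
  also have "\<dots> \<le> (n + k + b + 2) * (n + k + b + 2)" by (rule mult_le_mono1) simp
  finally show ?thesis using W_big by simp
qed

lemma es_less_W: "length es < W"
proof -
  have "length es \<le> n * D" by (rule length_es)
  also have "\<dots> \<le> (n + k + b + 2) * (n + k + b + 2)" using large by (intro mult_mono) auto
  finally show ?thesis using W_big by simp
qed

lemma small_mod: "x \<le> 2 * (n + k + b + 2) \<Longrightarrow> x mod W = x"
  using W_gr by simp

lemma W_1: "Suc 0 mod W = Suc 0" "1 < W" "W \<noteq> Suc 0"
  using W_gr[of 1] by auto

lemma nx_less: "u < n \<Longrightarrow> t \<le> n \<Longrightarrow> u * n + t < W"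
proof -
  assume "u < n" "t \<le> n"
  then have "u * n + t \<le> n * n + n" by (intro add_mono mult_le_mono1) auto
  also have "\<dots> = n * (n + 1)" by simp
  also have "\<dots> \<le> (n + k + b + 2) * (n + k + b + 2)" by (intro mult_mono) auto
  finally show ?thesis using W_big by simp
qed

lemma ix_less: "i \<le> k \<Longrightarrow> q \<le> b \<Longrightarrow> i * H + q < W"
proof -
  assume "i \<le> k" "q \<le> b"
  then have "i * H + q \<le> k * H + b" by (intro add_mono mult_le_mono1) auto
  also have "\<dots> \<le> (n + k + b + 2) * (n + k + b + 2)"
    by (simp add: H_def algebra_simps)
  finally show ?thesis using W_big by simp
qed

lemma eval_nx:
  assumes "vars s ''n'' = n" "vars s x < n" "eval_exp W s e \<le> n"
  shows "eval_exp W s (nx x e) = vars s x * n + eval_exp W s e"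
  using assms nx_less[OF assms(2,3)] by (simp add: nx_def)

lemma eval_ix:
  assumes "vars s ''h'' = H" "vars s x \<le> k" "eval_exp W s e \<le> b"
  shows "eval_exp W s (ix x e) = vars s x * H + eval_exp W s e"
  using assms ix_less[OF assms(2,3)] by (simp add: ix_def)

section \<open>Correctness of the adjacency lists and of the initial colouring\<close>

definition adj_ok :: "nat \<Rightarrow> mem \<Rightarrow> bool" where
  "adj_ok j s \<longleftrightarrow> (\<forall>u<n. arrs s ''deg'' u = length (nbrs (take j es) u) \<and>
     (\<forall>t<length (nbrs (take j es) u). arrs s ''adj'' (u * n + t) = nbrs (take j es) u ! t))"

lemma ht_edges:
  assumes s0: "vars s0 ''e'' = 0" "vars s0 ''m'' = length es" "vars s0 ''n'' = n"
    "arrs s0 ''src'' = array_of (map fst es)" "arrs s0 ''dst'' = array_of (map snd es)"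
    "arrs s0 ''deg'' = (\<lambda>_. 0)"
  shows "ht W (For ''e'' ''m'' edge_body) s0
    (\<lambda>s. same {''e'', ''u'', ''w''} {''deg'', ''adj''} s0 s \<and> adj_ok (length es) s) (n * D * 60 + 4)"
proof -
  define I where "I j s \<longleftrightarrow> vars s ''e'' = j \<and> same {''e'', ''u'', ''w''} {''deg'', ''adj''} s0 s \<and> adj_ok j s" for j s
  have "ht W (For ''e'' ''m'' edge_body) s0 (I (length es)) ((length es - 0) * (51 + 9) + 4)"
  proof (rule ht_For)
    fix j s
    assume "I j s"
    then show "vars s ''e'' = j \<and> vars s ''m'' = length es" using s0 by (simp add: I_def same_def)
  next
    fix j s
    assume I: "I j s" and j: "j < length es"
    obtain x y where xy: "es ! j = (x, y)" by force
    then have "(x, y) \<in> set es" using j nth_mem by metis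
    note e = es_edge[OF this]
    have tk: "nbrs (take (Suc j) es) u = nbrs (take j es) u @ (if x = u then [y] else []) @ (if y = u then [x] else [])" for u
      using j xy by (simp add: take_Suc_conv_app_nth nbrs_append nbrs_def[of "[_]"])
    have le: "length (nbrs (take j' es) u) \<le> n" for j' u
    proof -
      have "nb u = nbrs (take j' es) u @ nbrs (drop j' es) u"
        unfolding nb_def by (metis append_take_drop_id nbrs_append)
      then show ?thesis using length_nb_n[of u] by simp
    qed
    \<comment> \<open>Even with the new edge both lists have at most \<open>n\<close> entries, so
      the entries to be written lie within their rows.\<close>
    have lt: "length (nbrs (take j es) x) < n" "length (nbrs (take j es) y) < n"
      using le[of "Suc j" x] le[of "Suc j" y] unfolding tk by auto
    have v: "vars s ''e'' = j" "vars s ''n'' = n" "arrs s ''src'' = array_of (map fst es)" "arrs s ''dst'' = array_of (map snd es)"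
      using I s0 by (simp_all add: I_def same_def)
    have d: "arrs s ''deg'' x = length (nbrs (take j es) x)" "arrs s ''deg'' y = length (nbrs (take j es) y)"
      using I e by (auto simp: I_def adj_ok_def)
    have fs: "array_of (map fst es) j = x" "array_of (map snd es) j = y"
      using j xy by (simp_all add: array_of_def)
    have ne: "y \<noteq> x" using e by auto
    have idx: "u * n + t = x * n + length (nbrs (take j es) x) \<longleftrightarrow> u = x \<and> t = length (nbrs (take j es) x)"
      "u * n + t = y * n + length (nbrs (take j es) y) \<longleftrightarrow> u = y \<and> t = length (nbrs (take j es) y)"
      if "t < n" for u t using index_inj that lt by blast+
    have tn: "t < length (nbrs (take j' es) u) \<Longrightarrow> t < n" for t j' u using le[of j' u] by simp
    have I': "adj_ok (Suc j) (set_var ''e'' (Suc j) (set_arr ''deg'' y (Suc (length (nbrs (take j es) y)))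
          (set_arr ''adj'' (y * n + length (nbrs (take j es) y)) x
            (set_arr ''deg'' x (Suc (length (nbrs (take j es) x)))
              (set_arr ''adj'' (x * n + length (nbrs (take j es) x)) y
                (set_var ''w'' y (set_var ''u'' x s)))))))" (is "adj_ok _ ?s")
      unfolding adj_ok_def
    proof (intro allI impI conjI)
      fix u assume u: "u < n"
      show "arrs ?s ''deg'' u = length (nbrs (take (Suc j) es) u)"
        using I u ne by (auto simp: tk I_def adj_ok_def)
      fix t assume t: "t < length (nbrs (take (Suc j) es) u)"
      show "arrs ?s ''adj'' (u * n + t) = nbrs (take (Suc j) es) u ! t"
        using I u ne t idx[OF tn[OF t]] by (auto simp: tk I_def adj_ok_def nth_append split: if_splits)
    qed
    have sm: "Suc (length (nbrs (take j es) x)) mod W = Suc (length (nbrs (take j es) x))"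
      "Suc (length (nbrs (take j es) y)) mod W = Suc (length (nbrs (take j es) y))"
      using lt by (auto intro!: small_mod)
    show "ht W edge_body s (\<lambda>s'. vars s' ''e'' = j \<and> I (Suc j) (set_var ''e'' (Suc j) s')) 51"
      unfolding edge_body_def
      apply (rule ht_mono)
       apply (rule ht_Assign_Seq ht_Store_Seq)+
       apply (rule ht_Store)
       apply (simp add: v fs eval_nx e(2-4) lt less_imp_le d ne sm W_1)
       apply (use I I' in \<open>simp add: I_def same_upd\<close>)
      apply simp
      done
  next
    show "I 0 s0" using s0 by (simp add: I_def same_refl adj_ok_def)
  qed (use W_1 es_less_W in auto)
  then show ?thesis
    using length_es by (elim ht_post[THEN ht_mono]) (auto simp: I_def intro: mult_le_mono1)
qed

text \<open>\<open>at\<close> is only required to be a left inverse of the colouring. This makes the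
  colouring injective on each block, and counting then makes it a bijection with the
  \<open>b\<close> colours.\<close>

definition col_ok :: "nat \<Rightarrow> mem \<Rightarrow> bool" where
  "col_ok j s \<longleftrightarrow> (\<forall>u<j. 1 \<le> arrs s ''color'' u \<and> arrs s ''color'' u \<le> b \<and>
     arrs s ''at'' (blk u * H + arrs s ''color'' u) = u)"

lemma ht_vertices:
  assumes s0: "vars s0 ''v'' = 0" "vars s0 ''n'' = n" "vars s0 ''h'' = H"
    "arrs s0 ''block'' = blk" "arrs s0 ''cnt'' = (\<lambda>_. 0)"
  shows "ht W (For ''v'' ''n'' vertex_body) s0
    (\<lambda>s. same {''v'', ''i''} {''cnt'', ''at'', ''color''} s0 s \<and> col_ok n s) (n * 40 + 4)"
proof -
  define I where "I j s \<longleftrightarrow> vars s ''v'' = j \<and> same {''v'', ''i''} {''cnt'', ''at'', ''color''} s0 s \<and>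
     (\<forall>i\<in>{1..k}. arrs s ''cnt'' i = card {u. u < j \<and> blk u = i}) \<and>
     (\<forall>u<j. 1 \<le> arrs s ''color'' u \<and> arrs s ''color'' u \<le> arrs s ''cnt'' (blk u) \<and>
        arrs s ''at'' (blk u * H + arrs s ''color'' u) = u)" for j s
  have cnt_le: "card {u. u < j \<and> blk u = i} \<le> b" if "i \<in> {1..k}" "j \<le> n" for i j
  proof -
    have "{u. u < j \<and> blk u = i} \<subseteq> B i" using that by (auto simp: B_iff)
    then show ?thesis using card_mono[OF finite_B[OF that(1)]] card_B[OF that(1)] by metis
  qed
  have col: "arrs s ''color'' u \<le> b" if I: "I j s" and "u < j" "j \<le> n" for j u s
  proof -
    have u: "blk u \<in> {1..k}" using blk_in[of u] that by auto
    have "arrs s ''color'' u \<le> arrs s ''cnt'' (blk u)" using I \<open>u < j\<close> by (simp add: I_def)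
    also have "\<dots> = card {u'. u' < j \<and> blk u' = blk u}" using I u by (simp add: I_def)
    also have "\<dots> \<le> b" by (rule cnt_le[OF u \<open>j \<le> n\<close>])
    finally show ?thesis .
  qed
  have "ht W (For ''v'' ''n'' vertex_body) s0 (I n) ((n - 0) * (31 + 9) + 4)"
  proof (rule ht_For)
    fix j s
    assume "I j s"
    then show "vars s ''v'' = j \<and> vars s ''n'' = n" using s0 by (simp add: I_def same_def)
  next
    fix j s
    assume I: "I j s" and j: "j < n"
    define c where "c = card {u. u < j \<and> blk u = blk j}"
    have bj: "blk j \<in> {1..k}" "blk j \<le> k" using blk_in[OF j] by auto
    have "{u. u < Suc j \<and> blk u = blk j} = insert j {u. u < j \<and> blk u = blk j}" by auto
    then have Sc: "card {u. u < Suc j \<and> blk u = blk j} = Suc c" by (simp add: c_def)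
    then have cb: "Suc c \<le> b" using cnt_le[OF bj(1), of "Suc j"] j by simp
    have v: "vars s ''v'' = j" "vars s ''n'' = n" "vars s ''h'' = H" "arrs s ''block'' = blk"
      "arrs s ''cnt'' (blk j) = c"
      using I s0 bj by (simp_all add: I_def same_def c_def)
    have sm: "Suc c mod W = Suc c" using cb by (intro small_mod) simp
    let ?s = "set_var ''v'' (Suc j) (set_arr ''color'' j (Suc c) (set_arr ''at'' (blk j * H + Suc c) j
       (set_arr ''cnt'' (blk j) (Suc c) (set_var ''i'' (blk j) s))))"
    have "I (Suc j) ?s"
      unfolding I_def
    proof (intro conjI ballI allI impI)
      show "same {''v'', ''i''} {''cnt'', ''at'', ''color''} s0 ?s"
        using I by (simp add: I_def same_upd)
      fix i assume i: "i \<in> {1..k}"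
      have "i \<noteq> blk j \<Longrightarrow> {u. u < Suc j \<and> blk u = i} = {u. u < j \<and> blk u = i}"
        by (auto simp: less_Suc_eq)
      then show "arrs ?s ''cnt'' i = card {u. u < Suc j \<and> blk u = i}"
        using I i Sc by (auto simp: I_def)
    next
      fix u assume u: "u < Suc j"
      show "1 \<le> arrs ?s ''color'' u" "arrs ?s ''color'' u \<le> arrs ?s ''cnt'' (blk u)"
        using I u v(5) by (auto simp: I_def less_Suc_eq le_Suc_eq)
      show "arrs ?s ''at'' (blk u * H + arrs ?s ''color'' u) = u"
      proof (cases "u = j")
        case False
        then have uj: "u < j" using u by simp
        \<comment> \<open>Earlier vertices of the block have colours up to its counter, which is
          still \<open>c\<close>, so storing the new vertex overwrites none of their
          entries.\<close>
        have "blk u * H + arrs s ''color'' u \<noteq> blk j * H + Suc c"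
        proof
          assume "blk u * H + arrs s ''color'' u = blk j * H + Suc c"
          moreover have "arrs s ''color'' u < H" "Suc c < H" using col[OF I uj] j cb by (auto simp: H_def)
          ultimately have *: "blk u = blk j" "arrs s ''color'' u = Suc c" using index_inj by blast+
          have "arrs s ''color'' u \<le> arrs s ''cnt'' (blk u)" using I uj by (simp add: I_def)
          then show False using * v(5) by simp
        qed
        then show ?thesis using I uj by (simp add: I_def)
      qed simp
    qed simp
    then show "ht W vertex_body s (\<lambda>s'. vars s' ''v'' = j \<and> I (Suc j) (set_var ''v'' (Suc j) s')) 31"
      unfolding vertex_body_def
      apply -
      apply (rule ht_mono)
       apply (rule ht_Assign_Seq ht_Store_Seq)+
       apply (rule ht_Store)
       apply (simp add: v sm W_1 eval_ix bj cb)
      apply simp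
      done
  next
    show "I 0 s0" using s0 by (simp add: I_def same_refl)
  qed (use W_1 W_gr[of n] in auto)
  then show ?thesis
  proof (elim ht_post[THEN ht_mono])
    fix s assume I: "I n s"
    show "same {''v'', ''i''} {''cnt'', ''at'', ''color''} s0 s \<and> col_ok n s"
      using I col[OF I] by (simp add: I_def col_ok_def)
  qed simp
qed

lemma col_inj:
  assumes "col_ok n s" "i \<in> {1..k}"
  shows "bij_betw (arrs s ''color'') (B i) {1..b}"
proof -
  let ?f = "arrs s ''color''"
  have inj: "inj_on ?f (B i)"
  proof (rule inj_onI)
    fix x y assume xy: "x \<in> B i" "y \<in> B i" "?f x = ?f y"
    then have "x < n" "y < n" "blk x = blk y" using B_iff[OF assms(2)] by auto
    moreover have "arrs s ''at'' (blk x * H + ?f x) = x" "arrs s ''at'' (blk y * H + ?f y) = y"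
      using assms(1)[unfolded col_ok_def, rule_format, OF \<open>x < n\<close>]
        assms(1)[unfolded col_ok_def, rule_format, OF \<open>y < n\<close>] by simp_all
    ultimately show "x = y" using xy(3) by metis
  qed
  moreover have "?f ` B i \<subseteq> {1..b}"
    using assms B_iff[OF assms(2)] by (auto simp: col_ok_def)
  moreover have "card (?f ` B i) = card {1..b}"
    using card_image[OF inj] card_B[OF assms(2)] by simp
  ultimately show ?thesis using card_subset_eq[of "{1..b}"] by (auto simp: bij_betw_def)
qed

text \<open>All colours occur in every block, so the left inverse \<open>at\<close> is a right
  inverse as well.\<close>

lemma col_at:
  assumes "col_ok n s" "1 \<le> i" "i \<le> k" "1 \<le> q" "q \<le> b"
  shows "arrs s ''at'' (i * H + q) < n" "blk (arrs s ''at'' (i * H + q)) = i"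
    "arrs s ''color'' (arrs s ''at'' (i * H + q)) = q"
proof -
  have i: "i \<in> {1..k}" using assms by simp
  have "q \<in> arrs s ''color'' ` B i"
    using col_inj[OF assms(1) i] assms(4,5) unfolding bij_betw_def by simp
  then obtain u where u: "u \<in> B i" "arrs s ''color'' u = q" by auto
  then have "u < n" "blk u = i" using B_iff[OF i] by auto
  then have "arrs s ''at'' (i * H + q) = u" using assms(1) u(2) by (auto simp: col_ok_def)
  then show "arrs s ''at'' (i * H + q) < n" "blk (arrs s ''at'' (i * H + q)) = i"
    "arrs s ''color'' (arrs s ''at'' (i * H + q)) = q"
    using u \<open>u < n\<close> \<open>blk u = i\<close> by auto
qed

end

section \<open>Candidate lists and conflicts\<close>

text \<open>
  Vertices: \<open>v\<close> is being processed and has colour \<open>c\<close> and block \<open>o\<close>, \<open>w\<close> has colour \<open>c\<close> in block \<open>i\<close>, \<open>x\<close> is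
  the candidate drawn for block \<open>i\<close>, \<open>y\<close> is its current neighbour, and \<open>j\<close> is the block of a conflict or 0.
  The candidates of block \<open>i\<close> are the first \<open>a\<close> entries of row \<open>i\<close> of \<open>L\<close>, whose length so far is \<open>l\<close>.
  Row \<open>i\<close> of \<open>at\<close> lists the vertices of block \<open>i\<close> by colour; the rows have length \<open>h = b + 1\<close>. The entry of
  \<open>T\<close> for a block is 0 if the block is blank, and otherwise the successor of the chosen vertex. The
  top of the stack \<open>stk\<close> is at position \<open>p - 1\<close>.
\<close>

definition inner_body :: com where
  "inner_body = If (Op Eq (Arr ''color'' (Arr ''adj'' (nx ''w'' (Var ''t'')))) (Var ''q''))
     (Assign ''z'' (Const 1)) Skip"

definition col_body :: com where
  "col_body = Seq (Assign ''z'' (Const 0)) (Seq (Assign ''t'' (Const 0)) (Seq (For ''t'' ''d'' inner_body)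
     (If (Var ''z'') Skip
        (Seq (Store ''L'' (ix ''i'' (Var ''l'')) (Arr ''at'' (ix ''i'' (Var ''q''))))
             (Assign ''l'' (Op Plus (Var ''l'') (Const 1)))))))"

definition build_body :: com where
  "build_body = Seq (Assign ''w'' (Arr ''at'' (ix ''i'' (Var ''c''))))
    (Seq (Assign ''d'' (Arr ''deg'' (Var ''w'')))
    (Seq (Assign ''l'' (Const 0))
    (Seq (Assign ''q'' (Const 1))
    (Seq (For ''q'' ''h'' col_body)
    (Seq (Store ''T'' (Var ''i'') (Const 0))
         (If (Op Eq (Var ''i'') (Var ''o'')) Skip
            (Seq (Store ''stk'' (Var ''p'') (Var ''i'')) (Assign ''p'' (Op Plus (Var ''p'') (Const 1))))))))))"

definition conf_body :: com where
  "conf_body = Seq (Assign ''y'' (Arr ''adj'' (nx ''x'' (Var ''t''))))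
    (If (Op Eq (Arr ''T'' (Arr ''block'' (Var ''y''))) (Op Plus (Var ''y'') (Const 1)))
       (Assign ''j'' (Arr ''block'' (Var ''y''))) Skip)"

definition fill_body :: com where
  "fill_body = Seq (If (Op Eq (Var ''i'') (Var ''o'')) (Assign ''x'' (Var ''v'')) (Assign ''x'' (Arr ''L'' (ix ''i'' (Var ''r'')))))
    (Seq (Assign ''j'' (Const 0))
    (Seq (Assign ''d'' (Arr ''deg'' (Var ''x'')))
    (Seq (Assign ''t'' (Const 0))
    (Seq (For ''t'' ''d'' conf_body)
      (If (Var ''j'')
        (Seq (Store ''T'' (Var ''j'') (Const 0))
        (Seq (Store ''stk'' (Var ''p'') (Var ''j''))
             (Assign ''p'' (Op Plus (Var ''p'') (Const 1)))))
        (Seq (Store ''T'' (Var ''i'') (Op Plus (Var ''x'') (Const 1)))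
             (Assign ''p'' (Op Minus (Var ''p'') (Const 1)))))))))"

text \<open>The drawn index is ignored for the block of \<open>v\<close>. Drawing it nevertheless
  gives all iterations the same form, that of a step of the walk.\<close>

definition search_body :: com where
  "search_body = Seq (Assign ''i'' (Arr ''stk'' (Op Minus (Var ''p'') (Const 1))))
    (Seq (Draw ''r'' (Var ''a'')) fill_body)"

definition swap_body :: com where
  "swap_body = Seq (Assign ''x'' (Op Minus (Arr ''T'' (Var ''i'')) (Const 1)))
    (Seq (Assign ''w'' (Arr ''at'' (ix ''i'' (Var ''c''))))
    (Seq (Assign ''q'' (Arr ''color'' (Var ''x'')))
    (Seq (Store ''color'' (Var ''x'') (Var ''c''))
    (Seq (Store ''color'' (Var ''w'') (Var ''q''))
    (Seq (Store ''at'' (ix ''i'' (Var ''c'')) (Var ''x''))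
         (Store ''at'' (ix ''i'' (Var ''q'')) (Var ''w'')))))))"

context strong_instance
begin

definition env :: "mem \<Rightarrow> bool" where
  "env s \<longleftrightarrow> vars s ''n'' = n \<and> vars s ''h'' = H \<and> vars s ''g'' = Suc k \<and> vars s ''a'' = a \<and>
     arrs s ''block'' = blk \<and> adj_ok (length es) s"

lemma env_vars:
  assumes "env s"
  shows "vars s ''n'' = n" "vars s ''h'' = H" "vars s ''g'' = Suc k" "vars s ''a'' = a" "arrs s ''block'' = blk"
    "u < n \<Longrightarrow> arrs s ''deg'' u = length (nb u)"
    "u < n \<Longrightarrow> t < length (nb u) \<Longrightarrow> arrs s ''adj'' (u * n + t) = nb u ! t"
  using assms by (auto simp: env_def adj_ok_def nb_def)

lemma env_set [simp]:
  "x \<notin> {''n'', ''h'', ''g'', ''a''} \<Longrightarrow> env (set_var x c s) = env s"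
  "y \<notin> {''block'', ''deg'', ''adj''} \<Longrightarrow> env (set_arr y i c s) = env s"
  by (simp_all add: env_def adj_ok_def not_sym)

lemma env_same:
  assumes "same X Y s s'" "env s" "X \<inter> {''n'', ''h'', ''g'', ''a''} = {}" "Y \<inter> {''block'', ''deg'', ''adj''} = {}"
  shows "env s'"
proof -
  have "vars s' x = vars s x" if "x \<in> {''n'', ''h'', ''g'', ''a''}" for x
    using assms(1,3) that unfolding same_def by blast
  moreover have "arrs s' y = arrs s y" if "y \<in> {''block'', ''deg'', ''adj''}" for y
    using assms(1,4) that unfolding same_def by blast
  ultimately show ?thesis using assms(2) by (simp add: env_def adj_ok_def)
qed

lemma ht_inner:
  assumes s0: "env s0" "vars s0 ''w'' = u" "u < n" "vars s0 ''d'' = length (nb u)" "vars s0 ''t'' = 0" "vars s0 ''z'' = 0"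
  shows "ht W (For ''t'' ''d'' inner_body) s0 (\<lambda>s. same {''t'', ''z''} {} s0 s \<and>
     vars s ''z'' = of_bool (vars s0 ''q'' \<in> arrs s0 ''color'' ` set (nb u))) (D * 21 + 4)"
proof -
  define I where "I j s \<longleftrightarrow> vars s ''t'' = j \<and> same {''t'', ''z''} {} s0 s \<and>
     vars s ''z'' = of_bool (vars s0 ''q'' \<in> arrs s0 ''color'' ` set (take j (nb u)))" for j s
  have "ht W (For ''t'' ''d'' inner_body) s0 (I (length (nb u))) ((length (nb u) - 0) * (12 + 9) + 4)"
  proof (rule ht_For)
    fix j s assume "I j s"
    then show "vars s ''t'' = j \<and> vars s ''d'' = length (nb u)" using s0 by (simp add: I_def same_def)
  next
    fix j s assume I: "I j s" and j: "j < length (nb u)"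
    have sm: "same {''t'', ''z''} {} s0 s" using I by (simp add: I_def)
    have v: "vars s ''t'' = j" "vars s ''w'' = u" "vars s ''q'' = vars s0 ''q''" "arrs s ''color'' = arrs s0 ''color''"
      "vars s ''z'' = of_bool (vars s0 ''q'' \<in> arrs s0 ''color'' ` set (take j (nb u)))"
      using I s0 by (simp_all add: I_def same_def)
    have e: "env s" by (rule env_same[OF sm s0(1)]) auto
    have jn: "j \<le> n" using j length_nb_n[of u] by simp
    show "ht W inner_body s (\<lambda>s'. vars s' ''t'' = j \<and> I (Suc j) (set_var ''t'' (Suc j) s')) 12"
      unfolding inner_body_def
      apply (rule ht_mono)
       apply (rule ht_If)
        apply (rule ht_Assign)
        apply (use sm v e j jn s0(3) in \<open>simp add: eval_nx env_vars W_1 I_def same_upd take_Suc_conv_app_nth split: if_splits\<close>)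
       apply (rule ht_Skip)
       apply (use sm v e j jn s0(3) in \<open>simp add: eval_nx env_vars W_1 I_def same_upd take_Suc_conv_app_nth split: if_splits\<close>)
      apply simp
      done
  next
    show "I 0 s0" using s0 by (simp add: I_def same_refl)
  qed (use W_1 W_gr[of "length (nb u)"] length_nb_n[of u] in auto)
  then show ?thesis
    by (elim ht_post[THEN ht_mono]) (auto simp: I_def length_nb mult_le_mono1)
qed

definition good :: "(nat \<Rightarrow> nat) \<Rightarrow> nat \<Rightarrow> nat \<Rightarrow> nat list" where
  "good f u q = filter (\<lambda>c. c \<notin> f ` set (nb u)) [1..<q]"

lemma good_Suc: "1 \<le> q \<Longrightarrow> good f u (Suc q) = good f u q @ (if q \<in> f ` set (nb u) then [] else [q])"
  by (simp add: good_def)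

lemma length_good: "length (good f u q) \<le> q - 1"
  unfolding good_def by (rule order_trans[OF length_filter_le]) simp

text \<open>All rows share the array \<open>L\<close>; the last conjunct of the postcondition keeps
  the rows built earlier.\<close>

lemma ht_cols:
  assumes s0: "env s0" "vars s0 ''i'' = i" "1 \<le> i" "i \<le> k" "vars s0 ''w'' = u" "u < n"
    "vars s0 ''d'' = length (nb u)" "vars s0 ''l'' = 0" "vars s0 ''q'' = 1"
  shows "ht W (For ''q'' ''h'' col_body) s0 (\<lambda>s. same {''q'', ''z'', ''t'', ''l''} {''L''} s0 s \<and>
     (\<forall>r<length (good (arrs s0 ''color'') u H).
        arrs s ''L'' (i * H + r) = arrs s0 ''at'' (i * H + good (arrs s0 ''color'') u H ! r)) \<and>
     (\<forall>i' r. i' \<noteq> i \<longrightarrow> r < H \<longrightarrow> arrs s ''L'' (i' * H + r) = arrs s0 ''L'' (i' * H + r)))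
     (b * (D * 21 + 50) + 4)"
proof -
  define f where "f = arrs s0 ''color''"
  define I where "I j s \<longleftrightarrow> vars s ''q'' = j \<and> 1 \<le> j \<and> same {''q'', ''z'', ''t'', ''l''} {''L''} s0 s \<and>
     vars s ''l'' = length (good f u j) \<and>
     (\<forall>r<length (good f u j). arrs s ''L'' (i * H + r) = arrs s0 ''at'' (i * H + good f u j ! r)) \<and>
     (\<forall>i' r. i' \<noteq> i \<longrightarrow> r < H \<longrightarrow> arrs s ''L'' (i' * H + r) = arrs s0 ''L'' (i' * H + r))" for j s
  have "ht W (For ''q'' ''h'' col_body) s0 (I H) ((H - 1) * ((D * 21 + 41) + 9) + 4)"
  proof (rule ht_For)
    fix j s assume "I j s"
    then show "vars s ''q'' = j \<and> vars s ''h'' = H" using s0 by (simp add: I_def same_def env_vars)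
  next
    fix j s assume I: "I j s" and j: "j < H"
    have sm: "same {''q'', ''z'', ''t'', ''l''} {''L''} s0 s" using I by (simp add: I_def)
    have v: "vars s ''q'' = j" "vars s ''w'' = u" "vars s ''d'' = length (nb u)" "vars s ''i'' = i"
       "arrs s ''color'' = f" "arrs s ''at'' = arrs s0 ''at''" "vars s ''l'' = length (good f u j)" "1 \<le> j"
      using I s0 by (simp_all add: I_def same_def f_def)
    have e: "env s" by (rule env_same[OF sm s0(1)]) auto
    have jb: "j \<le> b" using j by (simp add: H_def)
    have lg: "length (good f u j) < b" "length (good f u j) < H"
      using length_good[of f u j] jb v(8) by (auto simp: H_def)
    have lm: "Suc (length (good f u j)) mod W = Suc (length (good f u j))" using lg by (intro small_mod) simp
    have I_L: "\<forall>r<length (good f u j). arrs s ''L'' (i * H + r) = arrs s0 ''at'' (i * H + good f u j ! r)"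
      "\<forall>i' r. i' \<noteq> i \<longrightarrow> r < H \<longrightarrow> arrs s ''L'' (i' * H + r) = arrs s0 ''L'' (i' * H + r)"
      using I by (simp_all add: I_def)
    have idx: "i' * H + r = i * H + length (good f u j) \<longleftrightarrow> i' = i \<and> r = length (good f u j)" if "r < H" for i' r
      using index_inj that lg by blast
    show "ht W col_body s (\<lambda>s'. vars s' ''q'' = j \<and> I (Suc j) (set_var ''q'' (Suc j) s')) (D * 21 + 41)"
      unfolding col_body_def
    proof (rule ht_mono)
      show "ht W (Seq (Assign ''z'' (Const 0)) (Seq (Assign ''t'' (Const 0)) (Seq (For ''t'' ''d'' inner_body)
         (If (Var ''z'') Skip
        (Seq (Store ''L'' (ix ''i'' (Var ''l'')) (Arr ''at'' (ix ''i'' (Var ''q''))))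
             (Assign ''l'' (Op Plus (Var ''l'') (Const 1))))))))
         s (\<lambda>s'. vars s' ''q'' = j \<and> I (Suc j) (set_var ''q'' (Suc j) s'))
         (1 + exp_cost (Const 0) + (1 + exp_cost (Const 0) + ((D * 21 + 4) + (1 + exp_cost (Var ''z'') + max 1 20))))"
      proof (rule ht_Assign_Seq, rule ht_Assign_Seq, rule ht_Seq, rule ht_inner[where u = u])
        fix s'
        assume s': "same {''t'', ''z''} {} (set_var ''t'' (eval_exp W (set_var ''z'' (eval_exp W s (Const 0)) s) (Const 0))
            (set_var ''z'' (eval_exp W s (Const 0)) s)) s' \<and>
          vars s' ''z'' = of_bool (vars (set_var ''t'' (eval_exp W (set_var ''z'' (eval_exp W s (Const 0)) s) (Const 0))
            (set_var ''z'' (eval_exp W s (Const 0)) s)) ''q'' \<in>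
             arrs (set_var ''t'' (eval_exp W (set_var ''z'' (eval_exp W s (Const 0)) s) (Const 0))
            (set_var ''z'' (eval_exp W s (Const 0)) s)) ''color'' ` set (nb u))"
        have z: "vars s' ''z'' = of_bool (j \<in> f ` set (nb u))" using s' v by simp
        have ss: "same {''q'', ''z'', ''t'', ''l''} {''L''} s0 s'"
          using s' sm by (auto simp: same_def)
        have v': "vars s' ''q'' = j" "vars s' ''i'' = i" "vars s' ''l'' = length (good f u j)" "arrs s' = arrs s"
          using s' v by (auto simp: same_def)
        have e': "vars s' ''h'' = H" using s' e by (simp add: same_def env_vars)
        show "ht W (If (Var ''z'') Skip
            (Seq (Store ''L'' (ix ''i'' (Var ''l'')) (Arr ''at'' (ix ''i'' (Var ''q''))))
             (Assign ''l'' (Op Plus (Var ''l'') (Const 1)))))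
           s' (\<lambda>s'. vars s' ''q'' = j \<and> I (Suc j) (set_var ''q'' (Suc j) s')) (1 + exp_cost (Var ''z'') + max 1 20)"
        proof (rule ht_If)
          assume "eval_exp W s' (Var ''z'') \<noteq> 0"
          then have "j \<in> f ` set (nb u)" using z by (simp split: if_splits)
          then show "ht W Skip s' (\<lambda>s'. vars s' ''q'' = j \<and> I (Suc j) (set_var ''q'' (Suc j) s')) 1"
            using v v' ss I_L by (intro ht_Skip) (simp add: I_def good_Suc same_upd)
        next
          assume "eval_exp W s' (Var ''z'') = 0"
          then have j': "j \<notin> f ` set (nb u)" using z by (simp split: if_splits)
          show "ht W (Seq (Store ''L'' (ix ''i'' (Var ''l'')) (Arr ''at'' (ix ''i'' (Var ''q''))))
             (Assign ''l'' (Op Plus (Var ''l'') (Const 1))))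
             s' (\<lambda>s'. vars s' ''q'' = j \<and> I (Suc j) (set_var ''q'' (Suc j) s')) 20"
            apply (rule ht_mono)
             apply (rule ht_Store_Seq)
             apply (rule ht_Assign)
             apply (use v v' e' ss I_L lg jb s0(4) in \<open>simp add: eval_ix W_1 lm I_def j' good_Suc same_upd idx nth_append less_Suc_eq\<close>)
            apply simp
            done
        qed
      qed (use e v s0(6) in simp_all)
    qed simp
  next
    show "I 1 s0" using s0 by (simp add: I_def same_refl good_def)
  qed (use W_1 W_gr[of H] in \<open>auto simp: H_def\<close>)
  then show ?thesis
    by (elim ht_post[THEN ht_mono]) (auto simp: I_def f_def H_def)
qed

text \<open>The result is the fold that defines \<open>conflict\<close>, written out because the
  walk is only instantiated in the locale \<open>phase\<close>.\<close>

lemma ht_conf: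
  assumes s0: "env s0" "vars s0 ''x'' = u" "u < n" "vars s0 ''d'' = length (nb u)" "vars s0 ''t'' = 0" "vars s0 ''j'' = 0"
  shows "ht W (For ''t'' ''d'' conf_body) s0 (\<lambda>s. same {''t'', ''y'', ''j''} {} s0 s \<and>
     vars s ''j'' = fold (\<lambda>y j. if arrs s0 ''T'' (blk y) = Suc y then blk y else j) (nb u) 0) (D * 30 + 4)"
proof -
  define I where "I j s \<longleftrightarrow> vars s ''t'' = j \<and> same {''t'', ''y'', ''j''} {} s0 s \<and>
     vars s ''j'' = fold (\<lambda>y j. if arrs s0 ''T'' (blk y) = Suc y then blk y else j) (take j (nb u)) 0" for j s
  have "ht W (For ''t'' ''d'' conf_body) s0 (I (length (nb u))) ((length (nb u) - 0) * (21 + 9) + 4)"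
  proof (rule ht_For)
    fix j s assume "I j s"
    then show "vars s ''t'' = j \<and> vars s ''d'' = length (nb u)" using s0 by (simp add: I_def same_def)
  next
    fix j s assume I: "I j s" and j: "j < length (nb u)"
    have sm: "same {''t'', ''y'', ''j''} {} s0 s" using I by (simp add: I_def)
    have v: "vars s ''t'' = j" "vars s ''x'' = u" "arrs s ''T'' = arrs s0 ''T''"
      "vars s ''j'' = fold (\<lambda>y j. if arrs s0 ''T'' (blk y) = Suc y then blk y else j) (take j (nb u)) 0"
      using I s0 by (simp_all add: I_def same_def)
    have e: "env s" by (rule env_same[OF sm s0(1)]) auto
    have jn: "j \<le> n" using j length_nb_n[of u] by simp
    have y: "nb u ! j < n" using j nb_less nth_mem by blast
    then have ym: "Suc (nb u ! j) mod W = Suc (nb u ! j)" by (intro small_mod) simp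
    show "ht W conf_body s (\<lambda>s'. vars s' ''t'' = j \<and> I (Suc j) (set_var ''t'' (Suc j) s')) 21"
      unfolding conf_body_def
      apply (rule ht_mono)
       apply (rule ht_Assign_Seq)
       apply (rule ht_If)
        apply (rule ht_Assign)
        apply (use sm v e j jn s0(3) in \<open>simp add: eval_nx env_vars W_1 ym I_def same_upd take_Suc_conv_app_nth split: if_splits\<close>)
       apply (rule ht_Skip)
       apply (use sm v e j jn s0(3) in \<open>simp add: eval_nx env_vars W_1 ym I_def same_upd take_Suc_conv_app_nth split: if_splits\<close>)
      apply simp
      done
  next
    show "I 0 s0" using s0 by (simp add: I_def same_refl)
  qed (use W_1 W_gr[of "length (nb u)"] length_nb_n[of u] in auto)
  then show ?thesis
    by (elim ht_post[THEN ht_mono]) (auto simp: I_def length_nb mult_le_mono1)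
qed

end

section \<open>Processing one vertex\<close>

definition phase_body :: com where
  "phase_body = Seq (Assign ''c'' (Arr ''color'' (Var ''v'')))
    (Seq (Assign ''o'' (Arr ''block'' (Var ''v'')))
    (Seq (Assign ''p'' (Const 1))
    (Seq (Store ''stk'' (Const 0) (Var ''o''))
    (Seq (Assign ''i'' (Const 1))
    (Seq (For ''i'' ''g'' build_body)
    (Seq (While (Var ''p'') search_body)
    (Seq (Assign ''i'' (Const 1))
         (For ''i'' ''g'' swap_body))))))))"

definition stack :: "mem \<Rightarrow> nat list" where
  "stack s = rev (map (arrs s ''stk'') [0..<vars s ''p''])"

text \<open>\<open>T0\<close> concerns indices that are not blocks. The program blanks the entries
  of the blocks only, whereas the walk wants the whole array to be blank at its start.\<close>

locale phase = strong_instance +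
  fixes s0 :: mem and v :: nat
  assumes v: "v < n" "vars s0 ''v'' = v" and env0: "env s0" and col0: "col_ok n s0"
    and T0: "\<And>i. i \<notin> {1..k} \<Longrightarrow> arrs s0 ''T'' i = 0"
begin

definition f :: "nat \<Rightarrow> nat" where "f = arrs s0 ''color''"
definition gat :: "nat \<Rightarrow> nat" where "gat = arrs s0 ''at''"
definition c :: nat where "c = f v"
definition J :: "nat set" where "J = {1..k}"
definition wit :: "nat \<Rightarrow> nat" where "wit i = gat (i * H + c)"
definition cand :: "nat \<Rightarrow> nat list" where "cand i = good f (wit i) H"
text \<open>In the block of \<open>v\<close> every index selects \<open>v\<close>; this is why
  \<open>inj_sel\<close> exempts that block.\<close>

definition sel :: "nat \<Rightarrow> nat \<Rightarrow> nat" where "sel i r = (if i = blk v then v else gat (i * H + cand i ! r))"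

lemma f_range: "u < n \<Longrightarrow> 1 \<le> f u \<and> f u \<le> b"
  using col0 by (simp add: col_ok_def f_def)

lemma at_f: "u < n \<Longrightarrow> gat (blk u * H + f u) = u"
  using col0 by (simp add: col_ok_def f_def gat_def)

lemma at_props:
  assumes "1 \<le> i" "i \<le> k" "1 \<le> q" "q \<le> b"
  shows "gat (i * H + q) < n" "blk (gat (i * H + q)) = i" "f (gat (i * H + q)) = q"
  using col_at[OF col0 assms] by (simp_all add: gat_def f_def)

lemma c_range: "1 \<le> c" "c \<le> b"
  using f_range[OF v(1)] by (simp_all add: c_def)

lemma wit_props:
  assumes "1 \<le> i" "i \<le> k"
  shows "wit i < n" "blk (wit i) = i" "f (wit i) = c"
  unfolding wit_def by (rule at_props[OF assms c_range])+

lemma wit_v: "wit (blk v) = v"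
  unfolding wit_def c_def by (rule at_f[OF v(1)])

lemma a_props: "0 < a" "4 * D \<le> a" "a \<le> b - D" "a \<le> b"
proof -
  have b: "0 < b" using c_range by simp
  have d: "b div 5 * 5 \<le> b" by simp
  have D: "D \<le> b div 5" using large by simp
  show "0 < a" "4 * D \<le> a" "a \<le> b - D" "a \<le> b" using b d D by (simp_all add: a_def)
qed

text \<open>The at most \<open>D\<close> neighbours of \<open>wit i\<close> exclude at most
  \<open>D\<close> of the \<open>b\<close> colours.\<close>

lemma cand_props:
  assumes "1 \<le> i" "i \<le> k"
  shows "a \<le> length (cand i)" "distinct (cand i)" "q \<in> set (cand i) \<Longrightarrow> 1 \<le> q \<and> q \<le> b \<and> q \<notin> f ` set (nb (wit i))"
proof -
  show d: "distinct (cand i)" by (simp add: cand_def good_def)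
  have "length (cand i) = card (set (cand i))" by (rule distinct_card[OF d, symmetric])
  also have "set (cand i) = {1..b} - f ` set (nb (wit i))"
    by (auto simp: cand_def good_def H_def)
  also have "card \<dots> \<ge> card {1..b} - card (f ` set (nb (wit i)))"
    by (rule diff_card_le_card_Diff) simp
  moreover have "card (f ` set (nb (wit i))) \<le> D"
    by (meson card_image_le card_length finite_set le_trans length_nb)
  ultimately show "a \<le> length (cand i)" using a_props(3) by simp
  show "q \<in> set (cand i) \<Longrightarrow> 1 \<le> q \<and> q \<le> b \<and> q \<notin> f ` set (nb (wit i))"
    by (auto simp: cand_def good_def H_def)
qed

lemma cand_nth:
  assumes "1 \<le> i" "i \<le> k" "r < a"
  shows "1 \<le> cand i ! r" "cand i ! r \<le> b" "cand i ! r \<notin> f ` set (nb (wit i))"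
  using cand_props(1,3)[OF assms(1,2)] assms(3) by (auto simp: nth_mem)

lemma sel_props:
  assumes "1 \<le> i" "i \<le> k" "r < a"
  shows "sel i r < n" "blk (sel i r) = i" "i \<noteq> blk v \<Longrightarrow> f (sel i r) = cand i ! r"
  using at_props[OF assms(1,2) cand_nth(1,2)[OF assms]] v by (auto simp: sel_def)

sublocale walk: transversal_walk J blk nb sel a D "blk v"
proof
  show "blk v \<in> J" using blk_in[OF v(1)] by (simp add: J_def)
  show "inj_on (sel i) {..<a}" if "i \<in> J" "i \<noteq> blk v" for i
  proof (rule inj_onI)
    fix r r' assume r: "r \<in> {..<a}" "r' \<in> {..<a}" "sel i r = sel i r'"
    have i: "1 \<le> i" "i \<le> k" using that by (auto simp: J_def)
    have "cand i ! r = cand i ! r'" using r sel_props(3)[OF i] that(2) by (metis lessThan_iff)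
    moreover have "r < length (cand i)" "r' < length (cand i)" using r cand_props(1)[OF i] by auto
    ultimately show "r = r'" using cand_props(2)[OF i] nth_eq_iff_index_eq by blast
  qed
  show "blk y \<in> J" if "y \<in> set (nb (sel i r))" for i r y
    using nb_less[OF that] blk_in by (simp add: J_def)
  show "x \<in> set (nb y)" if "y \<in> set (nb x)" for x y by (rule nb_sym[OF that])
  show "x \<notin> set (nb x)" for x using nb_less by blast
qed (use a_props sel_props length_nb in \<open>auto simp: J_def\<close>)

definition roots :: "nat \<Rightarrow> nat list" where
  "roots j = blk v # filter (\<lambda>i. i \<noteq> blk v) [1..<j]"

definition searching :: "mem \<Rightarrow> bool" where
  "searching s \<longleftrightarrow> env s \<and> vars s ''v'' = v \<and> vars s ''c'' = c \<and> vars s ''o'' = blk v \<and>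
     arrs s ''color'' = f \<and> arrs s ''at'' = gat \<and>
     (\<forall>i r. 1 \<le> i \<longrightarrow> i \<le> k \<longrightarrow> i \<noteq> blk v \<longrightarrow> r < a \<longrightarrow> arrs s ''L'' (i * H + r) = sel i r) \<and>
     walk.valid (arrs s ''T'', stack s)"

lemma ht_build:
  assumes s1: "same {''c'', ''o'', ''p'', ''i''} {''stk''} s0 s1" "vars s1 ''c'' = c" "vars s1 ''o'' = blk v"
    "vars s1 ''p'' = 1" "vars s1 ''i'' = 1" "arrs s1 ''stk'' 0 = blk v"
  shows "ht W (For ''i'' ''g'' build_body) s1
    (\<lambda>s. searching s \<and> arrs s ''T'' = (\<lambda>_. 0) \<and> stack s = rev (roots (Suc k)))
    (k * (b * (D * 21 + 50) + 60) + 4)"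
proof -
  have e1: "env s1" by (rule env_same[OF s1(1) env0]) auto
  define X where "X = {''i'', ''w'', ''d'', ''l'', ''q'', ''z'', ''t'', ''p''}"
  define Y where "Y = {''L'', ''T'', ''stk''}"
  define I where "I j s \<longleftrightarrow> vars s ''i'' = j \<and> 1 \<le> j \<and> same X Y s1 s \<and>
     (\<forall>i r. 1 \<le> i \<longrightarrow> i < j \<longrightarrow> r < length (cand i) \<longrightarrow> arrs s ''L'' (i * H + r) = gat (i * H + cand i ! r)) \<and>
     (\<forall>i. 1 \<le> i \<and> i < j \<or> i \<notin> {1..k} \<longrightarrow> arrs s ''T'' i = 0) \<and>
     map (arrs s ''stk'') [0..<vars s ''p''] = roots j" for j s
  have "ht W (For ''i'' ''g'' build_body) s1 (I (Suc k)) ((Suc k - 1) * ((b * (D * 21 + 50) + 51) + 9) + 4)"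
  proof (rule ht_For)
    fix j s assume "I j s"
    then show "vars s ''i'' = j \<and> vars s ''g'' = Suc k" using env_vars(3)[OF e1] by (simp add: I_def same_def X_def)
  next
    fix j s assume I: "I j s" and j: "j < Suc k"
    have sm: "same X Y s1 s" and j1: "1 \<le> j" using I by (simp_all add: I_def)
    have jk: "j \<le> k" using j by simp
    have vs: "vars s ''i'' = j" "vars s ''c'' = c" "vars s ''o'' = blk v"
       "arrs s ''color'' = f" "arrs s ''at'' = gat"
      using I s1 by (simp_all add: I_def same_def X_def Y_def f_def gat_def)
    have e: "env s" by (rule env_same[OF sm e1]) (auto simp: X_def Y_def)
    have IL: "\<forall>i r. 1 \<le> i \<longrightarrow> i < j \<longrightarrow> r < length (cand i) \<longrightarrow> arrs s ''L'' (i * H + r) = gat (i * H + cand i ! r)"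
      and IT: "\<forall>i. 1 \<le> i \<and> i < j \<or> i \<notin> {1..k} \<longrightarrow> arrs s ''T'' i = 0"
      and IS: "map (arrs s ''stk'') [0..<vars s ''p''] = roots j"
      using I by (simp_all add: I_def)
    have rS: "roots (Suc j) = roots j @ (if j = blk v then [] else [j])" using j1 by (simp add: roots_def)
    have "vars s ''p'' = length (roots j)" using arg_cong[OF IS, of length] by simp
    also have "\<dots> \<le> Suc j" unfolding roots_def
      using length_filter_le[of "\<lambda>i. i \<noteq> blk v" "[1..<j]"] by simp
    finally have pk: "Suc (vars s ''p'') mod W = Suc (vars s ''p'')" using jk by (intro small_mod) simp
    have w: "wit j < n" "gat (j * H + c) = wit j" using wit_props[OF j1 jk] by (simp_all add: wit_def)
    have lc: "length (cand i) \<le> b" for i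
      unfolding cand_def using length_good[of f "wit i" H] by (simp add: H_def)
    show "ht W build_body s (\<lambda>s'. vars s' ''i'' = j \<and> I (Suc j) (set_var ''i'' (Suc j) s')) (b * (D * 21 + 50) + 51)"
      unfolding build_body_def
      apply (rule ht_mono)
       apply (rule ht_Assign_Seq)+
       apply (rule ht_Seq)
        apply (rule ht_cols[where i = j and u = "wit j"])
                apply (use e vs j1 jk w c_range in \<open>simp_all add: eval_ix env_vars W_1\<close>)[9]
    proof -
      let ?s = "set_var ''q'' (eval_exp W (set_var ''l'' (eval_exp W (set_var ''d'' (eval_exp W (set_var ''w'' (eval_exp W s (Arr ''at'' (ix ''i'' (Var ''c'')))) s) (Arr ''deg'' (Var ''w''))) (set_var ''w'' (eval_exp W s (Arr ''at'' (ix ''i'' (Var ''c'')))) s)) (Const 0))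
        (set_var ''d'' (eval_exp W (set_var ''w'' (eval_exp W s (Arr ''at'' (ix ''i'' (Var ''c'')))) s) (Arr ''deg'' (Var ''w''))) (set_var ''w'' (eval_exp W s (Arr ''at'' (ix ''i'' (Var ''c'')))) s))) (Const 1))
        (set_var ''l'' (eval_exp W (set_var ''d'' (eval_exp W (set_var ''w'' (eval_exp W s (Arr ''at'' (ix ''i'' (Var ''c'')))) s) (Arr ''deg'' (Var ''w''))) (set_var ''w'' (eval_exp W s (Arr ''at'' (ix ''i'' (Var ''c'')))) s)) (Const 0))
        (set_var ''d'' (eval_exp W (set_var ''w'' (eval_exp W s (Arr ''at'' (ix ''i'' (Var ''c'')))) s) (Arr ''deg'' (Var ''w''))) (set_var ''w'' (eval_exp W s (Arr ''at'' (ix ''i'' (Var ''c'')))) s)))"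
      fix s'
      assume s': "same {''q'', ''z'', ''t'', ''l''} {''L''} ?s s' \<and>
         (\<forall>r<length (good (arrs ?s ''color'') (wit j) H).
            arrs s' ''L'' (j * H + r) = arrs ?s ''at'' (j * H + good (arrs ?s ''color'') (wit j) H ! r)) \<and>
         (\<forall>i' r. i' \<noteq> j \<longrightarrow> r < H \<longrightarrow> arrs s' ''L'' (i' * H + r) = arrs ?s ''L'' (i' * H + r))"
      have ss: "same X Y s1 s'" using s' sm by (auto simp: same_def X_def Y_def)
      have v': "vars s' ''i'' = j" "vars s' ''o'' = blk v" "vars s' ''p'' = vars s ''p''"
        "arrs s' ''T'' = arrs s ''T''" "arrs s' ''stk'' = arrs s ''stk''"
        using s' vs by (auto simp: same_def)
      have L': "arrs s' ''L'' (i * H + r) = gat (i * H + cand i ! r)" if "1 \<le> i" "i < Suc j" "r < length (cand i)" for i r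
      proof (cases "i = j")
        case True
        then show ?thesis using s' that vs by (simp add: cand_def)
      next
        case False
        then show ?thesis using s' that IL lc[of i] by (simp add: H_def)
      qed
      have xy: "''p'' \<in> X" "''i'' \<in> X" "''T'' \<in> Y" "''stk'' \<in> Y" by (simp_all add: X_def Y_def)
      show "ht W (Seq (Store ''T'' (Var ''i'') (Const 0))
         (If (Op Eq (Var ''i'') (Var ''o'')) Skip
            (Seq (Store ''stk'' (Var ''p'') (Var ''i'')) (Assign ''p'' (Op Plus (Var ''p'') (Const 1))))))
         s' (\<lambda>s'. vars s' ''i'' = j \<and> I (Suc j) (set_var ''i'' (Suc j) s')) 20"
        apply (rule ht_mono)
         apply (rule ht_Store_Seq)
         apply (rule ht_If)
          apply (rule ht_Skip)
          apply (use v' ss xy L' IT IS j1 in \<open>simp add: I_def same_upd rS less_Suc_eq W_1 split: if_splits\<close>)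
         apply (rule ht_Store_Seq)
         apply (rule ht_Assign)
         apply (use v' ss xy L' IT IS j1 in \<open>simp add: I_def same_upd rS less_Suc_eq W_1 pk split: if_splits\<close>)
        apply simp
        done
    qed simp
  next
    show "I 1 s1" using s1 T0 by (auto simp: I_def same_refl roots_def same_def)
  qed (use W_1 W_gr[of "Suc k"] in auto)
  then show ?thesis
  proof (elim ht_post[THEN ht_mono])
    fix s assume I: "I (Suc k) s"
    have sm: "same X Y s1 s" using I by (simp add: I_def)
    have "env s" by (rule env_same[OF sm e1]) (auto simp: X_def Y_def)
    moreover have T: "arrs s ''T'' = (\<lambda>_. 0)" using I by (auto simp: I_def fun_eq_iff less_Suc_eq_le)
    moreover have st: "stack s = rev (roots (Suc k))" using I by (simp add: I_def stack_def)
    moreover have "walk.valid ((\<lambda>_. 0), rev (roots (Suc k)))"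
    proof (rule walk.valid_start)
      show "set (rev (roots (Suc k))) = J" using blk_in[OF v(1)] by (auto simp: roots_def J_def)
      show "last (rev (roots (Suc k))) = blk v" by (simp add: roots_def)
    qed (simp add: roots_def)
    moreover have "arrs s ''L'' (i * H + r) = sel i r" if "1 \<le> i" "i \<le> k" "i \<noteq> blk v" "r < a" for i r
      using I that cand_props(1)[OF that(1,2)] by (simp add: I_def sel_def)
    ultimately show "searching s \<and> arrs s ''T'' = (\<lambda>_. 0) \<and> stack s = rev (roots (Suc k))"
      using s1 sm v by (simp add: searching_def same_def X_def Y_def f_def gat_def)
  qed simp
qed

end

section \<open>The search loop as the random walk\<close>

lemma average_affine:
  fixes x y :: real
  assumes "0 < a"
  shows "(\<Sum>r<a. x + y * g r) / real a = x + y * ((\<Sum>r<a. g r) / real a)"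
  using assms by (simp add: sum.distrib sum_distrib_left[symmetric] add_divide_distrib)

context strong_instance
begin

definition cost :: nat where "cost = D * 30 + 70"

text \<open>Of the constant units, 50 are for \<open>fill_body\<close>, 3 for the next guard and the
  truncation in \<open>time_le_While\<close>, and 7 for reading the stack and drawing.\<close>

lemma cost_step: "real (D * 30 + 53) + real cost * y + 7 \<le> real cost * (1 + y)"
  by (simp add: cost_def algebra_simps)

end

context phase
begin

declare walk.valid.simps [simp del]

lemma card_J: "card J = k"
  by (simp add: J_def)

lemma searching_set [simp]:
  "x \<in> {''i'', ''r'', ''x'', ''j'', ''d'', ''t'', ''y''} \<Longrightarrow> searching (set_var x e s) = searching s"
  by (elim insertE emptyE; simp add: searching_def stack_def)

lemma stack_set [simp]: "x \<noteq> ''p'' \<Longrightarrow> stack (set_var x e s) = stack s"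
  by (simp add: stack_def)

lemma searching_same:
  assumes S: "searching s" and sm: "same X {''T'', ''stk''} s s'"
    and X: "X \<inter> {''n'', ''h'', ''g'', ''a'', ''v'', ''c'', ''o''} = {}"
    and valid: "walk.valid (arrs s' ''T'', stack s')"
  shows "searching s'"
proof -
  have "env s'" using sm S X by (intro env_same[OF sm]) (auto simp only: searching_def)
  moreover have "vars s' ''v'' = vars s ''v''" "vars s' ''c'' = vars s ''c''" "vars s' ''o'' = vars s ''o''"
    using X by (auto intro!: same_vars[OF sm])
  moreover have "arrs s' ''color'' = arrs s ''color''" "arrs s' ''at'' = arrs s ''at''" "arrs s' ''L'' = arrs s ''L''"
    by (auto intro!: same_arrs[OF sm])
  ultimately show ?thesis using S valid unfolding searching_def by presburger
qed

lemma stack_Cons: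
  assumes "stack s = i # st"
  shows "vars s ''p'' = Suc (length st)" "arrs s ''stk'' (length st) = i"
    "rev (map (arrs s ''stk'') [0..<length st]) = st"
proof -
  have "length (stack s) = vars s ''p''" by (simp add: stack_def)
  then show p: "vars s ''p'' = Suc (length st)" using assms by simp
  show "arrs s ''stk'' (length st) = i" "rev (map (arrs s ''stk'') [0..<length st]) = st"
    using assms by (simp_all add: stack_def p)
qed

text \<open>Apart from the draw an iteration is deterministic. For a given index it performs one
  step of the walk, with \<open>T\<close> and the stack in memory as the configuration.\<close>

lemma ht_fill:
  assumes S: "searching s" and st: "stack s = i # st" and vi: "vars s ''i'' = i" and r: "vars s ''r'' = r" "r < a"
  shows "ht W fill_body s
    (\<lambda>s'. searching s' \<and> (arrs s' ''T'', stack s') = walk.step (arrs s ''T'', stack s) r) (D * 30 + 50)"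
proof -
  let ?x = "sel i r"
  have valid: "walk.valid (arrs s ''T'', i # st)" using S st by (simp add: searching_def)
  then have dist: "distinct (i # st)" "set (i # st) \<subseteq> J" unfolding walk.valid.simps by blast+
  then have i: "1 \<le> i" "i \<le> k" by (auto simp: J_def)
  have e: "env s" and vs: "vars s ''v'' = v" "vars s ''o'' = blk v" using S by (simp_all add: searching_def)
  have x: "?x < n" using sel_props(1)[OF i r(2)] .
  have L: "i \<noteq> blk v \<Longrightarrow> arrs s ''L'' (i * H + r) = ?x" using S i r(2) by (simp add: searching_def)
  have rb: "r \<le> b" using r(2) a_props(4) by simp
  have xm: "Suc ?x mod W = Suc ?x" using x by (intro small_mod) simp
  note p = stack_Cons[OF st]
  \<comment> \<open>Blocks on the stack are distinct, so the stack pointer stays too small to wrap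
    around.\<close>
  have "length (i # st) \<le> k"
    using card_mono[OF walk.finite_J dist(2)] distinct_card[OF dist(1)] card_J by simp
  then have pm: "Suc (Suc (length st)) mod W = Suc (Suc (length st))" by (intro small_mod) simp
  have choose: "ht W (If (Op Eq (Var ''i'') (Var ''o'')) (Assign ''x'' (Var ''v'')) (Assign ''x'' (Arr ''L'' (ix ''i'' (Var ''r'')))))
      s (\<lambda>s'. s' = set_var ''x'' ?x s) 12"
    apply (rule ht_mono)
     apply (rule ht_If)
      apply (rule ht_Assign)
      apply (use vi vs in \<open>simp add: sel_def split: if_splits\<close>)
     apply (rule ht_Assign)
     apply (use vi vs e i r rb L in \<open>simp add: eval_ix env_vars split: if_splits\<close>)
    apply simp
    done
  let ?s = "set_var ''t'' 0 (set_var ''d'' (length (nb ?x)) (set_var ''j'' 0 (set_var ''x'' ?x s)))"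
  have conf: "ht W (For ''t'' ''d'' conf_body) ?s (\<lambda>s'. same {''t'', ''y'', ''j''} {} ?s s' \<and>
     vars s' ''j'' = walk.conflict (arrs s ''T'') ?x) (D * 30 + 4)"
    using ht_conf[of ?s ?x] e x by (simp add: walk.conflict_def)
  have final: "ht W (If (Var ''j'')
        (Seq (Store ''T'' (Var ''j'') (Const 0))
        (Seq (Store ''stk'' (Var ''p'') (Var ''j''))
             (Assign ''p'' (Op Plus (Var ''p'') (Const 1)))))
        (Seq (Store ''T'' (Var ''i'') (Op Plus (Var ''x'') (Const 1)))
             (Assign ''p'' (Op Minus (Var ''p'') (Const 1))))) s'
     (\<lambda>s'. searching s' \<and> (arrs s' ''T'', stack s') = walk.step (arrs s ''T'', stack s) r) 20"
    if s': "same {''t'', ''y'', ''j''} {} ?s s' \<and> vars s' ''j'' = walk.conflict (arrs s ''T'') ?x" for s'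
  proof -
    have v': "vars s' ''i'' = i" "vars s' ''x'' = ?x" "vars s' ''p'' = Suc (length st)" "arrs s' = arrs s"
      "vars s' ''j'' = walk.conflict (arrs s ''T'') ?x" "vars s' ''v'' = v" "vars s' ''c'' = vars s ''c''" "vars s' ''o'' = blk v"
      using s' vi vs p by (auto simp: same_def)
    have sm: "same {''t'', ''y'', ''j''} {} ?s s'" using s' by blast
    have e': "env s'" by (rule env_same[OF sm]) (simp_all add: e)
    have valid': "walk.valid (walk.step (arrs s ''T'', i # st) r)"
      using walk.valid_step[OF valid r(2)] .
    have stk: "rev (map (arrs s ''stk'') [0..<Suc (length st)]) = i # st" using p by simp
    show ?thesis
    proof (rule ht_mono[OF ht_If])
      assume "eval_exp W s' (Var ''j'') \<noteq> 0"
      then have j: "walk.conflict (arrs s ''T'') ?x \<noteq> 0" using v' by simp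
      have step: "walk.step (arrs s ''T'', stack s) r =
         ((arrs s ''T'')(walk.conflict (arrs s ''T'') ?x := 0), walk.conflict (arrs s ''T'') ?x # i # st)"
        using j st by (simp add: Let_def)
      let ?f = "set_var ''p'' (Suc (Suc (length st))) (set_arr ''stk'' (Suc (length st)) (walk.conflict (arrs s ''T'') ?x)
        (set_arr ''T'' (walk.conflict (arrs s ''T'') ?x) 0 s'))"
      have eq: "(arrs ?f ''T'', stack ?f) = walk.step (arrs s ''T'', stack s) r"
        unfolding step using stk by (simp add: stack_def v')
      have "same {''x'', ''j'', ''d'', ''t'', ''y'', ''p''} {''T'', ''stk''} s ?f"
        using s' by (auto simp: same_def)
      then have S': "searching ?f"
        by (rule searching_same[OF S]) (use valid' st in \<open>simp_all only: eq, simp\<close>)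
      show "ht W (Seq (Store ''T'' (Var ''j'') (Const 0))
        (Seq (Store ''stk'' (Var ''p'') (Var ''j''))
             (Assign ''p'' (Op Plus (Var ''p'') (Const 1)))))
        s' (\<lambda>s'. searching s' \<and> (arrs s' ''T'', stack s') = walk.step (arrs s ''T'', stack s) r) (3 + (3 + 4))"
        apply (rule ht_mono)
         apply (rule ht_Store_Seq)+
         apply (rule ht_Assign)
         apply (use S' eq in \<open>simp add: v' W_1 pm del: walk.step.simps\<close>)
        apply simp
        done
    next
      assume "eval_exp W s' (Var ''j'') = 0"
      then have j: "walk.conflict (arrs s ''T'') ?x = 0" using v' by simp
      have step: "walk.step (arrs s ''T'', stack s) r = ((arrs s ''T'')(i := Suc ?x), st)"
        using j st by simp
      let ?f = "set_var ''p'' (length st) (set_arr ''T'' i (Suc ?x) s')"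
      have eq: "(arrs ?f ''T'', stack ?f) = walk.step (arrs s ''T'', stack s) r"
        unfolding step using p(3) by (simp add: stack_def v')
      have "same {''x'', ''j'', ''d'', ''t'', ''y'', ''p''} {''T'', ''stk''} s ?f"
        using s' by (auto simp: same_def)
      then have S': "searching ?f"
        by (rule searching_same[OF S]) (use valid' st in \<open>simp_all only: eq, simp\<close>)
      show "ht W (Seq (Store ''T'' (Var ''i'') (Op Plus (Var ''x'') (Const 1)))
             (Assign ''p'' (Op Minus (Var ''p'') (Const 1))))
        s' (\<lambda>s'. searching s' \<and> (arrs s' ''T'', stack s') = walk.step (arrs s ''T'', stack s) r) (5 + 4)"
        apply (rule ht_mono)
         apply (rule ht_Store_Seq)
         apply (rule ht_Assign)
         apply (use S' eq in \<open>simp add: v' W_1 xm del: walk.step.simps\<close>)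
        apply simp
        done
    qed simp
  qed
  show ?thesis
    unfolding fill_body_def
    apply (rule ht_mono)
     apply (rule ht_Seq[OF choose])
     apply (simp only:)
     apply (rule ht_Assign_Seq)+
     apply (rule ht_Seq)
      apply (use e x in \<open>simp add: env_vars\<close>)
      apply (rule conf)
     apply (rule final)
     apply simp
    apply simp
    done
qed

text \<open>The potential at truncation level \<open>N\<close> is \<open>cost\<close> times
  \<open>walk.steps N\<close>: the recursion of \<open>steps\<close> is one iteration averaged over
  the draw. As \<open>steps_bound\<close> is uniform in \<open>N\<close>, it bounds the supremum,
  and almost sure termination comes with it.\<close>

lemma ht_search:
  assumes S: "searching s1" "arrs s1 ''T'' = (\<lambda>_. 0)" "stack s1 = rs" "distinct rs" "set rs = J" "last rs = blk v"
  shows "ht W (While (Var ''p'') search_body) s1 (\<lambda>s. searching s \<and> stack s = [])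
    (cost * (18 * k * (max 1 D)\<^sup>2) + 2)"
proof -
  define R :: "nat \<Rightarrow> mem \<Rightarrow> ennreal" where
    "R N s = (if searching s then ennreal (real cost * walk.steps N (arrs s ''T'', stack s)) else \<infinity>)" for N s
  define Q :: "mem \<Rightarrow> ennreal" where "Q s = (if searching s \<and> stack s = [] then 0 else \<infinity>)" for s
  have p0: "vars s ''p'' = 0 \<longleftrightarrow> stack s = []" for s by (auto simp: stack_def)
  have "time_le W (While (Var ''p'') search_body) s1 Q ((SUP N. R N s1) + of_nat (1 + exp_cost (Var ''p'')))"
  proof (rule time_le_While)
    fix N s
    assume g: "eval_exp W s (Var ''p'') \<noteq> 0" and R: "R (Suc N) s < \<infinity>"
    have S: "searching s" using R by (simp add: R_def split: if_splits)
    obtain i st where st: "stack s = i # st" using g p0[of s] by (cases "stack s") auto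
    note p = stack_Cons[OF st]
    let ?si = "set_var ''i'' i s"
    let ?g = "\<lambda>r. walk.steps N (walk.step (arrs s ''T'', stack s) r)"
    define Q2 :: "mem \<Rightarrow> ennreal" where
      "Q2 s' = (if \<exists>r<a. s' = set_var ''r'' r ?si then of_nat (D * 30 + 53) + ennreal (real cost * ?g (vars s' ''r'')) else \<infinity>)" for s'
    have fill: "time_le W fill_body s' (\<lambda>s'. R N s' + of_nat (2 + exp_cost (Var ''p''))) (Q2 s')" if Q: "Q2 s' < \<infinity>" for s'
    proof -
      have "\<exists>r<a. s' = set_var ''r'' r ?si"
      proof (rule ccontr)
        assume "\<not> (\<exists>r<a. s' = set_var ''r'' r ?si)"
        then have "Q2 s' = \<infinity>" unfolding Q2_def by (simp only: if_False)
        then show False using Q by simp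
      qed
      then obtain r where r: "r < a" "s' = set_var ''r'' r ?si" by blast
      have "time_le W fill_body s' (\<lambda>s'. R N s' + of_nat (2 + exp_cost (Var ''p'')))
          (of_nat (D * 30 + 50) + (ennreal (real cost * ?g r) + of_nat (2 + exp_cost (Var ''p''))))"
      proof (rule ht_bounded)
        show "ht W fill_body s' (\<lambda>s''. searching s'' \<and> (arrs s'' ''T'', stack s'') = walk.step (arrs s' ''T'', stack s') r) (D * 30 + 50)"
          by (rule ht_fill[of _ i st]) (use S st r in auto)
        fix s'' assume "searching s'' \<and> (arrs s'' ''T'', stack s'') = walk.step (arrs s' ''T'', stack s') r"
        then have "R N s'' = ennreal (real cost * ?g r)" using r by (simp add: R_def del: walk.step.simps)
        then show "R N s'' + of_nat (2 + exp_cost (Var ''p'')) \<le> ennreal (real cost * ?g r) + of_nat (2 + exp_cost (Var ''p''))"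
          by simp
      qed
      moreover have "Q2 s' = of_nat (D * 30 + 50) + (ennreal (real cost * ?g r) + of_nat (2 + exp_cost (Var ''p'')))"
        using r by (auto simp: Q2_def algebra_simps simp del: walk.step.simps)
      ultimately show ?thesis by simp
    qed
    have draw: "time_le W (Seq (Draw ''r'' (Var ''a'')) fill_body) ?si (\<lambda>s'. R N s' + of_nat (2 + exp_cost (Var ''p'')))
        ((\<Sum>r<a. Q2 (set_var ''r'' r ?si)) / of_nat a + of_nat (1 + exp_cost (Var ''a'')))"
      by (rule time_le_Seq[OF time_le_Draw[OF a_props(1)] fill])
        (use S in \<open>simp_all add: searching_def env_vars\<close>)
    define y where "y = (\<Sum>r<a. ?g r) / real a"
    have g0: "0 \<le> ?g r" for r by (rule walk.steps_nonneg)
    have y0: "0 \<le> y" unfolding y_def by (intro divide_nonneg_nonneg sum_nonneg g0) simp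
    have Q2: "Q2 (set_var ''r'' r ?si) = ennreal (real (D * 30 + 53) + real cost * ?g r)" if "r \<in> {..<a}" for r
    proof -
      have "Q2 (set_var ''r'' r ?si) = of_nat (D * 30 + 53) + ennreal (real cost * ?g r)"
        using that by (auto simp: Q2_def simp del: walk.step.simps)
      then show ?thesis
        unfolding ennreal_of_nat_eq_real_of_nat using g0[of r] by (simp only: ennreal_plus mult_nonneg_nonneg of_nat_0_le_iff)
    qed
    have sum: "(\<Sum>r<a. Q2 (set_var ''r'' r ?si)) = ennreal (\<Sum>r<a. real (D * 30 + 53) + real cost * ?g r)"
    proof (rule trans)
      show "(\<Sum>r<a. Q2 (set_var ''r'' r ?si)) = (\<Sum>r<a. ennreal (real (D * 30 + 53) + real cost * ?g r))"
        by (rule sum.cong[OF refl Q2])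
    qed (rule sum_ennreal, intro add_nonneg_nonneg mult_nonneg_nonneg g0 of_nat_0_le_iff)
    have avg: "(\<Sum>r<a. Q2 (set_var ''r'' r ?si)) / of_nat a = ennreal (real (D * 30 + 53) + real cost * y)"
      unfolding sum ennreal_of_nat_eq_real_of_nat y_def average_affine[OF a_props(1), symmetric]
      by (rule divide_ennreal) (use a_props(1) in \<open>auto intro!: sum_nonneg add_nonneg_nonneg mult_nonneg_nonneg g0\<close>)
    have "time_le W search_body s (\<lambda>s'. R N s' + of_nat (2 + exp_cost (Var ''p'')))
        (((\<Sum>r<a. Q2 (set_var ''r'' r ?si)) / of_nat a + of_nat (1 + exp_cost (Var ''a''))) + of_nat 5)"
      unfolding search_body_def
    proof (rule time_le_Seq)
      define Q1 :: "mem \<Rightarrow> ennreal" where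
        "Q1 s' = (if s' = ?si then (\<Sum>r<a. Q2 (set_var ''r'' r ?si)) / of_nat a + of_nat (1 + exp_cost (Var ''a'')) else \<infinity>)" for s'
      have "eval_exp W s (Arr ''stk'' (Op Minus (Var ''p'') (Const 1))) = i" using p W_1 by simp
      then show "time_le W (Assign ''i'' (Arr ''stk'' (Op Minus (Var ''p'') (Const 1)))) s Q1
          ((\<Sum>r<a. Q2 (set_var ''r'' r ?si)) / of_nat a + of_nat (1 + exp_cost (Var ''a'')) + of_nat 5)"
        using time_le_Assign[of W "''i''" "Arr ''stk'' (Op Minus (Var ''p'') (Const 1))" s Q1] by (simp add: Q1_def)
      fix s' assume "Q1 s' < \<infinity>"
      then have "s' = ?si" unfolding Q1_def by (rule contrapos_pp) simp
      then show "time_le W (Seq (Draw ''r'' (Var ''a'')) fill_body) s' (\<lambda>s'. R N s' + of_nat (2 + exp_cost (Var ''p''))) (Q1 s')"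
        using draw by (simp add: Q1_def)
    qed
    moreover have "(\<Sum>r<a. Q2 (set_var ''r'' r ?si)) / of_nat a + of_nat (1 + exp_cost (Var ''a'')) + of_nat 5 \<le> R (Suc N) s"
    proof -
      have "(\<Sum>r<a. Q2 (set_var ''r'' r ?si)) / of_nat a + of_nat (1 + exp_cost (Var ''a'')) + of_nat 5 =
         ennreal (real (D * 30 + 53) + real cost * y) + ennreal 7"
        unfolding avg by (simp add: add.assoc)
      also have "\<dots> = ennreal (real (D * 30 + 53) + real cost * y + 7)"
        using y0 by (intro ennreal_plus[symmetric]) auto
      also have "\<dots> \<le> ennreal (real cost * (1 + y))" by (intro ennreal_leI cost_step)
      also have "\<dots> = R (Suc N) s" using S st by (simp add: R_def y_def del: walk.step.simps)
      finally show ?thesis .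
    qed
    ultimately show "time_le W search_body s (\<lambda>s'. R N s' + of_nat (2 + exp_cost (Var ''p''))) (R (Suc N) s)"
      by (rule time_le_mono[OF _ order_refl])
  next
    fix N s
    assume "eval_exp W s (Var ''p'') = 0"
    then show "Q s \<le> R N s" using p0[of s] by (auto simp: Q_def R_def)
  qed
  moreover have "(SUP N. R N s1) \<le> of_nat (cost * (18 * k * (max 1 D)\<^sup>2))"
  proof (rule SUP_least)
    fix N
    have "walk.steps N (\<lambda>_. 0, rs) \<le> 18 * real k * walk.D1\<^sup>2"
      using walk.steps_bound[OF S(4-6), of N] card_J by simp
    moreover have "walk.D1 = real (max 1 D)" by (simp add: walk.D1_def)
    ultimately have "real cost * walk.steps N (\<lambda>_. 0, rs) \<le> real cost * (18 * real k * (real (max 1 D))\<^sup>2)"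
      by (intro mult_left_mono) auto
    also have "\<dots> = real (cost * (18 * k * (max 1 D)\<^sup>2))" by simp
    finally show "R N s1 \<le> of_nat (cost * (18 * k * (max 1 D)\<^sup>2))"
      unfolding ennreal_of_nat_eq_real_of_nat using S(1-3) by (simp add: R_def ennreal_leI)
  qed
  then have "(SUP N. R N s1) + of_nat (1 + exp_cost (Var ''p'')) \<le> of_nat (cost * (18 * k * (max 1 D)\<^sup>2) + 2)"
    unfolding of_nat_add[of "cost * (18 * k * (max 1 D)\<^sup>2)"] exp_cost.simps one_add_one
    by (rule add_right_mono)
  ultimately show ?thesis
    unfolding ht_def Q_def[symmetric] by (rule time_le_mono[OF _ order_refl])
qed

end

section \<open>Exchanging the colours\<close>

context strong_instance
begin

definition proper :: "nat \<Rightarrow> (nat \<Rightarrow> nat) \<Rightarrow> bool" where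
  "proper v f \<longleftrightarrow> (\<forall>x<v. \<forall>y<v. y \<in> set (nb x) \<longrightarrow> f x \<noteq> f y)"

definition phase_cost :: nat where
  "phase_cost = k * (b * (D * 21 + 50) + 60) + cost * (18 * k * (max 1 D)\<^sup>2) + k * 60 + 40"

end

context phase
begin

text \<open>Where \<open>X\<close> and \<open>wit\<close> agree on a block, the first case applies
  and the vertex keeps the colour \<open>c\<close>.\<close>

definition swapped :: "(nat \<Rightarrow> nat) \<Rightarrow> nat \<Rightarrow> nat \<Rightarrow> nat" where
  "swapped X i u = (if blk u < i
     then (if u = X (blk u) then c else if u = wit (blk u) then f (X (blk u)) else f u) else f u)"

lemma ht_swap:
  assumes S: "searching s2" and i: "vars s2 ''i'' = 1"
    and X: "\<And>i. 1 \<le> i \<Longrightarrow> i \<le> k \<Longrightarrow> arrs s2 ''T'' i = Suc (X i) \<and> X i < n \<and> blk (X i) = i"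
  shows "ht W (For ''i'' ''g'' swap_body) s2 (\<lambda>s. same {''i'', ''x'', ''w'', ''q''} {''color'', ''at''} s2 s \<and>
     col_ok n s \<and> (\<forall>u<n. arrs s ''color'' u = swapped X (Suc k) u)) (k * 60 + 4)"
proof -
  have e2: "env s2" and s2: "vars s2 ''c'' = c" "arrs s2 ''color'' = f" "arrs s2 ''at'' = gat"
    using S by (simp_all add: searching_def)
  define I where "I j s \<longleftrightarrow> vars s ''i'' = j \<and> 1 \<le> j \<and> same {''i'', ''x'', ''w'', ''q''} {''color'', ''at''} s2 s \<and>
     col_ok n s \<and> (\<forall>u<n. arrs s ''color'' u = swapped X j u)" for j s
  have "ht W (For ''i'' ''g'' swap_body) s2 (I (Suc k)) ((Suc k - 1) * (51 + 9) + 4)"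
  proof (rule ht_For)
    fix j s assume "I j s"
    then show "vars s ''i'' = j \<and> vars s ''g'' = Suc k" using env_vars(3)[OF e2] by (simp add: I_def same_def)
  next
    fix j s assume I: "I j s" and j: "j < Suc k"
    have sm: "same {''i'', ''x'', ''w'', ''q''} {''color'', ''at''} s2 s" and col: "col_ok n s" and j1: "1 \<le> j"
      and fs: "\<And>u. u < n \<Longrightarrow> arrs s ''color'' u = swapped X j u"
      using I by (simp_all add: I_def)
    have jk: "j \<le> k" using j by simp
    have vs: "vars s ''i'' = j" "vars s ''c'' = c" "arrs s ''T'' j = Suc (X j)"
      using I s2 X[OF j1 jk] by (simp_all add: I_def same_def)
    have vh: "vars s ''h'' = H" using sm env_vars(2)[OF e2] by (simp add: same_def)
    have x: "X j < n" "blk (X j) = j" using X[OF j1 jk] by simp_all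
    define w where "w = arrs s ''at'' (j * H + c)"
    have w: "w < n" "blk w = j" "arrs s ''color'' w = c"
      using col_at[OF col j1 jk c_range] by (simp_all add: w_def)
    \<comment> \<open>Block \<open>j\<close> has not been treated yet, so its vertex of colour
      \<open>c\<close> is still the one from the start of the phase.\<close>
    have "f w = c" using fs[OF w(1)] w by (simp add: swapped_def)
    then have ww: "w = wit j"
      using at_f[OF w(1)] w(2) by (simp add: wit_def)
    have fx: "arrs s ''color'' (X j) = f (X j)" using fs[OF x(1)] x by (simp add: swapped_def)
    have fr: "1 \<le> f (X j)" "f (X j) \<le> b" using f_range[OF x(1)] by auto
    \<comment> \<open>If \<open>X j = w\<close>, the second update writes \<open>f w = c\<close>
      again, so no case distinction is made in the program.\<close>
    let ?f = "(arrs s ''color'')(X j := c, w := f (X j))"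
    let ?g = "(arrs s ''at'')(j * H + c := X j, j * H + f (X j) := w)"
    let ?s = "set_var ''i'' (Suc j) (set_arr ''at'' (j * H + f (X j)) w (set_arr ''at'' (j * H + c) (X j)
        (set_arr ''color'' w (f (X j)) (set_arr ''color'' (X j) c
          (set_var ''q'' (f (X j)) (set_var ''w'' w (set_var ''x'' (X j) s)))))))"
    have s_col: "arrs ?s ''color'' = ?f" "arrs ?s ''at'' = ?g" by simp_all
    have old: "1 \<le> arrs s ''color'' u" "arrs s ''color'' u \<le> b" "arrs s ''at'' (blk u * H + arrs s ''color'' u) = u" if "u < n" for u
      using col that by (simp_all add: col_ok_def)
    have "col_ok n ?s"
      unfolding col_ok_def s_col
    proof (intro allI impI conjI)
      fix u assume u: "u < n"
      show "1 \<le> ?f u" "?f u \<le> b" using old[OF u] c_range fr by auto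
      show "?g (blk u * H + ?f u) = u"
      proof (cases "u = w")
        case True
        then show ?thesis using w by simp
      next
        case nw: False
        show ?thesis
        proof (cases "u = X j")
          case True
          have "f (X j) \<noteq> c"
          proof
            assume "f (X j) = c"
            then have "X j = w" using at_f[OF x(1)] x(2) ww by (simp add: wit_def)
            then show False using nw True by simp
          qed
          then show ?thesis using True nw x by simp
        next
          case False
          have "blk u * H + arrs s ''color'' u \<noteq> j * H + c"
          proof
            assume "blk u * H + arrs s ''color'' u = j * H + c"
            then have "u = w" using old(3)[OF u] by (simp add: w_def)
            then show False using nw by simp
          qed
          moreover have "blk u * H + arrs s ''color'' u \<noteq> j * H + f (X j)"
          proof
            assume "blk u * H + arrs s ''color'' u = j * H + f (X j)"
            then have "u = X j" using old(3)[OF u] old(3)[OF x(1)] x(2) fx by simp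
            then show False using False by simp
          qed
          ultimately show ?thesis using nw False old(3)[OF u] by simp
        qed
      qed
    qed
    moreover have "arrs ?s ''color'' u = swapped X (Suc j) u" if u: "u < n" for u
    proof (cases "blk u = j")
      case True
      have "f (wit j) = c" "blk (wit j) = j" using wit_props[OF j1 jk] by simp_all
      then show ?thesis using True fs[OF u] unfolding s_col by (auto simp: swapped_def ww)
    next
      case False
      then have "u \<noteq> X j" "u \<noteq> w" using x w by auto
      then show ?thesis using False fs[OF u] unfolding s_col by (simp add: swapped_def less_Suc_eq)
    qed
    moreover have "same {''i'', ''x'', ''w'', ''q''} {''color'', ''at''} s2 ?s"
      by (intro same_upd sm) simp_all
    ultimately have I': "I (Suc j) ?s" unfolding I_def by simp
    show "ht W swap_body s (\<lambda>s'. vars s' ''i'' = j \<and> I (Suc j) (set_var ''i'' (Suc j) s')) 51"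
      unfolding swap_body_def
      apply (rule ht_mono)
       apply (rule ht_Assign_Seq ht_Store_Seq)+
       apply (rule ht_Store)
       apply (simp add: vs vh W_1 eval_ix jk c_range fx fr w_def[symmetric] I')
      apply simp
      done
  next
    have "swapped X 1 u = f u" if "u < n" for u using blk_in[OF that] by (simp add: swapped_def)
    then show "I 1 s2" using s2 i col0 by (simp add: I_def same_refl col_ok_def f_def gat_def)
  qed (use W_1 W_gr[of "Suc k"] in auto)
  then show ?thesis by (elim ht_post[THEN ht_mono]) (auto simp: I_def)
qed

text \<open>Colour \<open>c\<close> is now carried exactly by the vertices \<open>X i\<close>, which
  are independent, so a monochromatic edge would avoid them. Neither end would then be
  \<open>v\<close>, and some end would be a \<open>wit i\<close>, as the remaining vertices keep
  their colours. Two such ends were processed with the same colour \<open>c\<close> before and are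
  not adjacent. A single one has received a colour absent from its neighbours, and the other end has
  kept its colour.\<close>

lemma proper_swapped:
  assumes P: "proper v f" and fresh: "\<And>u. u < n \<Longrightarrow> f' u = swapped X (Suc k) u"
    and X: "\<And>i. 1 \<le> i \<Longrightarrow> i \<le> k \<Longrightarrow> X i < n \<and> blk (X i) = i" and Xv: "X (blk v) = v"
    and list: "\<And>i. 1 \<le> i \<Longrightarrow> i \<le> k \<Longrightarrow> i \<noteq> blk v \<Longrightarrow> f (X i) \<notin> f ` set (nb (wit i))"
    and indep: "\<And>i j. 1 \<le> i \<Longrightarrow> i \<le> k \<Longrightarrow> 1 \<le> j \<Longrightarrow> j \<le> k \<Longrightarrow> X j \<notin> set (nb (X i))"
  shows "proper (Suc v) f'"
  unfolding proper_def
proof (intro allI impI notI)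
  fix x y
  assume xy: "x < Suc v" "y < Suc v" "y \<in> set (nb x)" and eq: "f' x = f' y"
  have n: "x < n" "y < n" using nb_less[OF xy(3)] by auto
  have eq': "swapped X (Suc k) x = swapped X (Suc k) y" using eq fresh n by simp
  have yx: "x \<in> set (nb y)" by (rule nb_sym[OF xy(3)])
  have sw: "swapped X (Suc k) u = (if u = X (blk u) then c else if u = wit (blk u) then f (X (blk u)) else f u)"
    "1 \<le> blk u" "blk u \<le> k" if "u < n" for u
    using blk_in[OF that] by (auto simp: swapped_def)
  have ne: "swapped X (Suc k) u \<noteq> c" if u: "u < n" "u \<noteq> X (blk u)" for u
  proof -
    have "f u = c \<Longrightarrow> u = wit (blk u)"
      using at_f[OF u(1)] by (simp add: wit_def)
    moreover have "f (X (blk u)) = c \<Longrightarrow> X (blk u) = wit (blk u)"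
      using at_f[of "X (blk u)"] X[OF sw(2,3)[OF u(1)]] by (simp add: wit_def)
    ultimately show ?thesis using sw(1)[OF u(1)] u(2) by auto
  qed
  show False
  proof (cases "x = X (blk x) \<or> y = X (blk y)")
    case True
    then have "swapped X (Suc k) x = c" "swapped X (Suc k) y = c"
      using sw(1) n eq' by auto
    then have "x = X (blk x)" "y = X (blk y)" using ne n by blast+
    then show False using indep[of "blk x" "blk y"] sw(2,3) n xy(3) by metis
  next
    case False
    then have nv: "x \<noteq> v" "y \<noteq> v" using Xv by auto
    then have lt: "x < v" "y < v" using xy by auto
    have fxy: "f x \<noteq> f y" using P lt xy(3) by (simp add: proper_def)
    \<comment> \<open>In the block of \<open>v\<close> the two exchanged vertices are both
      \<open>v\<close>. A recoloured \<open>wit\<close> therefore lies in another block, where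
      \<open>list\<close> applies.\<close>
    have wv: "u = wit (blk u) \<Longrightarrow> u \<noteq> X (blk u) \<Longrightarrow> blk u \<noteq> blk v" for u
      using wit_v Xv by metis
    have fw: "f u = c" if "u = wit (blk u)" "u < n" for u
      using wit_props(3)[OF sw(2,3)[OF that(2)]] that by metis
    consider "x = wit (blk x)" "y = wit (blk y)" | "x = wit (blk x)" "y \<noteq> wit (blk y)"
      | "x \<noteq> wit (blk x)" "y = wit (blk y)" | "x \<noteq> wit (blk x)" "y \<noteq> wit (blk y)" by blast
    then show False
    proof cases
      case 1
      then show False using fw n fxy by metis
    next
      case 2
      then have "f (X (blk x)) = f y" using sw(1) n eq' False by auto
      moreover have "f (X (blk x)) \<notin> f ` set (nb x)"
        using list[OF sw(2,3)[OF n(1)]] wv[OF 2(1)] False 2(1) by metis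
      ultimately show False using xy(3) by auto
    next
      case 3
      then have "f (X (blk y)) = f x" using sw(1) n eq' False by auto
      moreover have "f (X (blk y)) \<notin> f ` set (nb y)"
        using list[OF sw(2,3)[OF n(2)]] wv[OF 3(2)] False 3(2) by metis
      ultimately show False using yx by auto
    next
      case 4
      then show False using sw(1) n eq' False fxy by auto
    qed
  qed
qed

lemma ht_phase:
  assumes P: "proper v f"
  shows "ht W phase_body s0 (\<lambda>s. env s \<and> vars s ''v'' = v \<and> col_ok n s \<and> proper (Suc v) (arrs s ''color'') \<and>
     (\<forall>i. i \<notin> {1..k} \<longrightarrow> arrs s ''T'' i = 0)) phase_cost"
proof -
  let ?s = "set_var ''i'' 1 (set_arr ''stk'' 0 (blk v) (set_var ''p'' 1 (set_var ''o'' (blk v) (set_var ''c'' c s0))))"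
  have e0: "arrs s0 ''color'' v = c" "arrs s0 ''block'' = blk"
    using env_vars(5)[OF env0] by (simp_all add: c_def f_def)
  have init: "same {''c'', ''o'', ''p'', ''i''} {''stk''} s0 ?s"
    by (intro same_upd same_refl) simp_all
  have build: "ht W (For ''i'' ''g'' build_body) ?s
    (\<lambda>s. searching s \<and> arrs s ''T'' = (\<lambda>_. 0) \<and> stack s = rev (roots (Suc k)))
    (k * (b * (D * 21 + 50) + 60) + 4)"
    by (rule ht_build[OF init]) simp_all
  have search: "ht W (While (Var ''p'') search_body) s (\<lambda>s. searching s \<and> stack s = [])
     (cost * (18 * k * (max 1 D)\<^sup>2) + 2)"
    if "searching s \<and> arrs s ''T'' = (\<lambda>_. 0) \<and> stack s = rev (roots (Suc k))" for s
  proof (rule ht_search)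
    show "set (rev (roots (Suc k))) = J" using blk_in[OF v(1)] by (auto simp: roots_def J_def)
  qed (use that in \<open>auto simp: roots_def\<close>)
  have swap: "ht W (For ''i'' ''g'' swap_body) (set_var ''i'' 1 s)
     (\<lambda>s. env s \<and> vars s ''v'' = v \<and> col_ok n s \<and> proper (Suc v) (arrs s ''color'') \<and>
     (\<forall>i. i \<notin> {1..k} \<longrightarrow> arrs s ''T'' i = 0)) (k * 60 + 4)"
    if s: "searching s \<and> stack s = []" for s
  proof -
    define X where "X i = arrs s ''T'' i - 1" for i
    have "walk.valid (arrs s ''T'', stack s)" "stack s = []" using s unfolding searching_def by blast+
    then have valid: "walk.valid (arrs s ''T'', [])" by simp
    have full: "\<exists>r<a. arrs s ''T'' i = Suc (sel i r)" if "1 \<le> i" "i \<le> k" for i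
    proof -
      have "i \<in> J" using that by (simp add: J_def)
      then show ?thesis using valid by (simp add: walk.valid.simps)
    qed
    have TX: "arrs s ''T'' i = Suc (X i)" "X i < n" "blk (X i) = i" "\<exists>r<a. X i = sel i r" if i: "1 \<le> i" "i \<le> k" for i
      using full[OF i] sel_props(1,2)[OF i] by (auto simp: X_def)
    have indep: "X j \<notin> set (nb (X i))" if "1 \<le> i" "i \<le> k" "1 \<le> j" "j \<le> k" for i j
      using valid TX(1)[OF that(1,2)] TX(1)[OF that(3,4)] unfolding walk.valid.simps by blast
    have T0': "arrs s ''T'' i = 0" if "i \<notin> {1..k}" for i
    proof -
      have "i \<notin> J" using that by (simp add: J_def)
      then show ?thesis using valid by (simp add: walk.valid.simps)
    qed
    have bv: "1 \<le> blk v" "blk v \<le> k" using blk_in[OF v(1)] by auto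
    have Xv: "X (blk v) = v" using TX(4)[OF bv] by (auto simp: sel_def)
    have list: "f (X i) \<notin> f ` set (nb (wit i))" if i: "1 \<le> i" "i \<le> k" and "i \<noteq> blk v" for i
    proof -
      obtain r where r: "r < a" "X i = sel i r" using TX(4)[OF i] by blast
      have "f (X i) = cand i ! r" using sel_props(3)[OF i r(1) that(3)] r(2) by simp
      then show ?thesis using cand_nth(3)[OF i r(1)] by simp
    qed
    have "ht W (For ''i'' ''g'' swap_body) (set_var ''i'' 1 s)
       (\<lambda>s'. same {''i'', ''x'', ''w'', ''q''} {''color'', ''at''} (set_var ''i'' 1 s) s' \<and>
         col_ok n s' \<and> (\<forall>u<n. arrs s' ''color'' u = swapped X (Suc k) u)) (k * 60 + 4)"
      by (rule ht_swap) (use s TX in simp_all)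
    then show ?thesis
    proof (rule ht_post)
      fix s' assume s': "same {''i'', ''x'', ''w'', ''q''} {''color'', ''at''} (set_var ''i'' 1 s) s' \<and>
         col_ok n s' \<and> (\<forall>u<n. arrs s' ''color'' u = swapped X (Suc k) u)"
      then have sm: "same {''i'', ''x'', ''w'', ''q''} {''color'', ''at''} (set_var ''i'' 1 s) s'" by blast
      have "env s'" by (rule env_same[OF sm]) (use s in \<open>simp_all add: searching_def\<close>)
      moreover have "vars s' ''v'' = v" using same_vars[OF sm, of "''v''"] s by (simp add: searching_def)
      moreover have "arrs s' ''T'' = arrs s ''T''" using same_arrs[OF sm, of "''T''"] by simp
      moreover have "proper (Suc v) (arrs s' ''color'')"
        by (rule proper_swapped[OF P, of _ X]) (use s' TX Xv list indep in simp_all)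
      ultimately show "env s' \<and> vars s' ''v'' = v \<and> col_ok n s' \<and> proper (Suc v) (arrs s' ''color'') \<and>
        (\<forall>i. i \<notin> {1..k} \<longrightarrow> arrs s' ''T'' i = 0)" using s' T0' by simp
    qed
  qed
  show ?thesis
    unfolding phase_body_def
    apply (rule ht_mono)
     apply (rule ht_Assign_Seq ht_Store_Seq)+
     apply (rule ht_Seq)
      apply (simp add: v e0 W_1)
      apply (rule build[simplified])
     apply (rule ht_Seq)
      apply (rule search, simp)
     apply (rule ht_Assign_Seq)
     apply (simp add: W_1)
     apply (rule swap[simplified], simp)
    apply (simp add: phase_cost_def)
    done
qed

end

section \<open>The algorithm\<close>

definition program :: com where
  "program = Seq (Assign ''h'' (Op Plus (Var ''b'') (Const 1)))
    (Seq (Assign ''g'' (Op Plus (Var ''k'') (Const 1)))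
    (Seq (Assign ''a'' (Op Minus (Var ''b'') (Op Div (Var ''b'') (Const 5))))
    (Seq (For ''e'' ''m'' edge_body)
    (Seq (For ''v'' ''n'' vertex_body)
    (Seq (Assign ''v'' (Const 0))
         (For ''v'' ''n'' phase_body))))))"

context strong_instance
begin

lemma ht_main:
  assumes s: "vars s0 ''v'' = 0" "env s0" "col_ok n s0" "arrs s0 ''T'' = (\<lambda>_. 0)"
  shows "ht W (For ''v'' ''n'' phase_body) s0 (\<lambda>s. col_ok n s \<and> proper n (arrs s ''color''))
    (n * (phase_cost + 9) + 4)"
proof -
  define I where "I j s \<longleftrightarrow> vars s ''v'' = j \<and> env s \<and> col_ok n s \<and> proper j (arrs s ''color'') \<and>
     (\<forall>i. i \<notin> {1..k} \<longrightarrow> arrs s ''T'' i = 0)" for j s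
  have "ht W (For ''v'' ''n'' phase_body) s0 (I n) ((n - 0) * (phase_cost + 9) + 4)"
  proof (rule ht_For)
    fix j s assume "I j s"
    then show "vars s ''v'' = j \<and> vars s ''n'' = n" by (simp add: I_def env_vars)
  next
    fix j s assume I: "I j s" and j: "j < n"
    interpret phase n k b D E B es bs s j
      by unfold_locales (use I j in \<open>auto simp: I_def\<close>)
    show "ht W phase_body s (\<lambda>s'. vars s' ''v'' = j \<and> I (Suc j) (set_var ''v'' (Suc j) s')) phase_cost"
    proof (rule ht_post[OF ht_phase])
      show "proper j f" using I by (simp add: I_def f_def)
    qed (use I in \<open>simp_all add: I_def col_ok_def\<close>)
  next
    show "I 0 s0" using s by (simp add: I_def proper_def)
  qed (use W_1 W_gr[of n] in auto)
  then show ?thesis by (elim ht_post[THEN ht_mono]) (auto simp: I_def)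
qed

lemma strong_coloringI:
  assumes "col_ok n s" "proper n (arrs s ''color'')"
  shows "strong_coloring {..<n} E k b B (arrs s ''color'')"
  unfolding strong_coloring_def
proof (intro conjI ballI allI impI)
  show "arrs s ''color'' \<in> {..<n} \<rightarrow> {1..b}" using assms(1) by (auto simp: col_ok_def)
  show "arrs s ''color'' ` B i = {1..b}" if "i \<in> {1..k}" for i
    using col_inj[OF assms(1) that] by (simp add: bij_betw_def)
  show "arrs s ''color'' u \<noteq> arrs s ''color'' v" if "{u, v} \<in> E" for u v
    using assms(2) E_edge[OF that] that by (auto simp: proper_def nb_iff)
qed

section \<open>Total cost and existence\<close>

definition total_cost :: nat where
  "total_cost = n * D * 60 + n * 40 + n * (phase_cost + 9) + 60"

lemma ht_program:
  "ht W program (input_mem n k b es bs) (\<lambda>s. strong_coloring {..<n} E k b B (arrs s ''color'')) total_cost"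
proof -
  define s0 where "s0 = set_var ''a'' a (set_var ''g'' (Suc k) (set_var ''h'' H (input_mem n k b es bs)))"
  have s0: "vars s0 ''n'' = n" "vars s0 ''m'' = length es" "vars s0 ''v'' = 0" "vars s0 ''e'' = 0"
    "vars s0 ''h'' = H" "vars s0 ''g'' = Suc k" "vars s0 ''a'' = a"
    "arrs s0 ''src'' = array_of (map fst es)" "arrs s0 ''dst'' = array_of (map snd es)" "arrs s0 ''block'' = blk"
    "arrs s0 ''deg'' = (\<lambda>_. 0)" "arrs s0 ''cnt'' = (\<lambda>_. 0)" "arrs s0 ''T'' = (\<lambda>_. 0)"
    by (simp_all add: s0_def input_mem_def blk_def)
  have m: "Suc b mod W = Suc b" "Suc k mod W = Suc k" "5 mod W = 5"
  proof -
    have "2 ^ 3 \<le> W" unfolding W_def word_base_def by (rule power_mono) simp_all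
    then show "5 mod W = 5" by simp
  qed (auto intro!: small_mod)
  have 1: "ht W (For ''e'' ''m'' edge_body) s0
    (\<lambda>s. same {''e'', ''u'', ''w''} {''deg'', ''adj''} s0 s \<and> adj_ok (length es) s) (n * D * 60 + 4)"
    by (rule ht_edges) (rule s0)+
  have 2: "ht W (For ''v'' ''n'' vertex_body) s1
      (\<lambda>s. same {''v'', ''i''} {''cnt'', ''at'', ''color''} s1 s \<and> col_ok n s) (n * 40 + 4)"
    if "same {''e'', ''u'', ''w''} {''deg'', ''adj''} s0 s1 \<and> adj_ok (length es) s1" for s1
    by (rule ht_vertices) (use that s0 in \<open>simp_all add: same_def\<close>)
  have 3: "ht W (For ''v'' ''n'' phase_body) (set_var ''v'' 0 s2)
      (\<lambda>s. strong_coloring {..<n} E k b B (arrs s ''color'')) (n * (phase_cost + 9) + 4)"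
    if s1: "same {''e'', ''u'', ''w''} {''deg'', ''adj''} s0 s1 \<and> adj_ok (length es) s1"
      and s2: "same {''v'', ''i''} {''cnt'', ''at'', ''color''} s1 s2 \<and> col_ok n s2" for s1 s2
  proof -
    have "env s1" using s1 s0 by (simp add: env_def same_def)
    moreover have sm: "same {''v'', ''i''} {''cnt'', ''at'', ''color''} s1 s2" using s2 by (rule conjunct1)
    ultimately have "env s2" by (intro env_same[OF sm]) simp_all
    moreover have "arrs s2 ''T'' = (\<lambda>_. 0)" using s1 s2 s0 by (simp add: same_def)
    ultimately have "ht W (For ''v'' ''n'' phase_body) (set_var ''v'' 0 s2)
        (\<lambda>s. col_ok n s \<and> proper n (arrs s ''color'')) (n * (phase_cost + 9) + 4)"
      using s2 by (intro ht_main) (simp_all add: col_ok_def)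
    then show ?thesis by (rule ht_post) (use strong_coloringI in blast)
  qed
  show ?thesis
    unfolding program_def
    apply (rule ht_mono)
     apply (rule ht_Assign_Seq)+
     apply (rule ht_Seq)
      apply (use m W_1 in \<open>simp add: input_mem_def\<close>)
      apply (rule 1[unfolded s0_def H_def a_def, simplified input_mem_def])
     apply (rule ht_Seq)
      apply (rule 2)
      apply (simp add: s0_def H_def a_def input_mem_def)
     apply (rule ht_Assign_Seq)
     apply simp
     apply (rule 3)
      apply (simp add: s0_def H_def a_def input_mem_def)
     apply simp
    apply (simp add: total_cost_def)
    done
qed

text \<open>The search dominates a phase: O(k M^2) steps of cost O(M), where k M \<le> k b = n
  absorbs one factor M. The coefficients of a phase add up to 71 + 1800 + 60 + 60 + 49 = 2040, and
  then 60 + 40 + 2040 + 60 = 2200. For \<open>n = 0\<close> only the constant remains.\<close>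

lemma total_cost_le: "total_cost \<le> 2200 * (max 1 n)\<^sup>2 * (max 1 D)\<^sup>2"
proof (cases "n = 0")
  case True
  define M where "M = (max 1 D)\<^sup>2"
  have "1 \<le> M" by (simp add: M_def)
  then show ?thesis using True unfolding total_cost_def M_def[symmetric] by simp
next
  case False
  define N where "N = max 1 n"
  define M where "M = max 1 D"
  have n: "n = N" "1 \<le> N" using False by (auto simp: N_def)
  have M: "1 \<le> M" "D \<le> M" by (auto simp: M_def)
  have "b \<noteq> 0" "k \<noteq> 0" using False n_eq by auto
  then have bM: "M \<le> b" using large by (auto simp: M_def)
  have kM: "k * M \<le> N" using bM n_eq n by simp
  have kN: "k \<le> N" using order_trans[OF mult_le_mono2[OF M(1), of k] kM] by simp
  have MM: "M \<le> M\<^sup>2" "1 \<le> M\<^sup>2" using M(1) by (auto simp: power2_eq_square)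
  have "k * (b * (D * 21 + 50)) = N * (D * 21 + 50)" using n_eq n by (metis mult.assoc)
  also have "\<dots> \<le> N * (71 * M\<^sup>2)" using M MM by (intro mult_le_mono2) linarith
  finally have 1: "k * (b * (D * 21 + 50)) \<le> 71 * (N * M\<^sup>2)" by simp
  have "cost \<le> 100 * M" using M by (simp add: cost_def)
  then have "cost * (18 * k * M\<^sup>2) \<le> 100 * M * (18 * k * M\<^sup>2)" by (rule mult_le_mono1)
  also have "\<dots> = 1800 * ((k * M) * M\<^sup>2)" by simp
  also have "\<dots> \<le> 1800 * (N * M\<^sup>2)" by (intro mult_le_mono2 mult_le_mono1 kM)
  finally have 2: "cost * (18 * k * M\<^sup>2) \<le> 1800 * (N * M\<^sup>2)" .
  have NM: "N \<le> N * M\<^sup>2" "1 \<le> N * M\<^sup>2" using MM n by auto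
  have "phase_cost = k * (b * (D * 21 + 50)) + k * 60 + cost * (18 * k * M\<^sup>2) + k * 60 + 40"
    by (simp add: phase_cost_def M_def add_mult_distrib2)
  then have pc: "phase_cost + 9 \<le> 2040 * (N * M\<^sup>2)" using 1 2 kN NM by linarith
  have "N * (phase_cost + 9) \<le> N * (2040 * (N * M\<^sup>2))" by (rule mult_le_mono2[OF pc])
  also have "\<dots> = 2040 * (N\<^sup>2 * M\<^sup>2)" by (simp add: power2_eq_square)
  finally have 3: "N * (phase_cost + 9) \<le> 2040 * (N\<^sup>2 * M\<^sup>2)" .
  have NN: "N \<le> N\<^sup>2" "1 \<le> N\<^sup>2" using n by (auto simp: power2_eq_square)
  have "N * D \<le> N\<^sup>2 * M\<^sup>2" using NN MM M by (intro mult_le_mono) linarith+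
  moreover have "N * 1 \<le> N\<^sup>2 * M\<^sup>2" using NN MM by (intro mult_le_mono)
  moreover have "1 * 1 \<le> N\<^sup>2 * M\<^sup>2" using NN MM by (intro mult_le_mono)
  moreover have "total_cost = N * D * 60 + N * 40 + N * (phase_cost + 9) + 60"
    by (subst total_cost_def) (simp only: n(1)[symmetric])
  ultimately have "total_cost \<le> 2200 * (N\<^sup>2 * M\<^sup>2)" using 3 by linarith
  then show ?thesis by (simp add: N_def M_def mult.assoc)
qed

end

text \<open>If no memory satisfied \<open>P\<close>, the expectation would be infinite. The running
  time bound thus yields the existence of a colouring as well.\<close>

lemma ht_exists:
  assumes "ht W c s P T"
  shows "\<exists>s'. P s'"
proof (rule ccontr)
  assume "\<nexists>s'. P s'"
  then have "expect \<infinity> (run W c (s, 0)) (\<lambda>(s', t'). of_nat t' + (if P s' then 0 else \<infinity>)) =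
      (\<integral>\<^sup>+ \<omega>. \<infinity> \<partial>measure_pmf (run W c (s, 0)))"
    unfolding expect_def by (intro nn_integral_cong) (auto split: option.split)
  moreover have "expect \<infinity> (run W c (s, 0)) (\<lambda>(s', t'). of_nat t' + (if P s' then 0 else \<infinity>)) \<le> of_nat T"
    using assms unfolding ht_def time_le_def by (metis add_0 of_nat_0)
  ultimately show False by (simp add: top_unique)
qed

lemma edge_list_exists:
  fixes E :: "nat set set"
  assumes "simple_graph {..<n} E"
  shows "\<exists>es. edge_list E es"
proof -
  have "E \<subseteq> Pow {..<n}" using assms unfolding simple_graph_def by auto
  then have "finite E" by (rule finite_subset) simp
  then obtain Es where Es: "set Es = E" "distinct Es" using finite_distinct_list by blast
  have "\<forall>e\<in>E. \<exists>p. (case p of (x, y) \<Rightarrow> {x, y}) = e"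
    using assms unfolding simple_graph_def by fastforce
  then obtain g where g: "\<forall>e\<in>E. (case g e of (x, y) \<Rightarrow> {x, y}) = e" by metis
  have "map (\<lambda>(x, y). {x, y}) (map g Es) = Es" using g Es by (auto intro!: map_idI)
  then have "edge_list E (map g Es)" unfolding edge_list_def using Es by metis
  then show ?thesis by blast
qed

lemma block_list_exists:
  assumes "block_partition {..<n} k b B"
  shows "\<exists>bs. block_list n k B bs"
proof -
  have "\<forall>v<n. \<exists>i. i \<in> {1..k} \<and> v \<in> B i" using assms unfolding block_partition_def by blast
  then obtain g where g: "\<forall>v<n. g v \<in> {1..k} \<and> v \<in> B (g v)" by metis
  then have "block_list n k B (map g [0..<n])" by (auto simp: block_list_def)
  then show ?thesis by blast
qed

lemma strong_coloring_exists_nat: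
  fixes E :: "nat set set"
  assumes "simple_graph {..<n} E" "max_degree {..<n} E = D" "block_partition {..<n} k b B" "5 * D \<le> b"
  shows "\<exists>f. strong_coloring {..<n} E k b B f"
proof -
  obtain es where es: "edge_list E es" using edge_list_exists[OF assms(1)] by blast
  obtain bs where bs: "block_list n k B bs" using block_list_exists[OF assms(3)] by blast
  interpret strong_instance n k b D E B es bs by unfold_locales (fact assms es bs)+
  show ?thesis using ht_exists[OF ht_program] by blast
qed

text \<open>The graph is transported to an initial segment of the naturals and the colouring is
  pulled back. For the degrees an upper bound suffices, as it preserves b \<ge> 5 \<Delta>.\<close>

lemma strong_coloring_exists:
  fixes V :: "'a set"
  assumes G: "simple_graph V E" and P: "block_partition V k b B" and large: "5 * max_degree V E \<le> b"
  shows "\<exists>f. strong_coloring V E k b B f"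
proof -
  define n where "n = card V"
  have fin: "finite V" using G by (simp add: simple_graph_def)
  obtain h where "bij_betw h V {0..<card V}" using ex_bij_betw_finite_nat[OF fin] by blast
  then have h: "bij_betw h V {..<n}" by (simp add: n_def lessThan_atLeast0)
  then have inj: "inj_on h V" and img: "h ` V = {..<n}" by (auto simp: bij_betw_def)
  define E' where "E' = (`) h ` E"
  define B' where "B' i = h ` B i" for i
  have EV: "e \<subseteq> V" if "e \<in> E" for e using G that unfolding simple_graph_def by auto
  have BV: "B i \<subseteq> V" if "i \<in> {1..k}" for i using P that unfolding block_partition_def by blast
  have finE: "finite E" by (rule finite_subset[of _ "Pow V"]) (use EV fin in auto)
  have G': "simple_graph {..<n} E'"
    unfolding simple_graph_def
  proof (intro conjI ballI)
    fix e' assume "e' \<in> E'"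
    then obtain u v where uv: "u \<in> V" "v \<in> V" "u \<noteq> v" "e' = {h u, h v}"
      using G unfolding E'_def simple_graph_def by fastforce
    then have "h u \<in> {..<n}" "h v \<in> {..<n}" "h u \<noteq> h v" using img inj by (auto dest: inj_onD)
    then show "\<exists>u v. u \<in> {..<n} \<and> v \<in> {..<n} \<and> u \<noteq> v \<and> e' = {u, v}" using uv by blast
  qed simp
  have deg: "degree E' (h v) \<le> max_degree V E" if "v \<in> V" for v
  proof -
    have "{e \<in> E'. h v \<in> e} \<subseteq> (`) h ` {e \<in> E. v \<in> e}"
      using EV inj that unfolding E'_def by (auto dest!: inj_onD)
    then have "degree E' (h v) \<le> card ((`) h ` {e \<in> E. v \<in> e})"
      unfolding degree_def using finE by (intro card_mono) auto
    also have "\<dots> \<le> degree E v" unfolding degree_def using finE by (intro card_image_le) auto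
    also have "\<dots> \<le> max_degree V E" unfolding max_degree_def using fin that by (intro Max_ge) auto
    finally show ?thesis .
  qed
  have "max_degree (h ` V) E' \<le> max_degree V E"
    unfolding max_degree_def[of "h ` V"] using fin deg by (subst Max_le_iff) auto
  then have "max_degree {..<n} E' \<le> max_degree V E" unfolding img .
  then have large': "5 * max_degree {..<n} E' \<le> b" using large by simp
  have P': "block_partition {..<n} k b B'"
    unfolding block_partition_def
  proof (intro conjI ballI)
    show "(\<Union>i\<in>{1..k}. B' i) = {..<n}"
      using P img unfolding B'_def block_partition_def by (metis image_UN)
    show "disjoint_family_on B' {1..k}"
      unfolding disjoint_family_on_def
    proof (intro ballI impI)
      fix i j assume ij: "i \<in> {1..k}" "j \<in> {1..k}" "i \<noteq> j"
      then have "B i \<inter> B j = {}" using P unfolding block_partition_def disjoint_family_on_def by blast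
      then show "B' i \<inter> B' j = {}"
        unfolding B'_def using inj_on_image_Int[OF inj BV[OF ij(1)] BV[OF ij(2)]] by simp
    qed
    fix i assume i: "i \<in> {1..k}"
    show "card (B' i) = b"
      using P i card_image[OF inj_on_subset[OF inj BV[OF i]]] unfolding B'_def block_partition_def by simp
  qed
  obtain f where f: "strong_coloring {..<n} E' k b B' f"
    using strong_coloring_exists_nat[OF G' refl P' large'] by blast
  have "strong_coloring V E k b B (f \<circ> h)"
    unfolding strong_coloring_def
  proof (intro conjI ballI allI impI)
    show "f \<circ> h \<in> V \<rightarrow> {1..b}"
    proof (rule Pi_I)
      fix x assume "x \<in> V"
      then have "h x \<in> {..<n}" using img by blast
      moreover have "f \<in> {..<n} \<rightarrow> {1..b}" using f unfolding strong_coloring_def by (rule conjunct1)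
      ultimately show "(f \<circ> h) x \<in> {1..b}" unfolding comp_def by (rule funcset_mem[rotated])
    qed
    show "(f \<circ> h) ` B i = {1..b}" if "i \<in> {1..k}" for i
      using f that unfolding strong_coloring_def B'_def by (simp add: image_comp)
    fix u v assume "{u, v} \<in> E"
    then have "h ` {u, v} \<in> E'" unfolding E'_def by blast
    then show "(f \<circ> h) u \<noteq> (f \<circ> h) v" using f unfolding strong_coloring_def by simp
  qed
  then show ?thesis by blast
qed

theorem theorem8p5:
  shows
    "(\<forall>(V :: 'a set) E n k b B \<Delta>.
        simple_graph V E \<and> card V = n \<and> max_degree V E = \<Delta> \<and>
        block_partition V k b B \<and> b \<ge> 5 * \<Delta> \<longrightarrow>
        (\<exists>f. strong_coloring V E k b B f))
     \<and>
     (\<exists>(p :: com) (d :: nat) (C :: real). \<forall>n k b \<Delta> E B es bs.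
        simple_graph {..<n} E \<and> max_degree {..<n} E = \<Delta> \<and>
        block_partition {..<n} k b B \<and> b \<ge> 5 * \<Delta> \<and>
        edge_list E es \<and> block_list n k B bs \<longrightarrow>
        (let r = run (word_base n k b ^ d) p (input_mem n k b es bs, 0) in
           (\<forall>(s, t) \<in> set_spmf r. strong_coloring {..<n} E k b B (arrs s ''color'')) \<and>
           expected_time r \<le> ennreal (C * (real (max 1 n))\<^sup>2 * (real (max 1 \<Delta>))\<^sup>2)))"
proof
  show "\<forall>(V :: 'a set) E n k b B \<Delta>.
        simple_graph V E \<and> card V = n \<and> max_degree V E = \<Delta> \<and>
        block_partition V k b B \<and> b \<ge> 5 * \<Delta> \<longrightarrow>
        (\<exists>f. strong_coloring V E k b B f)"
    using strong_coloring_exists by blast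
  have "let r = run (word_base n k b ^ 3) program (input_mem n k b es bs, 0) in
           (\<forall>(s, t) \<in> set_spmf r. strong_coloring {..<n} E k b B (arrs s ''color'')) \<and>
           expected_time r \<le> ennreal (2200 * (real (max 1 n))\<^sup>2 * (real (max 1 \<Delta>))\<^sup>2)"
    if "simple_graph {..<n} E \<and> max_degree {..<n} E = \<Delta> \<and>
        block_partition {..<n} k b B \<and> b \<ge> 5 * \<Delta> \<and> edge_list E es \<and> block_list n k B bs"
    for n k b \<Delta> E B es bs
  proof -
    interpret strong_instance n k b \<Delta> E B es bs by unfold_locales (use that in auto)
    note run = ht_run[OF ht_program, unfolded W_def]
    have "expected_time (run (word_base n k b ^ 3) program (input_mem n k b es bs, 0)) \<le> of_nat total_cost"
      by (rule run(2))
    also have "\<dots> \<le> of_nat (2200 * (max 1 n)\<^sup>2 * (max 1 \<Delta>)\<^sup>2)" using total_cost_le by (rule of_nat_mono)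
    also have "\<dots> = ennreal (2200 * (real (max 1 n))\<^sup>2 * (real (max 1 \<Delta>))\<^sup>2)"
      unfolding ennreal_of_nat_eq_real_of_nat by simp
    finally show ?thesis using run(1) unfolding Let_def by blast
  qed
  then show "\<exists>(p :: com) (d :: nat) (C :: real). \<forall>n k b \<Delta> E B es bs.
        simple_graph {..<n} E \<and> max_degree {..<n} E = \<Delta> \<and>
        block_partition {..<n} k b B \<and> b \<ge> 5 * \<Delta> \<and>
        edge_list E es \<and> block_list n k B bs \<longrightarrow>
        (let r = run (word_base n k b ^ d) p (input_mem n k b es bs, 0) in
           (\<forall>(s, t) \<in> set_spmf r. strong_coloring {..<n} E k b B (arrs s ''color'')) \<and>
           expected_time r \<le> ennreal (C * (real (max 1 n))\<^sup>2 * (real (max 1 \<Delta>))\<^sup>2))"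
    by blast
qed

end
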